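(* Let $(\mathfrak g_1,\delta_{\mathfrak g_1}),\ldots,(\mathfrak g_n,\delta_{\mathfrak g_n})$, $n\ge2$, be Lie bialgebras, let $(\mathfrak g,\delta_{\mathfrak g})$ be the direct product Lie bialgebra, $\mathfrak g=\mathfrak g_1\oplus\cdots\oplus\mathfrak g_n$, let $t\in\wedge^2\mathfrak g$ be a mixed twisting element of $(\mathfrak g,\delta_{\mathfrak g})$, and let $(\mathfrak g,\delta_{\mathfrak g,t})$ be the corresponding twisted Lie bialgebra, $\delta_{\mathfrak g,t}(x)=\delta_{\mathfrak g}(x)-[x,t]$. 1) Let $(Y_j,\pi_j,\lambda_j)$, $1\le j\le n$, be left $(\mathfrak g_j,\delta_{\mathfrak g_j})$-Poisson spaces, and let $Y=Y_1\times\cdots\times Y_n$ with the product action $\lambda(x_1,\ldots,x_n)=(\lambda_1(x_1),\ldots,\lambda_n(x_n))$ of $\mathfrak g$. Then $\pi_Y=(\pi_1,\ldots,\pi_n)+\lambda(t)$ is a mixed product Poisson structure on $Y$, and $(Y,\pi_Y,\lambda)$ is a left $(\mathfrak g,\delta_{\mathfrak g,t})$-Poisson space. 2) Let $(Y_j,\pi_j,\rho_j)$, $1\le j\le n$, be right $(\mathfrak g_j,\delta_{\mathfrak g_j})$-Poisson spaces, and let $Y=Y_1\times\cdots\times Y_n$ with $\rho(x_1,\ldots,x_n)=(\rho_1(x_1),\ldots,\rho_n(x_n))$. Then $\pi_Y=(\pi_1,\ldots,\pi_n)-\rho(t)$ is a mixed product Poisson structure on $Y$, and $(Y,\pi_Y,\rho)$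 is a right $(\mathfrak g,\delta_{\mathfrak g,t})$-Poisson space. 3) If $r_j\in\mathfrak g_j\otimes\mathfrak g_j$ is a quasitriangular structure for $(\mathfrak g_j,\delta_{\mathfrak g_j})$ and $\pi_j=-\lambda_j(r_j)$ in 1) (resp. $\pi_j=\rho_j(r_j)$ in 2)) for $1\le j\le n$, then $\pi_Y=-\lambda(r-t)$ in 1) (resp. $\pi_Y=\rho(r-t)$ in 2)), where $r=(r_1,\ldots,r_n)$.
   Context: Everything is over $\mathbf k=\mathbb R$ (smooth) or $\mathbb C$ (holomorphic), finite dimensional; $u\wedge v=u\otimes v-v\otimes u$. A Lie bialgebra is a pair $(\mathfrak g,\delta_{\mathfrak g})$ with $\delta_{\mathfrak g}:\mathfrak g\to\wedge^2\mathfrak g$ a 1-cocycle whose dual is a Lie bracket on $\mathfrak g^*$. The direct product Lie bialgebra has the direct product bracket and $\delta_{\mathfrak g}(x_1,\ldots,x_n)=(\delta_{\mathfrak g_1}(x_1),\ldots,\delta_{\mathfrak g_n}(x_n))$. A twisting element of $(\mathfrak g,\delta_{\mathfrak g})$ is $t\in\wedge^2\mathfrak g$ with $\delta_{\mathfrak g}(t)+\tfrac12[t,t]=0$, where $\delta_{\mathfrak g}(x\wedge y)=\delta_{\mathfrak g}(x)\wedge y-x\wedge\delta_{\mathfrak g}(y)$ and $[t,t]\in\wedge^3\mathfrak g$ is the Schouten bracket on $\wedge\mathfrak g$ (identifying $\wedge\mathfrak g$ with left invariant multivector fields). A twisting element $t$ of the direct product is mixed if $p_j(t)=0$ for each projection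 $p_j:\mathfrak g\to\mathfrak g_j$. A left (right) action of $\mathfrak g$ on $Y$ is a Lie algebra anti-homomorphism (homomorphism) $\sigma$ from $\mathfrak g$ to vector fields, extended to tensors by $\sigma(u\otimes v)=\sigma(u)\otimes\sigma(v)$. A left (right) $(\mathfrak g,\delta_{\mathfrak g})$-Poisson space is a triple $(Y,\pi_Y,\sigma)$, $(Y,\pi_Y)$ a Poisson manifold and $\sigma$ a left (right) action with $[\sigma(x),\pi_Y]=\sigma(\delta_{\mathfrak g}(x))$ for all $x$. A quasitriangular structure of $(\mathfrak g,\delta_{\mathfrak g})$ is $r\in\mathfrak g\otimes\mathfrak g$ with ad-invariant symmetric part, $[r_{12},r_{13}]+[r_{12},r_{23}]+[r_{13},r_{23}]=0$, and $\delta_{\mathfrak g}(x)=\mathrm{ad}_xr$. For direct sums or products, $(A_1,\ldots,A_n)$ is the sum of the images of the $A_j$ (tensors or tensor fields) under the inclusions of the factors. A mixed product Poisson structure on $Y_1\times Y_2$ is a Poisson bivector field projecting to well-defined Poisson structures on $Y_1$ and $Y_2$; a Poisson structure on $Y_1\times\cdots\times Y_n$ is a mixed product if its projection to each $Y_i\times Y_j$, $i<j$, is a well-defined mixed product Poisson structure. *)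

theory Defs
  imports "HOL-Analysis.Analysis" "HOL-Library.Function_Algebras"
begin

section \<open>Linear algebra\<close>

text \<open>A finite-dimensional vector space is a finite-dimensional subspace \<open>V\<close> of an arbitrary
  vector space (a type \<open>'v\<close> with scalar multiplication \<open>s\<close>), so that a finite family of spaces of
  different dimensions can be written \<open>V j\<close>. Addition on function types is pointwise
  (\<open>Function_Algebras\<close>).\<close>

definition linear_on ::
  "('k::field \<Rightarrow> 'v::ab_group_add \<Rightarrow> 'v) \<Rightarrow> ('k \<Rightarrow> 'w::ab_group_add \<Rightarrow> 'w) \<Rightarrow> 'v set \<Rightarrow> ('v \<Rightarrow> 'w) \<Rightarrow> bool"
  where "linear_on s s' V f \<longleftrightarrow>
    (\<forall>x\<in>V. \<forall>y\<in>V. f (x + y) = f x + f y) \<and> (\<forall>c. \<forall>x\<in>V. f (s c x) = s' c (f x))"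

definition fin_dim_subspace :: "('k::field \<Rightarrow> 'v::ab_group_add \<Rightarrow> 'v) \<Rightarrow> 'v set \<Rightarrow> bool"
  where "fin_dim_subspace s V \<longleftrightarrow> module.subspace s V \<and> (\<exists>B. finite B \<and> V = module.span s B)"

text \<open>Functionals on \<open>V\<close> are normalised to vanish outside \<open>V\<close>, so that equality in \<open>dual s V\<close>
  is equality on \<open>V\<close>.\<close>

definition cut_to :: "'v set \<Rightarrow> ('v \<Rightarrow> 'k::zero) \<Rightarrow> 'v \<Rightarrow> 'k"
  where "cut_to V f = (\<lambda>x. if x \<in> V then f x else 0)"

definition dual :: "('k::field \<Rightarrow> 'v::ab_group_add \<Rightarrow> 'v) \<Rightarrow> 'v set \<Rightarrow> ('v \<Rightarrow> 'k) set"
  where "dual s V = {\<alpha>. linear_on s (*) V \<alpha> \<and> (\<forall>x. x \<notin> V \<longrightarrow> \<alpha> x = 0)}"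

definition dual_scale :: "'k::field \<Rightarrow> ('v \<Rightarrow> 'k) \<Rightarrow> ('v \<Rightarrow> 'k)"
  where "dual_scale c \<alpha> = (\<lambda>x. c * \<alpha> x)"

text \<open>Tensors are realised as multilinear functions on the dual space (extended by \<open>0\<close>):
  \<open>u \<otimes> v\<close> is \<open>(\<alpha>, \<beta>) \<mapsto> \<alpha> u * \<beta> v\<close>, and \<open>V \<otimes> V\<close> consists of the finite sums of such
  elements. Since functionals on a vector space separate points, this is injective on the
  algebraic tensor product.\<close>

type_synonym ('k, 'v) tensor2 = "('v \<Rightarrow> 'k) \<Rightarrow> ('v \<Rightarrow> 'k) \<Rightarrow> 'k"
type_synonym ('k, 'v) tensor3 = "('v \<Rightarrow> 'k) \<Rightarrow> ('v \<Rightarrow> 'k) \<Rightarrow> ('v \<Rightarrow> 'k) \<Rightarrow> 'k"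

definition tensor ::
  "('k::field \<Rightarrow> 'v::ab_group_add \<Rightarrow> 'v) \<Rightarrow> 'v set \<Rightarrow> 'v \<Rightarrow> 'v \<Rightarrow> ('k, 'v) tensor2"
  where "tensor s V u v =
    (\<lambda>\<alpha> \<beta>. if \<alpha> \<in> dual s V \<and> \<beta> \<in> dual s V then \<alpha> u * \<beta> v else 0)"

definition wedge ::
  "('k::field \<Rightarrow> 'v::ab_group_add \<Rightarrow> 'v) \<Rightarrow> 'v set \<Rightarrow> 'v \<Rightarrow> 'v \<Rightarrow> ('k, 'v) tensor2"
  where "wedge s V u v = tensor s V u v - tensor s V v u"

definition tensor_square ::
  "('k::field \<Rightarrow> 'v::ab_group_add \<Rightarrow> 'v) \<Rightarrow> 'v set \<Rightarrow> ('k, 'v) tensor2 set"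
  where "tensor_square s V = {\<Sum>(u, v)\<leftarrow>us. tensor s V u v | us. set us \<subseteq> V \<times> V}"

definition wedge_square ::
  "('k::field \<Rightarrow> 'v::ab_group_add \<Rightarrow> 'v) \<Rightarrow> 'v set \<Rightarrow> ('k, 'v) tensor2 set"
  where "wedge_square s V = {\<Sum>(u, v)\<leftarrow>us. wedge s V u v | us. set us \<subseteq> V \<times> V}"

definition scale2 :: "'k::field \<Rightarrow> ('k, 'v) tensor2 \<Rightarrow> ('k, 'v) tensor2"
  where "scale2 c \<tau> = (\<lambda>\<alpha> \<beta>. c * \<tau> \<alpha> \<beta>)"

text \<open>\<open>push V s' W f\<close> is \<open>f \<otimes> f : V \<otimes> V \<rightarrow> W \<otimes> W\<close> for a linear map \<open>f : V \<rightarrow> W\<close>.\<close>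

definition push :: "'v set \<Rightarrow> ('k::field \<Rightarrow> 'w::ab_group_add \<Rightarrow> 'w) \<Rightarrow> 'w set \<Rightarrow> ('v \<Rightarrow> 'w)
    \<Rightarrow> ('k, 'v) tensor2 \<Rightarrow> ('k, 'w) tensor2"
  where "push V s' W f \<tau> =
    (\<lambda>\<alpha> \<beta>. if \<alpha> \<in> dual s' W \<and> \<beta> \<in> dual s' W
            then \<tau> (cut_to V (\<lambda>x. \<alpha> (f x))) (cut_to V (\<lambda>x. \<beta> (f x))) else 0)"


section \<open>Lie bialgebras\<close>

definition lie_bracket_on ::
  "('k::field \<Rightarrow> 'v::ab_group_add \<Rightarrow> 'v) \<Rightarrow> 'v set \<Rightarrow> ('v \<Rightarrow> 'v \<Rightarrow> 'v) \<Rightarrow> bool"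
  where "lie_bracket_on s V br \<longleftrightarrow>
    (\<forall>x\<in>V. \<forall>y\<in>V. br x y \<in> V) \<and>
    (\<forall>x\<in>V. linear_on s s V (\<lambda>y. br x y)) \<and>
    (\<forall>y\<in>V. linear_on s s V (\<lambda>x. br x y)) \<and>
    (\<forall>x\<in>V. br x x = 0) \<and>
    (\<forall>x\<in>V. \<forall>y\<in>V. \<forall>z\<in>V. br x (br y z) + br y (br z x) + br z (br x y) = 0)"

record ('k, 'v) bialg =
  underlying :: "'v set"
  brk :: "'v \<Rightarrow> 'v \<Rightarrow> 'v"
  cobr :: "'v \<Rightarrow> ('k, 'v) tensor2"

text \<open>\<open>ad s G x \<tau>\<close> is \<open>[x, \<tau>]\<close> for \<open>\<tau> \<in> V \<otimes> V\<close>, that is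
  \<open>ad_x (u \<otimes> v) = [x, u] \<otimes> v + u \<otimes> [x, v]\<close>.\<close>

definition ad :: "('k::field \<Rightarrow> 'v::ab_group_add \<Rightarrow> 'v) \<Rightarrow> ('k, 'v) bialg \<Rightarrow> 'v
    \<Rightarrow> ('k, 'v) tensor2 \<Rightarrow> ('k, 'v) tensor2"
  where "ad s G x \<tau> =
    (\<lambda>\<alpha> \<beta>. if \<alpha> \<in> dual s (underlying G) \<and> \<beta> \<in> dual s (underlying G)
            then \<tau> (cut_to (underlying G) (\<lambda>u. \<alpha> (brk G x u))) \<beta>
               + \<tau> \<alpha> (cut_to (underlying G) (\<lambda>v. \<beta> (brk G x v)))
            else 0)"

definition dual_brk :: "('k::field, 'v::ab_group_add) bialg \<Rightarrow> ('v \<Rightarrow> 'k) \<Rightarrow> ('v \<Rightarrow> 'k) \<Rightarrow> ('v \<Rightarrow> 'k)"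
  where "dual_brk G \<alpha> \<beta> = cut_to (underlying G) (\<lambda>x. cobr G x \<alpha> \<beta>)"

definition lie_bialgebra ::
  "('k::field \<Rightarrow> 'v::ab_group_add \<Rightarrow> 'v) \<Rightarrow> ('k, 'v) bialg \<Rightarrow> bool"
  where "lie_bialgebra s G \<longleftrightarrow>
    vector_space s \<and> fin_dim_subspace s (underlying G) \<and>
    lie_bracket_on s (underlying G) (brk G) \<and>
    (\<forall>x\<in>underlying G. cobr G x \<in> wedge_square s (underlying G)) \<and>
    linear_on s scale2 (underlying G) (cobr G) \<and>
    (\<forall>x\<in>underlying G. \<forall>y\<in>underlying G.
       cobr G (brk G x y) = ad s G x (cobr G y) - ad s G y (cobr G x)) \<and>
    lie_bracket_on dual_scale (dual s (underlying G)) (dual_brk G)"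


subsection \<open>Twisting elements\<close>

text \<open>The linear extension of \<open>x \<and> y \<mapsto> \<delta>(x) \<and> y - x \<and> \<delta>(y)\<close>; see \<open>cobr_ext_wedge\<close> below.\<close>

definition cobr_ext :: "('k::field, 'v::ab_group_add) bialg \<Rightarrow> ('k, 'v) tensor2 \<Rightarrow> ('k, 'v) tensor3"
  where "cobr_ext G t = (\<lambda>\<alpha> \<beta> \<gamma>.
    t (dual_brk G \<alpha> \<beta>) \<gamma> + t (dual_brk G \<beta> \<gamma>) \<alpha> + t (dual_brk G \<gamma> \<alpha>) \<beta>)"

text \<open>\<open>bracket_12_13\<close> is the bilinear extension of
  \<open>(a \<otimes> b, a' \<otimes> b') \<mapsto> [a, a'] \<otimes> b \<otimes> b'\<close>, and similarly for the other two.\<close>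

definition bracket_12_13 ::
  "('k::field, 'v::ab_group_add) bialg \<Rightarrow> ('k, 'v) tensor2 \<Rightarrow> ('k, 'v) tensor2 \<Rightarrow> ('k, 'v) tensor3"
  where "bracket_12_13 G t t' = (\<lambda>\<alpha> \<beta> \<gamma>.
    t (cut_to (underlying G) (\<lambda>a. t' (cut_to (underlying G) (\<lambda>a'. \<alpha> (brk G a a'))) \<gamma>)) \<beta>)"

definition bracket_12_23 ::
  "('k::field, 'v::ab_group_add) bialg \<Rightarrow> ('k, 'v) tensor2 \<Rightarrow> ('k, 'v) tensor2 \<Rightarrow> ('k, 'v) tensor3"
  where "bracket_12_23 G t t' = (\<lambda>\<alpha> \<beta> \<gamma>.
    t \<alpha> (cut_to (underlying G) (\<lambda>b. t' (cut_to (underlying G) (\<lambda>a'. \<beta> (brk G b a'))) \<gamma>)))"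

definition bracket_13_23 ::
  "('k::field, 'v::ab_group_add) bialg \<Rightarrow> ('k, 'v) tensor2 \<Rightarrow> ('k, 'v) tensor2 \<Rightarrow> ('k, 'v) tensor3"
  where "bracket_13_23 G t t' = (\<lambda>\<alpha> \<beta> \<gamma>.
    t \<alpha> (cut_to (underlying G) (\<lambda>b. t' \<beta> (cut_to (underlying G) (\<lambda>b'. \<gamma> (brk G b b'))))))"

text \<open>The Schouten bracket of bivectors. For antisymmetric \<open>t = \<Sum> a \<otimes> b\<close> and
  \<open>t' = \<Sum> a' \<otimes> b'\<close> it equals \<open>\<Sum> [a, a'] \<and> b \<and> b'\<close>, where \<open>u \<and> v \<and> w\<close> is the alternating
  sum of \<open>u \<otimes> v \<otimes> w\<close> over all six permutations; see \<open>schouten_wedge\<close> below.\<close>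

definition schouten ::
  "('k::field, 'v::ab_group_add) bialg \<Rightarrow> ('k, 'v) tensor2 \<Rightarrow> ('k, 'v) tensor2 \<Rightarrow> ('k, 'v) tensor3"
  where "schouten G t t' = (\<lambda>\<alpha> \<beta> \<gamma>.
      bracket_12_13 G t t' \<alpha> \<beta> \<gamma> + bracket_12_13 G t t' \<beta> \<gamma> \<alpha> + bracket_12_13 G t t' \<gamma> \<alpha> \<beta>
    - bracket_12_13 G t t' \<alpha> \<gamma> \<beta> - bracket_12_13 G t t' \<beta> \<alpha> \<gamma> - bracket_12_13 G t t' \<gamma> \<beta> \<alpha>)"

definition twisting_element ::
  "('k::field \<Rightarrow> 'v::ab_group_add \<Rightarrow> 'v) \<Rightarrow> ('k, 'v) bialg \<Rightarrow> ('k, 'v) tensor2 \<Rightarrow> bool"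
  where "twisting_element s G t \<longleftrightarrow>
    t \<in> wedge_square s (underlying G) \<and>
    (\<forall>\<alpha>\<in>dual s (underlying G). \<forall>\<beta>\<in>dual s (underlying G). \<forall>\<gamma>\<in>dual s (underlying G).
       cobr_ext G t \<alpha> \<beta> \<gamma> + 1 / 2 * schouten G t t \<alpha> \<beta> \<gamma> = 0)"

definition twist :: "('k::field \<Rightarrow> 'v::ab_group_add \<Rightarrow> 'v) \<Rightarrow> ('k, 'v) bialg
    \<Rightarrow> ('k, 'v) tensor2 \<Rightarrow> ('k, 'v) bialg"
  where "twist s G t = G\<lparr>cobr := (\<lambda>x. cobr G x - ad s G x t)\<rparr>"

definition quasitriangular ::
  "('k::field \<Rightarrow> 'v::ab_group_add \<Rightarrow> 'v) \<Rightarrow> ('k, 'v) bialg \<Rightarrow> ('k, 'v) tensor2 \<Rightarrow> bool"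
  where "quasitriangular s G r \<longleftrightarrow>
    r \<in> tensor_square s (underlying G) \<and>
    (\<forall>x\<in>underlying G. ad s G x (\<lambda>\<alpha> \<beta>. 1 / 2 * (r \<alpha> \<beta> + r \<beta> \<alpha>)) = 0) \<and>
    (\<forall>\<alpha>\<in>dual s (underlying G). \<forall>\<beta>\<in>dual s (underlying G). \<forall>\<gamma>\<in>dual s (underlying G).
       bracket_12_13 G r r \<alpha> \<beta> \<gamma> + bracket_12_23 G r r \<alpha> \<beta> \<gamma> + bracket_13_23 G r r \<alpha> \<beta> \<gamma> = 0) \<and>
    (\<forall>x\<in>underlying G. cobr G x = ad s G x r)"


subsection \<open>Direct products\<close>

definition prod_scale :: "('k \<Rightarrow> 'v \<Rightarrow> 'v) \<Rightarrow> 'k \<Rightarrow> (nat \<Rightarrow> 'v) \<Rightarrow> (nat \<Rightarrow> 'v)"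
  where "prod_scale s c x = (\<lambda>j. s c (x j))"

definition prod_space :: "nat set \<Rightarrow> (nat \<Rightarrow> ('k, 'v::zero) bialg) \<Rightarrow> (nat \<Rightarrow> 'v) set"
  where "prod_space J G = {x. (\<forall>j\<in>J. x j \<in> underlying (G j)) \<and> (\<forall>j. j \<notin> J \<longrightarrow> x j = 0)}"

definition incl :: "nat \<Rightarrow> 'v::zero \<Rightarrow> (nat \<Rightarrow> 'v)"
  where "incl j x = (\<lambda>i. if i = j then x else 0)"

text \<open>\<open>prod_tensor s J G A\<close> is \<open>(A_1, \<dots>, A_n)\<close> for \<open>A_j \<in> V_j \<otimes> V_j\<close>.\<close>

definition prod_tensor :: "('k::field \<Rightarrow> 'v::ab_group_add \<Rightarrow> 'v) \<Rightarrow> nat set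
    \<Rightarrow> (nat \<Rightarrow> ('k, 'v) bialg) \<Rightarrow> (nat \<Rightarrow> ('k, 'v) tensor2) \<Rightarrow> ('k, nat \<Rightarrow> 'v) tensor2"
  where "prod_tensor s J G A =
    (\<Sum>j\<in>J. push (underlying (G j)) (prod_scale s) (prod_space J G) (incl j) (A j))"

definition prod_bialg :: "('k::field \<Rightarrow> 'v::ab_group_add \<Rightarrow> 'v) \<Rightarrow> nat set
    \<Rightarrow> (nat \<Rightarrow> ('k, 'v) bialg) \<Rightarrow> ('k, nat \<Rightarrow> 'v) bialg"
  where "prod_bialg s J G =
    \<lparr>underlying = prod_space J G,
     brk = (\<lambda>x y j. if j \<in> J then brk (G j) (x j) (y j) else 0),
     cobr = (\<lambda>x. prod_tensor s J G (\<lambda>j. cobr (G j) (x j)))\<rparr>"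

definition mixed_twisting_element :: "('k::field \<Rightarrow> 'v::ab_group_add \<Rightarrow> 'v) \<Rightarrow> nat set
    \<Rightarrow> (nat \<Rightarrow> ('k, 'v) bialg) \<Rightarrow> ('k, nat \<Rightarrow> 'v) tensor2 \<Rightarrow> bool"
  where "mixed_twisting_element s J G t \<longleftrightarrow>
    twisting_element (prod_scale s) (prod_bialg s J G) t \<and>
    (\<forall>j\<in>J. push (prod_space J G) s (underlying (G j)) (\<lambda>x. x j) t = 0)"


section \<open>Manifolds\<close>

text \<open>Everything below is over a field \<open>'k :: real_normed_field\<close>; by the theorems of Ostrowski and
  Gelfand-Mazur such a field is \<open>\<real>\<close> or \<open>\<complex>\<close>. Differentiation is differentiation over \<open>'k\<close>, so
  \<open>smooth_on\<close> means \<open>C\<^sup>\<infinity>\<close> over \<open>\<real>\<close> and holomorphic over \<open>\<complex>\<close> (a function with continuous complex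
  partial derivatives is holomorphic, and holomorphic functions are infinitely differentiable).
  Coordinates are indexed by a finite set \<open>I\<close>; \<open>\<open>'k\<close>\<^sup>I\<close> is \<open>PiE I (\<lambda>_. UNIV)\<close>.\<close>

definition coord_space :: "'i set \<Rightarrow> ('i \<Rightarrow> 'k::topological_space) topology"
  where "coord_space I = product_topology (\<lambda>_. euclidean) I"

definition partial :: "'i \<Rightarrow> (('i \<Rightarrow> 'k::real_normed_field) \<Rightarrow> 'k) \<Rightarrow> ('i \<Rightarrow> 'k) \<Rightarrow> 'k"
  where "partial i f x = deriv (\<lambda>z. f (x(i := z))) (x i)"

primrec Ck_on :: "nat \<Rightarrow> 'i set \<Rightarrow> ('i \<Rightarrow> 'k::real_normed_field) set \<Rightarrow> (('i \<Rightarrow> 'k) \<Rightarrow> 'k) \<Rightarrow> bool"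
  where
    "Ck_on 0 I W f \<longleftrightarrow> continuous_map (subtopology (coord_space I) W) euclidean f"
  | "Ck_on (Suc k) I W f \<longleftrightarrow>
       continuous_map (subtopology (coord_space I) W) euclidean f \<and>
       (\<forall>i\<in>I. (\<forall>x\<in>W. (\<lambda>z. f (x(i := z))) field_differentiable at (x i)) \<and>
               Ck_on k I W (partial i f))"

definition smooth_on :: "'i set \<Rightarrow> ('i \<Rightarrow> 'k::real_normed_field) set \<Rightarrow> (('i \<Rightarrow> 'k) \<Rightarrow> 'k) \<Rightarrow> bool"
  where "smooth_on I W f \<longleftrightarrow> (\<forall>k. Ck_on k I W f)"

text \<open>A manifold carries an atlas indexed by a set of labels \<open>charts\<close>: the chart with label \<open>c\<close> is
  \<open>coord c\<close> on \<open>chart_dom c\<close>, with values in \<open>\<open>'k\<close>\<^sup>I\<close> for \<open>I = idx\<close>.\<close>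

record ('a, 'c, 'i, 'k) manifold =
  mtop :: "'a topology"
  idx :: "'i set"
  charts :: "'c set"
  chart_dom :: "'c \<Rightarrow> 'a set"
  coord :: "'c \<Rightarrow> 'a \<Rightarrow> 'i \<Rightarrow> 'k"

text \<open>\<open>in_chart M c h\<close> is the coordinate expression of a function \<open>h\<close> on \<open>M\<close>, and
  \<open>chart_deriv M c i h p\<close> is \<open>(\<partial>h/\<partial>x\<^sub>i)(p)\<close> in the coordinates of \<open>c\<close>.\<close>

definition in_chart :: "('a, 'c, 'i, 'k) manifold \<Rightarrow> 'c \<Rightarrow> ('a \<Rightarrow> 'k) \<Rightarrow> ('i \<Rightarrow> 'k) \<Rightarrow> 'k"
  where "in_chart M c h = (\<lambda>x. h (inv_into (chart_dom M c) (coord M c) x))"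

definition chart_deriv ::
  "('a, 'c, 'i, 'k::real_normed_field) manifold \<Rightarrow> 'c \<Rightarrow> 'i \<Rightarrow> ('a \<Rightarrow> 'k) \<Rightarrow> 'a \<Rightarrow> 'k"
  where "chart_deriv M c i h p = partial i (in_chart M c h) (coord M c p)"

definition is_manifold :: "('a, 'c, 'i, 'k::real_normed_field) manifold \<Rightarrow> bool"
  where "is_manifold M \<longleftrightarrow>
    Hausdorff_space (mtop M) \<and> second_countable (mtop M) \<and> finite (idx M) \<and>
    (\<Union>c\<in>charts M. chart_dom M c) = topspace (mtop M) \<and>
    (\<forall>c\<in>charts M.
       openin (mtop M) (chart_dom M c) \<and>
       openin (coord_space (idx M)) (coord M c ` chart_dom M c) \<and>
       homeomorphic_map (subtopology (mtop M) (chart_dom M c))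
         (subtopology (coord_space (idx M)) (coord M c ` chart_dom M c)) (coord M c)) \<and>
    (\<forall>c\<in>charts M. \<forall>c'\<in>charts M. \<forall>i\<in>idx M.
       smooth_on (idx M) (coord M c ` (chart_dom M c \<inter> chart_dom M c')) (in_chart M c (\<lambda>p. coord M c' p i)))"


subsection \<open>Vector fields and contravariant 2-tensor fields\<close>

text \<open>Tensor fields are given by their components in the charts of the atlas, which are smooth and
  transform with the Jacobian. Components outside chart domains or for indices outside \<open>idx\<close>
  carry no meaning, so tensor fields are compared with \<open>vf_eq\<close> and \<open>tf_eq\<close>.\<close>

type_synonym ('a, 'c, 'i, 'k) vfield = "'c \<Rightarrow> 'a \<Rightarrow> 'i \<Rightarrow> 'k"
type_synonym ('a, 'c, 'i, 'k) tfield = "'c \<Rightarrow> 'a \<Rightarrow> 'i \<Rightarrow> 'i \<Rightarrow> 'k"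

definition vf_eq ::
  "('a, 'c, 'i, 'k) manifold \<Rightarrow> ('a, 'c, 'i, 'k) vfield \<Rightarrow> ('a, 'c, 'i, 'k) vfield \<Rightarrow> bool"
  where "vf_eq M X X' \<longleftrightarrow> (\<forall>c\<in>charts M. \<forall>p\<in>chart_dom M c. \<forall>a\<in>idx M. X c p a = X' c p a)"

definition tf_eq ::
  "('a, 'c, 'i, 'k) manifold \<Rightarrow> ('a, 'c, 'i, 'k) tfield \<Rightarrow> ('a, 'c, 'i, 'k) tfield \<Rightarrow> bool"
  where "tf_eq M T T' \<longleftrightarrow>
    (\<forall>c\<in>charts M. \<forall>p\<in>chart_dom M c. \<forall>a\<in>idx M. \<forall>b\<in>idx M. T c p a b = T' c p a b)"

definition vector_field ::
  "('a, 'c, 'i, 'k::real_normed_field) manifold \<Rightarrow> ('a, 'c, 'i, 'k) vfield \<Rightarrow> bool"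
  where "vector_field M X \<longleftrightarrow>
    (\<forall>c\<in>charts M. \<forall>a\<in>idx M.
       smooth_on (idx M) (coord M c ` chart_dom M c) (in_chart M c (\<lambda>p. X c p a))) \<and>
    (\<forall>c\<in>charts M. \<forall>c'\<in>charts M. \<forall>p\<in>chart_dom M c \<inter> chart_dom M c'. \<forall>a\<in>idx M.
       X c' p a = (\<Sum>d\<in>idx M. chart_deriv M c d (\<lambda>q. coord M c' q a) p * X c p d))"

definition tensor_field ::
  "('a, 'c, 'i, 'k::real_normed_field) manifold \<Rightarrow> ('a, 'c, 'i, 'k) tfield \<Rightarrow> bool"
  where "tensor_field M T \<longleftrightarrow>
    (\<forall>c\<in>charts M. \<forall>a\<in>idx M. \<forall>b\<in>idx M.
       smooth_on (idx M) (coord M c ` chart_dom M c) (in_chart M c (\<lambda>p. T c p a b))) \<and>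
    (\<forall>c\<in>charts M. \<forall>c'\<in>charts M. \<forall>p\<in>chart_dom M c \<inter> chart_dom M c'. \<forall>a\<in>idx M. \<forall>b\<in>idx M.
       T c' p a b = (\<Sum>d\<in>idx M. \<Sum>e\<in>idx M.
         chart_deriv M c d (\<lambda>q. coord M c' q a) p *
         chart_deriv M c e (\<lambda>q. coord M c' q b) p * T c p d e))"

definition bivector_field ::
  "('a, 'c, 'i, 'k::real_normed_field) manifold \<Rightarrow> ('a, 'c, 'i, 'k) tfield \<Rightarrow> bool"
  where "bivector_field M P \<longleftrightarrow> tensor_field M P \<and> tf_eq M P (\<lambda>c p a b. - P c p b a)"

definition vf_bracket :: "('a, 'c, 'i, 'k::real_normed_field) manifold
    \<Rightarrow> ('a, 'c, 'i, 'k) vfield \<Rightarrow> ('a, 'c, 'i, 'k) vfield \<Rightarrow> ('a, 'c, 'i, 'k) vfield"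
  where "vf_bracket M X X' = (\<lambda>c p a. \<Sum>d\<in>idx M.
    X c p d * chart_deriv M c d (\<lambda>q. X' c q a) p - X' c p d * chart_deriv M c d (\<lambda>q. X c q a) p)"

text \<open>The Schouten bracket \<open>[X, T]\<close> of a vector field with a contravariant 2-tensor field is the Lie
  derivative.\<close>

definition vf_tf_bracket :: "('a, 'c, 'i, 'k::real_normed_field) manifold
    \<Rightarrow> ('a, 'c, 'i, 'k) vfield \<Rightarrow> ('a, 'c, 'i, 'k) tfield \<Rightarrow> ('a, 'c, 'i, 'k) tfield"
  where "vf_tf_bracket M X T = (\<lambda>c p a b. \<Sum>d\<in>idx M.
      X c p d * chart_deriv M c d (\<lambda>q. T c q a b) p
    - T c p d b * chart_deriv M c d (\<lambda>q. X c q a) p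
    - T c p a d * chart_deriv M c d (\<lambda>q. X c q b) p)"

text \<open>The Schouten bracket of bivector fields \<open>P = \<Sum> P\<^sup>a\<^sup>b \<partial>\<^sub>a \<otimes> \<partial>\<^sub>b\<close> and \<open>Q\<close>, with the same
  normalisation and sign as \<open>schouten\<close>.\<close>

definition tf_bracket :: "('a, 'c, 'i, 'k::real_normed_field) manifold
    \<Rightarrow> ('a, 'c, 'i, 'k) tfield \<Rightarrow> ('a, 'c, 'i, 'k) tfield
    \<Rightarrow> 'c \<Rightarrow> 'a \<Rightarrow> 'i \<Rightarrow> 'i \<Rightarrow> 'i \<Rightarrow> 'k"
  where "tf_bracket M P Q = (\<lambda>c p a b e. \<Sum>d\<in>idx M.
      P c p a d * chart_deriv M c d (\<lambda>q. Q c q b e) p + Q c p a d * chart_deriv M c d (\<lambda>q. P c q b e) p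
    + P c p b d * chart_deriv M c d (\<lambda>q. Q c q e a) p + Q c p b d * chart_deriv M c d (\<lambda>q. P c q e a) p
    + P c p e d * chart_deriv M c d (\<lambda>q. Q c q a b) p + Q c p e d * chart_deriv M c d (\<lambda>q. P c q a b) p)"

definition poisson_structure ::
  "('a, 'c, 'i, 'k::real_normed_field) manifold \<Rightarrow> ('a, 'c, 'i, 'k) tfield \<Rightarrow> bool"
  where "poisson_structure M P \<longleftrightarrow>
    is_manifold M \<and> bivector_field M P \<and>
    (\<forall>c\<in>charts M. \<forall>p\<in>chart_dom M c. \<forall>a\<in>idx M. \<forall>b\<in>idx M. \<forall>e\<in>idx M. tf_bracket M P P c p a b e = 0)"


subsection \<open>Actions and Poisson spaces\<close>

definition linear_to_vector_fields :: "('k::real_normed_field \<Rightarrow> 'v::ab_group_add \<Rightarrow> 'v) \<Rightarrow> 'v set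
    \<Rightarrow> ('a, 'c, 'i, 'k) manifold \<Rightarrow> ('v \<Rightarrow> ('a, 'c, 'i, 'k) vfield) \<Rightarrow> bool"
  where "linear_to_vector_fields s V M \<sigma> \<longleftrightarrow>
    (\<forall>x\<in>V. vector_field M (\<sigma> x)) \<and>
    (\<forall>x\<in>V. \<forall>y\<in>V. vf_eq M (\<sigma> (x + y)) (\<sigma> x + \<sigma> y)) \<and>
    (\<forall>k. \<forall>x\<in>V. vf_eq M (\<sigma> (s k x)) (\<lambda>c p a. k * \<sigma> x c p a))"

definition left_action :: "('k::real_normed_field \<Rightarrow> 'v::ab_group_add \<Rightarrow> 'v) \<Rightarrow> ('k, 'v) bialg
    \<Rightarrow> ('a, 'c, 'i, 'k) manifold \<Rightarrow> ('v \<Rightarrow> ('a, 'c, 'i, 'k) vfield) \<Rightarrow> bool"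
  where "left_action s G M \<sigma> \<longleftrightarrow>
    linear_to_vector_fields s (underlying G) M \<sigma> \<and>
    (\<forall>x\<in>underlying G. \<forall>y\<in>underlying G. vf_eq M (\<sigma> (brk G x y)) (- vf_bracket M (\<sigma> x) (\<sigma> y)))"

definition right_action :: "('k::real_normed_field \<Rightarrow> 'v::ab_group_add \<Rightarrow> 'v) \<Rightarrow> ('k, 'v) bialg
    \<Rightarrow> ('a, 'c, 'i, 'k) manifold \<Rightarrow> ('v \<Rightarrow> ('a, 'c, 'i, 'k) vfield) \<Rightarrow> bool"
  where "right_action s G M \<sigma> \<longleftrightarrow>
    linear_to_vector_fields s (underlying G) M \<sigma> \<and>
    (\<forall>x\<in>underlying G. \<forall>y\<in>underlying G. vf_eq M (\<sigma> (brk G x y)) (vf_bracket M (\<sigma> x) (\<sigma> y)))"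

text \<open>The linear extension of \<open>\<sigma>(u \<otimes> v) = \<sigma>(u) \<otimes> \<sigma>(v)\<close>: for fixed chart, point and index,
  \<open>x \<mapsto> \<sigma> x c p a\<close> is a functional on \<open>V\<close>; see \<open>act_tensor\<close> below.\<close>

definition act ::
  "'v set \<Rightarrow> ('v \<Rightarrow> ('a, 'c, 'i, 'k::zero) vfield) \<Rightarrow> ('k, 'v) tensor2 \<Rightarrow> ('a, 'c, 'i, 'k) tfield"
  where "act V \<sigma> t = (\<lambda>c p a b. t (cut_to V (\<lambda>x. \<sigma> x c p a)) (cut_to V (\<lambda>x. \<sigma> x c p b)))"

definition left_poisson_space :: "('k::real_normed_field \<Rightarrow> 'v::ab_group_add \<Rightarrow> 'v) \<Rightarrow> ('k, 'v) bialg
    \<Rightarrow> ('a, 'c, 'i, 'k) manifold \<Rightarrow> ('a, 'c, 'i, 'k) tfield \<Rightarrow> ('v \<Rightarrow> ('a, 'c, 'i, 'k) vfield) \<Rightarrow> bool"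
  where "left_poisson_space s G M P \<sigma> \<longleftrightarrow>
    lie_bialgebra s G \<and> poisson_structure M P \<and> left_action s G M \<sigma> \<and>
    (\<forall>x\<in>underlying G. tf_eq M (vf_tf_bracket M (\<sigma> x) P) (act (underlying G) \<sigma> (cobr G x)))"

definition right_poisson_space :: "('k::real_normed_field \<Rightarrow> 'v::ab_group_add \<Rightarrow> 'v) \<Rightarrow> ('k, 'v) bialg
    \<Rightarrow> ('a, 'c, 'i, 'k) manifold \<Rightarrow> ('a, 'c, 'i, 'k) tfield \<Rightarrow> ('v \<Rightarrow> ('a, 'c, 'i, 'k) vfield) \<Rightarrow> bool"
  where "right_poisson_space s G M P \<sigma> \<longleftrightarrow>
    lie_bialgebra s G \<and> poisson_structure M P \<and> right_action s G M \<sigma> \<and>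
    (\<forall>x\<in>underlying G. tf_eq M (vf_tf_bracket M (\<sigma> x) P) (act (underlying G) \<sigma> (cobr G x)))"


subsection \<open>Product manifolds and mixed product Poisson structures\<close>

text \<open>Points of the product over \<open>J\<close> are extensional families; the charts are products of charts of
  the factors, and \<open>(j, a)\<close> is the index of the coordinate \<open>a\<close> of the factor \<open>j\<close>.\<close>

definition prod_manifold :: "nat set \<Rightarrow> (nat \<Rightarrow> ('a, 'c, 'i, 'k) manifold)
    \<Rightarrow> (nat \<Rightarrow> 'a, nat \<Rightarrow> 'c, nat \<times> 'i, 'k) manifold"
  where "prod_manifold J M =
    \<lparr>mtop = product_topology (\<lambda>j. mtop (M j)) J,
     idx = (SIGMA j:J. idx (M j)),
     charts = (\<Pi>\<^sub>E j\<in>J. charts (M j)),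
     chart_dom = (\<lambda>c. \<Pi>\<^sub>E j\<in>J. chart_dom (M j) (c j)),
     coord = (\<lambda>c p. \<lambda>(j, a)\<in>(SIGMA j:J. idx (M j)). coord (M j) (c j) (p j) a)\<rparr>"

text \<open>\<open>prod_vf X\<close> is \<open>(X_1, \<dots>, X_n)\<close> and \<open>prod_tf T\<close> is \<open>(T_1, \<dots>, T_n)\<close>, in product charts.\<close>

definition prod_vf :: "(nat \<Rightarrow> ('a, 'c, 'i, 'k) vfield)
    \<Rightarrow> (nat \<Rightarrow> 'a, nat \<Rightarrow> 'c, nat \<times> 'i, 'k) vfield"
  where "prod_vf X = (\<lambda>c p (j, a). X j (c j) (p j) a)"

definition prod_tf :: "(nat \<Rightarrow> ('a, 'c, 'i, 'k::zero) tfield)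
    \<Rightarrow> (nat \<Rightarrow> 'a, nat \<Rightarrow> 'c, nat \<times> 'i, 'k) tfield"
  where "prod_tf T = (\<lambda>c p (j, a) (l, b). if j = l then T j (c j) (p j) a b else 0)"

definition prod_action :: "(nat \<Rightarrow> 'v \<Rightarrow> ('a, 'c, 'i, 'k) vfield)
    \<Rightarrow> (nat \<Rightarrow> 'v) \<Rightarrow> (nat \<Rightarrow> 'a, nat \<Rightarrow> 'c, nat \<times> 'i, 'k) vfield"
  where "prod_action \<sigma> x = prod_vf (\<lambda>j. \<sigma> j (x j))"

text \<open>\<open>T\<close> projects to \<open>S\<close> under \<open>F : M \<rightarrow> N\<close>: \<open>F\<^sub>*(T p) = S (F p)\<close> for all points \<open>p\<close> of \<open>M\<close>.\<close>

definition projects_to ::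
  "('a, 'c, 'i, 'k::real_normed_field) manifold \<Rightarrow> ('b, 'd, 'j, 'k) manifold \<Rightarrow> ('a \<Rightarrow> 'b)
    \<Rightarrow> ('a, 'c, 'i, 'k) tfield \<Rightarrow> ('b, 'd, 'j, 'k) tfield \<Rightarrow> bool"
  where "projects_to M N F T S \<longleftrightarrow>
    (\<forall>c\<in>charts M. \<forall>c'\<in>charts N. \<forall>p\<in>chart_dom M c. F p \<in> chart_dom N c' \<longrightarrow>
      (\<forall>a\<in>idx N. \<forall>b\<in>idx N.
         S c' (F p) a b = (\<Sum>d\<in>idx M. \<Sum>e\<in>idx M.
           chart_deriv M c d (\<lambda>q. coord N c' (F q) a) p *
           chart_deriv M c e (\<lambda>q. coord N c' (F q) b) p * T c p d e)))"

definition mixed_product_pair :: "(nat \<Rightarrow> ('a, 'c, 'i, 'k::real_normed_field) manifold)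
    \<Rightarrow> nat \<Rightarrow> nat \<Rightarrow> (nat \<Rightarrow> 'a, nat \<Rightarrow> 'c, nat \<times> 'i, 'k) tfield \<Rightarrow> bool"
  where "mixed_product_pair M i j P \<longleftrightarrow>
    poisson_structure (prod_manifold {i, j} M) P \<and>
    (\<forall>l\<in>{i, j}. \<exists>Q. poisson_structure (M l) Q \<and>
       projects_to (prod_manifold {i, j} M) (M l) (\<lambda>p. p l) P Q)"

definition mixed_product_poisson :: "nat set \<Rightarrow> (nat \<Rightarrow> ('a, 'c, 'i, 'k::real_normed_field) manifold)
    \<Rightarrow> (nat \<Rightarrow> 'a, nat \<Rightarrow> 'c, nat \<times> 'i, 'k) tfield \<Rightarrow> bool"
  where "mixed_product_poisson J M P \<longleftrightarrow>
    poisson_structure (prod_manifold J M) P \<and>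
    (\<forall>i\<in>J. \<forall>j\<in>J. i < j \<longrightarrow>
       (\<exists>Q. mixed_product_pair M i j Q \<and>
          projects_to (prod_manifold J M) (prod_manifold {i, j} M) (\<lambda>p. restrict p {i, j}) P Q))"


section \<open>The definitions on decomposable tensors\<close>

lemma cut_to_in_dual:
  assumes "vector_space s" "module.subspace s V" "linear_on s (*) V f"
  shows "cut_to V f \<in> dual s V"
proof -
  interpret vector_space s by fact
  show ?thesis
    using assms(2,3) unfolding linear_on_def cut_to_def dual_def
    by (auto simp: subspace_add subspace_scale)
qed

lemma cut_to_apply: "x \<in> V \<Longrightarrow> cut_to V f x = f x"
  by (simp add: cut_to_def)

lemma act_tensor:
  assumes "vector_space s" "module.subspace s V" "u \<in> V" "v \<in> V"
    and "linear_on s (*) V (\<lambda>x. \<sigma> x c p a)" "linear_on s (*) V (\<lambda>x. \<sigma> x c p b)"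
  shows "act V \<sigma> (tensor s V u v) c p a b = \<sigma> u c p a * \<sigma> v c p b"
  using cut_to_in_dual[OF assms(1,2,5)] cut_to_in_dual[OF assms(1,2,6)] assms(3,4)
  by (simp add: act_def tensor_def cut_to_apply)

definition wedge3 :: "'v \<Rightarrow> 'v \<Rightarrow> 'v \<Rightarrow> ('k::field, 'v) tensor3"
  where "wedge3 u v w = (\<lambda>\<alpha> \<beta> \<gamma>.
      \<alpha> u * \<beta> v * \<gamma> w + \<alpha> v * \<beta> w * \<gamma> u + \<alpha> w * \<beta> u * \<gamma> v
    - \<alpha> u * \<beta> w * \<gamma> v - \<alpha> v * \<beta> u * \<gamma> w - \<alpha> w * \<beta> v * \<gamma> u)"

context
  fixes s :: "'k::field \<Rightarrow> 'v::ab_group_add \<Rightarrow> 'v" and G :: "('k, 'v) bialg" and V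
  assumes G: "lie_bialgebra s G"
  defines "V \<equiv> underlying G"
begin

lemma subspace_V: "vector_space s" "module.subspace s V"
  using G by (auto simp: lie_bialgebra_def fin_dim_subspace_def V_def)

lemma brk_in_V: "x \<in> V \<Longrightarrow> y \<in> V \<Longrightarrow> brk G x y \<in> V"
  using G by (auto simp: lie_bialgebra_def lie_bracket_on_def V_def)

lemma brk_dual:
  assumes "\<alpha> \<in> dual s V" "x \<in> V"
  shows "linear_on s (*) V (\<lambda>y. \<alpha> (brk G x y))" "linear_on s (*) V (\<lambda>y. \<alpha> (brk G y x))"
  using G assms brk_in_V
  unfolding lie_bialgebra_def lie_bracket_on_def dual_def linear_on_def V_def by auto

lemma brk_cut_to_dual:
  assumes "\<alpha> \<in> dual s V" "x \<in> V"
  shows "cut_to V (\<lambda>y. \<alpha> (brk G x y)) \<in> dual s V" "cut_to V (\<lambda>y. \<alpha> (brk G y x)) \<in> dual s V"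
  using brk_dual[OF assms] cut_to_in_dual[OF subspace_V] by auto

lemma ad_tensor:
  assumes "x \<in> V" "u \<in> V" "v \<in> V"
  shows "ad s G x (tensor s V u v) = tensor s V (brk G x u) v + tensor s V u (brk G x v)"
  using assms brk_cut_to_dual
  by (auto simp: ad_def tensor_def fun_eq_iff cut_to_apply simp flip: V_def)

lemma dual_brk_in_dual:
  "\<alpha> \<in> dual s V \<Longrightarrow> \<beta> \<in> dual s V \<Longrightarrow> dual_brk G \<alpha> \<beta> \<in> dual s V"
  using G by (simp add: lie_bialgebra_def lie_bracket_on_def V_def)

lemma cobr_ext_wedge:
  assumes "x \<in> V" "y \<in> V" "\<alpha> \<in> dual s V" "\<beta> \<in> dual s V" "\<gamma> \<in> dual s V"
  shows "cobr_ext G (wedge s V x y) \<alpha> \<beta> \<gamma> =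
    (cobr G x \<alpha> \<beta> * \<gamma> y + cobr G x \<beta> \<gamma> * \<alpha> y + cobr G x \<gamma> \<alpha> * \<beta> y) -
    (\<alpha> x * cobr G y \<beta> \<gamma> + \<beta> x * cobr G y \<gamma> \<alpha> + \<gamma> x * cobr G y \<alpha> \<beta>)"
  using assms dual_brk_in_dual
  by (simp add: cobr_ext_def wedge_def tensor_def)
     (simp add: dual_brk_def cut_to_apply algebra_simps flip: V_def)

lemma bracket_12_13_tensor:
  assumes "a \<in> V" "b \<in> V" "a' \<in> V" "b' \<in> V" "\<alpha> \<in> dual s V" "\<beta> \<in> dual s V" "\<gamma> \<in> dual s V"
  shows "bracket_12_13 G (tensor s V a b) (tensor s V a' b') \<alpha> \<beta> \<gamma> = \<alpha> (brk G a a') * \<beta> b * \<gamma> b'"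
proof -
  have eq: "cut_to V (\<lambda>x. tensor s V a' b' (cut_to V (\<lambda>y. \<alpha> (brk G x y))) \<gamma>) =
    cut_to V (\<lambda>x. \<alpha> (brk G x a') * \<gamma> b')"
    using assms brk_cut_to_dual by (auto simp: cut_to_def tensor_def fun_eq_iff)
  have "cut_to V (\<lambda>x. \<alpha> (brk G x a') * \<gamma> b') \<in> dual s V"
    using brk_dual(2)[OF assms(5,3)]
    by (intro cut_to_in_dual subspace_V) (auto simp: linear_on_def algebra_simps)
  then show ?thesis
    using assms unfolding bracket_12_13_def V_def[symmetric] eq by (simp add: tensor_def cut_to_apply)
qed

lemma bracket_12_23_tensor:
  assumes "a \<in> V" "b \<in> V" "a' \<in> V" "b' \<in> V" "\<alpha> \<in> dual s V" "\<beta> \<in> dual s V" "\<gamma> \<in> dual s V"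
  shows "bracket_12_23 G (tensor s V a b) (tensor s V a' b') \<alpha> \<beta> \<gamma> = \<alpha> a * \<beta> (brk G b a') * \<gamma> b'"
proof -
  have eq: "cut_to V (\<lambda>x. tensor s V a' b' (cut_to V (\<lambda>y. \<beta> (brk G x y))) \<gamma>) =
    cut_to V (\<lambda>x. \<beta> (brk G x a') * \<gamma> b')"
    using assms brk_cut_to_dual by (auto simp: cut_to_def tensor_def fun_eq_iff)
  have "cut_to V (\<lambda>x. \<beta> (brk G x a') * \<gamma> b') \<in> dual s V"
    using brk_dual(2)[OF assms(6,3)]
    by (intro cut_to_in_dual subspace_V) (auto simp: linear_on_def algebra_simps)
  then show ?thesis
    using assms unfolding bracket_12_23_def V_def[symmetric] eq by (simp add: tensor_def cut_to_apply)
qed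

lemma bracket_13_23_tensor:
  assumes "a \<in> V" "b \<in> V" "a' \<in> V" "b' \<in> V" "\<alpha> \<in> dual s V" "\<beta> \<in> dual s V" "\<gamma> \<in> dual s V"
  shows "bracket_13_23 G (tensor s V a b) (tensor s V a' b') \<alpha> \<beta> \<gamma> = \<alpha> a * \<beta> a' * \<gamma> (brk G b b')"
proof -
  have eq: "cut_to V (\<lambda>x. tensor s V a' b' \<beta> (cut_to V (\<lambda>y. \<gamma> (brk G x y)))) =
    cut_to V (\<lambda>x. \<beta> a' * \<gamma> (brk G x b'))"
    using assms brk_cut_to_dual by (auto simp: cut_to_def tensor_def fun_eq_iff)
  have "cut_to V (\<lambda>x. \<beta> a' * \<gamma> (brk G x b')) \<in> dual s V"
    using brk_dual(2)[OF assms(7,4)]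
    by (intro cut_to_in_dual subspace_V) (auto simp: linear_on_def algebra_simps)
  then show ?thesis
    using assms unfolding bracket_13_23_def V_def[symmetric] eq by (simp add: tensor_def cut_to_apply)
qed

lemma bracket_12_13_wedge:
  assumes "x \<in> V" "y \<in> V" "z \<in> V" "w \<in> V" "\<alpha> \<in> dual s V" "\<beta> \<in> dual s V" "\<gamma> \<in> dual s V"
  shows "bracket_12_13 G (wedge s V x y) (wedge s V z w) \<alpha> \<beta> \<gamma> =
      \<alpha> (brk G x z) * \<beta> y * \<gamma> w - \<alpha> (brk G x w) * \<beta> y * \<gamma> z
    - \<alpha> (brk G y z) * \<beta> x * \<gamma> w + \<alpha> (brk G y w) * \<beta> x * \<gamma> z"
proof -
  have eq: "cut_to V (\<lambda>x. wedge s V z w (cut_to V (\<lambda>y. \<alpha> (brk G x y))) \<gamma>) =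
    cut_to V (\<lambda>x. \<alpha> (brk G x z) * \<gamma> w - \<alpha> (brk G x w) * \<gamma> z)"
    using assms brk_cut_to_dual by (auto simp: cut_to_def wedge_def tensor_def fun_eq_iff)
  have "cut_to V (\<lambda>x. \<alpha> (brk G x z) * \<gamma> w - \<alpha> (brk G x w) * \<gamma> z) \<in> dual s V"
    using brk_dual(2)[OF assms(5,3)] brk_dual(2)[OF assms(5,4)]
    by (intro cut_to_in_dual subspace_V) (auto simp: linear_on_def algebra_simps)
  then show ?thesis
    using assms unfolding bracket_12_13_def V_def[symmetric] eq
    by (simp add: wedge_def tensor_def cut_to_apply algebra_simps)
qed

lemma schouten_wedge:
  assumes "x \<in> V" "y \<in> V" "z \<in> V" "w \<in> V" "\<alpha> \<in> dual s V" "\<beta> \<in> dual s V" "\<gamma> \<in> dual s V"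
  shows "schouten G (wedge s V x y) (wedge s V z w) \<alpha> \<beta> \<gamma> =
      wedge3 (brk G x z) y w \<alpha> \<beta> \<gamma> - wedge3 (brk G x w) y z \<alpha> \<beta> \<gamma>
    - wedge3 (brk G y z) x w \<alpha> \<beta> \<gamma> + wedge3 (brk G y w) x z \<alpha> \<beta> \<gamma>"
  using assms by (simp add: schouten_def bracket_12_13_wedge wedge3_def algebra_simps)

end

end

theory Submission
  imports Defs
begin

text \<open>
  The statement about products is a special case of a statement about a single Poisson space: if
  \<open>\<sigma>\<close> is an action of a Lie bialgebra \<open>(\<gg>, \<delta>)\<close> on \<open>(M, P)\<close> with \<open>[\<sigma>(x), P] = \<sigma>(\<delta>(x))\<close>, and \<open>t\<close> is a
  twisting element, then \<open>P + \<sigma>(t)\<close> (for a left action; \<open>P - \<sigma>(t)\<close> for a right one) is Poisson, and \<open>\<sigma>\<close> is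
  compatible with it for the twisted cobracket (\<open>signed_poisson_space_twist\<close>). Indeed, writing \<open>\<epsilon> = 1\<close> for
  left and \<open>\<epsilon> = -1\<close> for right actions, \<open>[\<sigma>(t), \<sigma>(t)] = - \<epsilon> \<sigma>([t, t])\<close> because \<open>\<sigma>\<close> respects brackets up to
  the sign \<open>- \<epsilon>\<close>, and \<open>[P, \<sigma>(t)] = - \<sigma>(\<delta>(t))\<close> because of the compatibility with \<open>P\<close>. Therefore
  \<open>[P + \<epsilon> \<sigma>(t), P + \<epsilon> \<sigma>(t)] = - 2 \<epsilon> \<sigma>(\<delta>(t) + 1/2 [t, t]) = 0\<close>. That the twisted cobracket is again a Lie
  bialgebra structure is Drinfeld's theorem (\<open>lie_bialgebra_twist\<close>).

  Both formulas are proved in a chart. For a point \<open>p\<close> the components \<open>e\<^sub>a(x) = \<sigma>(x)\<^sup>a(p)\<close> and their derivatives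
  \<open>\<partial>\<^sub>d e\<^sub>a\<close> are functionals on \<open>\<gg>\<close>, and since tensors are functions of functionals, \<open>\<sigma>(t)\<^sup>a\<^sup>b = t(e\<^sub>a, e\<^sub>b)\<close>.
  The hypotheses on \<open>\<sigma>\<close> express the coadjoint action on \<open>e\<^sub>a\<close> and the dual bracket of \<open>e\<^sub>a\<close> and \<open>e\<^sub>b\<close> through \<open>e\<close>
  and \<open>\<partial>e\<close>, after which the formulas are identities between finite sums. No second derivatives enter.

  For the application, the product \<open>(\<pi>\<^sub>1, \<dots>, \<pi>\<^sub>n)\<close> is Poisson and the product action is compatible with it,
  because derivatives of functions of one factor in the directions of the other factors vanish
  (\<open>chart_deriv_prod\<close>). To see that the twisted structure is a mixed product, the general statement is
  applied once more, to the action of the same full product Lie bialgebra on the product over a subset \<open>K\<close> of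
  the factors: the same formula defines a Poisson structure there (\<open>subproduct_twist\<close>), and the
  structure on the larger product projects to it since components in the directions of \<open>K\<close> depend only on the
  coordinates of \<open>K\<close> (\<open>projects_to_subproduct\<close>). For a pair of factors it projects further to each
  \<open>\<pi>\<^sub>l\<close>, because the remaining diagonal term \<open>\<sigma>\<^sub>l(p\<^sub>l(t))\<close> is zero (\<open>act_mixed_diagonal\<close>).
\<close>

section \<open>Functionals and tensors\<close>

lemma dual_add: "\<alpha> \<in> dual s V \<Longrightarrow> \<beta> \<in> dual s V \<Longrightarrow> \<alpha> + \<beta> \<in> dual s V"
  by (auto simp: dual_def linear_on_def algebra_simps)

lemma dual_dual_scale: "\<alpha> \<in> dual s V \<Longrightarrow> dual_scale k \<alpha> \<in> dual s V"
  by (auto simp: dual_def linear_on_def dual_scale_def algebra_simps)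

lemma dual_zero: "0 \<in> dual s V"
  by (auto simp: dual_def linear_on_def)

lemma dual_uminus: "\<alpha> \<in> dual s V \<Longrightarrow> - \<alpha> \<in> dual s V"
  by (auto simp: dual_def linear_on_def algebra_simps)

lemma dual_diff: "\<alpha> \<in> dual s V \<Longrightarrow> \<beta> \<in> dual s V \<Longrightarrow> \<alpha> - \<beta> \<in> dual s V"
  by (auto simp: dual_def linear_on_def algebra_simps)

lemma dual_eqI:
  "\<alpha> \<in> dual s V \<Longrightarrow> \<beta> \<in> dual s V \<Longrightarrow> (\<And>x. x \<in> V \<Longrightarrow> \<alpha> x = \<beta> x) \<Longrightarrow> \<alpha> = \<beta>"
  by (rule ext, case_tac "x \<in> V") (auto simp: dual_def)

lemma tensor_square_expansion:
  assumes "\<tau> \<in> tensor_square s V"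
  shows "\<exists>(m::nat) u v. (\<forall>i<m. u i \<in> V \<and> v i \<in> V) \<and>
    (\<forall>\<alpha>\<in>dual s V. \<forall>\<beta>\<in>dual s V. \<tau> \<alpha> \<beta> = (\<Sum>i<m. \<alpha> (u i) * \<beta> (v i)))"
proof -
  obtain us where us: "\<tau> = (\<Sum>(u, v)\<leftarrow>us. tensor s V u v)" "set us \<subseteq> V \<times> V"
    using assms by (auto simp: tensor_square_def)
  have "\<tau> \<alpha> \<beta> = (\<Sum>i<length us. \<alpha> (fst (us ! i)) * \<beta> (snd (us ! i)))"
    if "\<alpha> \<in> dual s V" "\<beta> \<in> dual s V" for \<alpha> \<beta>
  proof -
    have "(\<Sum>(u, v)\<leftarrow>us. tensor s V u v) \<alpha> \<beta> = (\<Sum>p\<leftarrow>us. \<alpha> (fst p) * \<beta> (snd p))"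
      using that by (induction us) (auto simp: tensor_def)
    then show ?thesis by (simp add: us(1) sum_list_sum_nth atLeast0LessThan)
  qed
  moreover have "fst (us ! i) \<in> V" "snd (us ! i) \<in> V" if "i < length us" for i
    using us(2) nth_mem[OF that] by (auto simp: mem_Times_iff dest: subsetD)
  ultimately show ?thesis
    by (intro exI[of _ "length us"] exI[of _ "\<lambda>i. fst (us ! i)"] exI[of _ "\<lambda>i. snd (us ! i)"]
          conjI ballI allI impI) auto
qed

lemma tensor_in_tensor_square: "u \<in> V \<Longrightarrow> v \<in> V \<Longrightarrow> tensor s V u v \<in> tensor_square s V"
  unfolding tensor_square_def by (intro CollectI exI[of _ "[(u, v)]"]) auto

lemma tensor_square_zero: "0 \<in> tensor_square s V"
  unfolding tensor_square_def by (intro CollectI exI[of _ "[]"]) auto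

lemma tensor_square_add:
  assumes "\<tau> \<in> tensor_square s V" "\<tau>' \<in> tensor_square s V"
  shows "\<tau> + \<tau>' \<in> tensor_square s V"
proof -
  obtain us us' where "\<tau> = (\<Sum>(u, v)\<leftarrow>us. tensor s V u v)" "set us \<subseteq> V \<times> V"
    "\<tau>' = (\<Sum>(u, v)\<leftarrow>us'. tensor s V u v)" "set us' \<subseteq> V \<times> V"
    using assms by (auto simp: tensor_square_def)
  then show ?thesis
    unfolding tensor_square_def by (intro CollectI exI[of _ "us @ us'"]) auto
qed

lemma tensor_square_sum:
  "(\<And>j. j \<in> J \<Longrightarrow> f j \<in> tensor_square s V) \<Longrightarrow> (\<Sum>j\<in>J. f j) \<in> tensor_square s V"
  by (induction J rule: infinite_finite_induct) (auto intro: tensor_square_zero tensor_square_add)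

text \<open>A linear map between tensor squares is well defined on finite sums, so its values need only be known
  on decomposable tensors.\<close>

lemma tensor_square_map:
  assumes "\<tau> \<in> tensor_square s V" "T 0 = 0" "\<And>a b. T (a + b) = T a + T b"
    and "\<And>u v. u \<in> V \<Longrightarrow> v \<in> V \<Longrightarrow> T (tensor s V u v) \<in> tensor_square s' W"
  shows "T \<tau> \<in> tensor_square s' W"
proof -
  obtain us where us: "\<tau> = (\<Sum>(u, v)\<leftarrow>us. tensor s V u v)" "set us \<subseteq> V \<times> V"
    using assms(1) by (auto simp: tensor_square_def)
  have "T (\<Sum>(u, v)\<leftarrow>us. tensor s V u v) \<in> tensor_square s' W"
    using us(2) by (induction us) (auto simp: assms(2-4) tensor_square_zero intro!: tensor_square_add)
  then show ?thesis by (simp add: us(1))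
qed

lemma tensor_square_uminus:
  assumes "vector_space s" "module.subspace s V" "\<tau> \<in> tensor_square s V"
  shows "- \<tau> \<in> tensor_square s V"
proof (rule tensor_square_map[OF assms(3), where T = uminus])
  interpret vector_space s by fact
  fix u v assume uv: "u \<in> V" "v \<in> V"
  have "- tensor s V u v \<alpha> \<beta> = tensor s V (- u) v \<alpha> \<beta>" for \<alpha> \<beta>
  proof (cases "\<alpha> \<in> dual s V")
    case True
    then have "\<alpha> (s (- 1) u) = - 1 * \<alpha> u"
      using uv(1) unfolding dual_def linear_on_def by blast
    then show ?thesis by (simp add: tensor_def)
  qed (simp add: tensor_def)
  then have "- tensor s V u v = tensor s V (- u) v" by (intro ext) simp
  then show "- tensor s V u v \<in> tensor_square s V"
    using tensor_in_tensor_square[OF subspace_neg[OF assms(2) uv(1)] uv(2), of s] by simp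
qed auto

text \<open>If \<open>\<tau> = \<Sum> u \<otimes> v\<close> is antisymmetric, then \<open>\<tau> = \<Sum> (u/2) \<and> v\<close>. This reduces closure properties of
  \<open>wedge_square\<close> to those of \<open>tensor_square\<close>.\<close>

lemma wedge_square_iff:
  fixes s :: "'k::field_char_0 \<Rightarrow> 'v::ab_group_add \<Rightarrow> 'v"
  assumes "vector_space s" "module.subspace s V"
  shows "\<tau> \<in> wedge_square s V \<longleftrightarrow> \<tau> \<in> tensor_square s V \<and> (\<forall>\<alpha> \<beta>. \<tau> \<alpha> \<beta> = - \<tau> \<beta> \<alpha>)"
    (is "?L = ?R")
proof -
  interpret vector_space s by fact
  have R: ?R if L: ?L
  proof -
    obtain us where us: "\<tau> = (\<Sum>(u, v)\<leftarrow>us. wedge s V u v)" "set us \<subseteq> V \<times> V"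
      using L by (auto simp: wedge_square_def)
    have "wedge s V u v \<in> tensor_square s V" if "u \<in> V" "v \<in> V" for u v
      using tensor_square_add[OF tensor_in_tensor_square[OF that]
          tensor_square_uminus[OF assms tensor_in_tensor_square[OF that(2,1)]]]
      by (simp add: wedge_def)
    then have "(\<Sum>(u, v)\<leftarrow>us. wedge s V u v) \<in> tensor_square s V"
      using us(2) by (induction us) (auto simp: tensor_square_zero intro!: tensor_square_add)
    then have 1: "\<tau> \<in> tensor_square s V" by (simp only: us(1))
    have "(\<Sum>(u, v)\<leftarrow>us. wedge s V u v) \<alpha> \<beta> = - (\<Sum>(u, v)\<leftarrow>us. wedge s V u v) \<beta> \<alpha>"
      for \<alpha> \<beta>
      by (induction us) (auto simp: wedge_def tensor_def)
    then have "\<forall>\<alpha> \<beta>. \<tau> \<alpha> \<beta> = - \<tau> \<beta> \<alpha>" unfolding us(1) by (intro allI)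
    with 1 show ?thesis by (rule conjI)
  qed
  have L: ?L if R: ?R
  proof -
    obtain us where us: "\<tau> = (\<Sum>(u, v)\<leftarrow>us. tensor s V u v)" "set us \<subseteq> V \<times> V"
      using conjunct1[OF R] by (auto simp: tensor_square_def)
    define ws where "ws = map (\<lambda>(u, v). (s (1/2) u, v)) us"
    have "(\<Sum>(u, v)\<leftarrow>ws. wedge s V u v) \<alpha> \<beta> = \<tau> \<alpha> \<beta>" for \<alpha> \<beta>
    proof -
      have "(\<Sum>(u, v)\<leftarrow>ws. wedge s V u v) \<alpha> \<beta> = 
        1/2 * (\<Sum>(u, v)\<leftarrow>us. tensor s V u v) \<alpha> \<beta> - 1/2 * (\<Sum>(u, v)\<leftarrow>us. tensor s V u v) \<beta> \<alpha>"
        using us(2) unfolding ws_def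
      proof (induction us)
        case (Cons p us)
        obtain u v where p: "p = (u, v)" by (cases p)
        have "wedge s V (s (1/2) u) v \<alpha> \<beta> = 1/2 * tensor s V u v \<alpha> \<beta> - 1/2 * tensor s V u v \<beta> \<alpha>"
        proof -
          have "\<gamma> (s (1/2) u) = 1/2 * \<gamma> u" if "\<gamma> \<in> dual s V" for \<gamma>
            using that Cons.prems p by (simp add: dual_def linear_on_def)
          from this[of \<alpha>] this[of \<beta>] show ?thesis
            by (cases "\<alpha> \<in> dual s V \<and> \<beta> \<in> dual s V") (auto simp: wedge_def tensor_def field_simps)
        qed
        moreover note Cons.IH
        ultimately show ?case using Cons.prems p by (simp add: ring_distribs)
      qed simp
      also have "\<dots> = 1/2 * \<tau> \<alpha> \<beta> - 1/2 * \<tau> \<beta> \<alpha>" by (simp add: us(1))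
      also have "\<dots> = 1/2 * \<tau> \<alpha> \<beta> + 1/2 * \<tau> \<alpha> \<beta>" 
      proof -
        have "\<tau> \<beta> \<alpha> = - \<tau> \<alpha> \<beta>" using R by blast
        then show ?thesis by simp
      qed
      also have "\<dots> = \<tau> \<alpha> \<beta>" by simp
      finally show ?thesis .
    qed
    then have "\<tau> = (\<Sum>(u, v)\<leftarrow>ws. wedge s V u v)" by (intro ext) (rule sym)
    moreover have "set ws \<subseteq> V \<times> V"
      using us(2) assms(2) by (auto simp: ws_def subspace_scale)
    ultimately show ?thesis unfolding wedge_square_def by blast
  qed
  from R L show ?thesis by blast
qed

text \<open>A tensor is bilinear on functionals. This form is the one used in charts, where a functional is only
  known through its values as a combination of other functionals, with the coordinate index as summation index.\<close>

lemma tensor_lincomb_left: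
  assumes "\<tau> \<in> tensor_square s V" "\<phi> \<in> dual s V" "\<beta> \<in> dual s V"
    and "\<And>d. d \<in> I \<Longrightarrow> f d \<in> dual s V" "\<And>x. x \<in> V \<Longrightarrow> \<phi> x = (\<Sum>d\<in>I. k d * f d x)"
  shows "\<tau> \<phi> \<beta> = (\<Sum>d\<in>I. k d * \<tau> (f d) \<beta>)"
proof -
  obtain m :: nat and u v where uv: "\<forall>i<m. u i \<in> V \<and> v i \<in> V"
    "\<forall>\<alpha>\<in>dual s V. \<forall>\<beta>\<in>dual s V. \<tau> \<alpha> \<beta> = (\<Sum>i<m. \<alpha> (u i) * \<beta> (v i))"
    using tensor_square_expansion[OF assms(1)] by blast
  have "\<tau> \<phi> \<beta> = (\<Sum>i<m. \<Sum>d\<in>I. k d * (f d (u i) * \<beta> (v i)))"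
    using assms uv by (simp add: sum_distrib_right mult.assoc)
  also have "\<dots> = (\<Sum>d\<in>I. k d * (\<Sum>i<m. f d (u i) * \<beta> (v i)))"
    by (subst sum.swap) (simp add: sum_distrib_left)
  also have "\<dots> = (\<Sum>d\<in>I. k d * \<tau> (f d) \<beta>)"
    using assms uv by simp
  finally show ?thesis .
qed

lemma tensor_square_swap:
  assumes "\<tau> \<in> tensor_square s V"
  shows "(\<lambda>\<alpha> \<beta>. \<tau> \<beta> \<alpha>) \<in> tensor_square s V"
proof (rule tensor_square_map[OF assms, where T = "\<lambda>\<tau> \<alpha> \<beta>. \<tau> \<beta> \<alpha>"])
  fix u v assume "u \<in> V" "v \<in> V"
  moreover have "(\<lambda>\<alpha> \<beta>. tensor s V u v \<beta> \<alpha>) = tensor s V v u" by (auto simp: tensor_def fun_eq_iff)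
  ultimately show "(\<lambda>\<alpha> \<beta>. tensor s V u v \<beta> \<alpha>) \<in> tensor_square s V"
    by (simp add: tensor_in_tensor_square)
qed (auto simp: fun_eq_iff)

lemma tensor_lincomb_right:
  assumes "\<tau> \<in> tensor_square s V" "\<phi> \<in> dual s V" "\<alpha> \<in> dual s V"
    and "\<And>d. d \<in> I \<Longrightarrow> f d \<in> dual s V" "\<And>x. x \<in> V \<Longrightarrow> \<phi> x = (\<Sum>d\<in>I. k d * f d x)"
  shows "\<tau> \<alpha> \<phi> = (\<Sum>d\<in>I. k d * \<tau> \<alpha> (f d))"
  using tensor_lincomb_left[OF tensor_square_swap[OF assms(1)] assms(2-5)] by simp

lemma tensor_add_left:
  assumes "\<tau> \<in> tensor_square s V" "\<alpha> \<in> dual s V" "\<alpha>' \<in> dual s V" "\<beta> \<in> dual s V"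
  shows "\<tau> (\<alpha> + \<alpha>') \<beta> = \<tau> \<alpha> \<beta> + \<tau> \<alpha>' \<beta>"
  using tensor_lincomb_left[OF assms(1) dual_add[OF assms(2,3)] assms(4),
      of "{False, True}" "\<lambda>b. if b then \<alpha> else \<alpha>'" "\<lambda>_. 1"] assms(2,3) by (simp add: add.commute)

lemma tensor_scale_left:
  assumes "\<tau> \<in> tensor_square s V" "\<alpha> \<in> dual s V" "\<beta> \<in> dual s V"
  shows "\<tau> (dual_scale k \<alpha>) \<beta> = k * \<tau> \<alpha> \<beta>"
  using tensor_lincomb_left[OF assms(1) dual_dual_scale[OF assms(2)] assms(3),
      where I = "{()}" and f = "\<lambda>_. \<alpha>" and k = "\<lambda>_. k"] assms(2) by (simp add: dual_scale_def)

lemma tensor_zero_left: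
  assumes "\<tau> \<in> tensor_square s V" "\<beta> \<in> dual s V"
  shows "\<tau> 0 \<beta> = 0"
  using tensor_lincomb_left[OF assms(1) dual_zero assms(2), of "{}"] by simp

lemma tensor_minus_left:
  assumes "\<tau> \<in> tensor_square s V" "\<alpha> \<in> dual s V" "\<beta> \<in> dual s V"
  shows "\<tau> (- \<alpha>) \<beta> = - \<tau> \<alpha> \<beta>"
  using tensor_lincomb_left[OF assms(1) dual_uminus[OF assms(2)] assms(3),
      of "{()}" "\<lambda>_. \<alpha>" "\<lambda>_. -1"] assms(2) by simp

lemma tensor_diff_left:
  assumes "\<tau> \<in> tensor_square s V" "\<alpha> \<in> dual s V" "\<alpha>' \<in> dual s V" "\<beta> \<in> dual s V"
  shows "\<tau> (\<alpha> - \<alpha>') \<beta> = \<tau> \<alpha> \<beta> - \<tau> \<alpha>' \<beta>"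
  using tensor_add_left[OF assms(1,2) dual_uminus[OF assms(3)] assms(4)]
    tensor_minus_left[OF assms(1,3,4)] by simp

lemma tensor_add_right:
  assumes "\<tau> \<in> tensor_square s V" "\<alpha> \<in> dual s V" "\<beta> \<in> dual s V" "\<beta>' \<in> dual s V"
  shows "\<tau> \<alpha> (\<beta> + \<beta>') = \<tau> \<alpha> \<beta> + \<tau> \<alpha> \<beta>'"
  using tensor_add_left[OF tensor_square_swap[OF assms(1)] assms(3,4,2)] by simp

lemma tensor_scale_right:
  assumes "\<tau> \<in> tensor_square s V" "\<alpha> \<in> dual s V" "\<beta> \<in> dual s V"
  shows "\<tau> \<alpha> (dual_scale k \<beta>) = k * \<tau> \<alpha> \<beta>"
  using tensor_scale_left[OF tensor_square_swap[OF assms(1)] assms(3,2)] by simp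

lemma tensor_zero_right:
  assumes "\<tau> \<in> tensor_square s V" "\<alpha> \<in> dual s V"
  shows "\<tau> \<alpha> 0 = 0"
  using tensor_zero_left[OF tensor_square_swap[OF assms(1)] assms(2)] by simp

lemma tensor_diff_right:
  assumes "\<tau> \<in> tensor_square s V" "\<alpha> \<in> dual s V" "\<beta> \<in> dual s V" "\<beta>' \<in> dual s V"
  shows "\<tau> \<alpha> (\<beta> - \<beta>') = \<tau> \<alpha> \<beta> - \<tau> \<alpha> \<beta>'"
  using tensor_diff_left[OF tensor_square_swap[OF assms(1)] assms(3,4,2)] by simp

lemma push_in_tensor_square:
  assumes \<tau>: "\<tau> \<in> tensor_square s V" and "vector_space s" "module.subspace s V"
    and "linear_on s s' V f" "\<And>x. x \<in> V \<Longrightarrow> f x \<in> W"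
  shows "push V s' W f \<tau> \<in> tensor_square s' W"
proof (rule tensor_square_map[OF \<tau>, where T = "push V s' W f"])
  fix u v assume uv: "u \<in> V" "v \<in> V"
  have "cut_to V (\<lambda>x. \<alpha> (f x)) \<in> dual s V" if "\<alpha> \<in> dual s' W" for \<alpha>
    using that assms by (intro cut_to_in_dual) (auto simp: linear_on_def dual_def)
  then have "push V s' W f (tensor s V u v) = tensor s' W (f u) (f v)"
    using uv by (auto simp: push_def tensor_def fun_eq_iff cut_to_apply)
  then show "push V s' W f (tensor s V u v) \<in> tensor_square s' W"
    using uv assms by (simp add: tensor_in_tensor_square)
qed (auto simp: push_def fun_eq_iff)


section \<open>Twisting a Lie bialgebra\<close>

text \<open>The transpose of \<open>ad\<^sub>x\<close>. There is no minus sign, so \<open>x \<mapsto> coad G x\<close> reverses brackets.\<close>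

definition coad :: "('k::field, 'v::ab_group_add) bialg \<Rightarrow> 'v \<Rightarrow> ('v \<Rightarrow> 'k) \<Rightarrow> ('v \<Rightarrow> 'k)"
  where "coad G x \<alpha> = cut_to (underlying G) (\<lambda>u. \<alpha> (brk G x u))"

locale lie_bialg =
  fixes s :: "'k::real_normed_field \<Rightarrow> 'v::ab_group_add \<Rightarrow> 'v" and G :: "('k, 'v) bialg"
  assumes G: "lie_bialgebra s G"
begin

abbreviation "V \<equiv> underlying G"
abbreviation "D \<equiv> dual s V"

sublocale vector_space s using G by (simp add: lie_bialgebra_def)

lemma subspace: "subspace V" using subspace_V[OF G] by simp

lemma V_closed: "x \<in> V \<Longrightarrow> y \<in> V \<Longrightarrow> x + y \<in> V" "x \<in> V \<Longrightarrow> s k x \<in> V" "0 \<in> V"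
  using subspace by (auto simp: subspace_add subspace_scale subspace_0)

lemma brk_closed: "x \<in> V \<Longrightarrow> y \<in> V \<Longrightarrow> brk G x y \<in> V"
  by (rule brk_in_V[OF G])

lemma brk_add: 
  "x \<in> V \<Longrightarrow> y \<in> V \<Longrightarrow> z \<in> V \<Longrightarrow> brk G (x + y) z = brk G x z + brk G y z"
  "x \<in> V \<Longrightarrow> y \<in> V \<Longrightarrow> z \<in> V \<Longrightarrow> brk G z (x + y) = brk G z x + brk G z y"
  using G by (auto simp: lie_bialgebra_def lie_bracket_on_def linear_on_def)

lemma brk_scale: 
  "x \<in> V \<Longrightarrow> z \<in> V \<Longrightarrow> brk G (s k x) z = s k (brk G x z)"
  "x \<in> V \<Longrightarrow> z \<in> V \<Longrightarrow> brk G z (s k x) = s k (brk G z x)"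
  using G by (auto simp: lie_bialgebra_def lie_bracket_on_def linear_on_def)

lemma brk_self: "x \<in> V \<Longrightarrow> brk G x x = 0"
  using G by (auto simp: lie_bialgebra_def lie_bracket_on_def)

lemma brk_anti: assumes "x \<in> V" "y \<in> V" shows "brk G y x = - brk G x y"
proof -
  have "brk G (x + y) (x + y) = 0" using assms by (intro brk_self V_closed)
  moreover have "brk G (x + y) (x + y) = (brk G x x + brk G y x) + (brk G x y + brk G y y)"
    using assms by (simp add: brk_add V_closed)
  ultimately have "brk G x y + brk G y x = 0"
    using assms by (simp add: brk_self add.commute)
  then show ?thesis by (simp add: eq_neg_iff_add_eq_0 add.commute)
qed

lemma jacobi: "x \<in> V \<Longrightarrow> y \<in> V \<Longrightarrow> z \<in> V \<Longrightarrow>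
  brk G x (brk G y z) + brk G y (brk G z x) + brk G z (brk G x y) = 0"
  using G by (auto simp: lie_bialgebra_def lie_bracket_on_def)

lemma D_add: "\<alpha> \<in> D \<Longrightarrow> x \<in> V \<Longrightarrow> y \<in> V \<Longrightarrow> \<alpha> (x + y) = \<alpha> x + \<alpha> y"
  and D_scale: "\<alpha> \<in> D \<Longrightarrow> x \<in> V \<Longrightarrow> \<alpha> (s k x) = k * \<alpha> x"
  by (auto simp: dual_def linear_on_def)

lemma D_minus: assumes "\<alpha> \<in> D" "x \<in> V" shows "\<alpha> (- x) = - \<alpha> x"
  using D_scale[OF assms, of "-1"] by simp

lemma coad_in_dual: "x \<in> V \<Longrightarrow> \<alpha> \<in> D \<Longrightarrow> coad G x \<alpha> \<in> D"
  using brk_cut_to_dual(1)[OF G] by (simp add: coad_def)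

lemma coad_apply: "y \<in> V \<Longrightarrow> coad G x \<alpha> y = \<alpha> (brk G x y)"
  by (simp add: coad_def cut_to_def)

lemma coad_linear:
  "x \<in> V \<Longrightarrow> y \<in> V \<Longrightarrow> \<alpha> \<in> D \<Longrightarrow> coad G (x + y) \<alpha> = coad G x \<alpha> + coad G y \<alpha>"
  "x \<in> V \<Longrightarrow> \<alpha> \<in> D \<Longrightarrow> coad G (s k x) \<alpha> = dual_scale k (coad G x \<alpha>)"
  by (auto simp: coad_def cut_to_def fun_eq_iff dual_scale_def brk_add brk_scale D_add D_scale brk_closed)

text \<open>The Jacobi identity read on functionals.\<close>

lemma coad_brk:
  assumes "x \<in> V" "y \<in> V" "\<alpha> \<in> D"
  shows "coad G (brk G x y) \<alpha> = coad G y (coad G x \<alpha>) - coad G x (coad G y \<alpha>)"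
proof (rule dual_eqI)
  fix z assume z: "z \<in> V"
  have "brk G y (brk G z x) = - brk G y (brk G x z)"
    using brk_scale(2)[of "brk G x z" y "-1"] brk_anti[of x z] brk_closed assms z by simp
  moreover have "brk G z (brk G x y) = - brk G (brk G x y) z"
    using brk_anti[OF brk_closed[OF assms(1,2)] z] .
  ultimately have "brk G x (brk G y z) + - brk G y (brk G x z) + - brk G (brk G x y) z = 0"
    using jacobi[of x y z] assms z by simp
  then have "brk G (brk G x y) z = brk G x (brk G y z) + - brk G y (brk G x z)"
    by (subst eq_commute, subst eq_iff_diff_eq_0) (simp only: diff_conv_add_uminus)
  then have "\<alpha> (brk G (brk G x y) z) = \<alpha> (brk G x (brk G y z)) - \<alpha> (brk G y (brk G x z))"
    using D_add[OF assms(3), of "brk G x (brk G y z)" "- brk G y (brk G x z)"]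
      D_minus[OF assms(3), of "brk G y (brk G x z)"] assms z subspace_neg[OF subspace]
    by (simp add: brk_closed del: add_uminus_conv_diff)
  then show "coad G (brk G x y) \<alpha> z = (coad G y (coad G x \<alpha>) - coad G x (coad G y \<alpha>)) z"
    using assms z by (simp add: coad_apply brk_closed)
qed (use assms in \<open>auto intro!: coad_in_dual brk_closed dual_diff\<close>)

lemma ad_apply: "\<alpha> \<in> D \<Longrightarrow> \<beta> \<in> D \<Longrightarrow> ad s G x \<tau> \<alpha> \<beta> = \<tau> (coad G x \<alpha>) \<beta> + \<tau> \<alpha> (coad G x \<beta>)"
  by (simp add: ad_def coad_def)

lemma ad_outside: "\<alpha> \<notin> D \<or> \<beta> \<notin> D \<Longrightarrow> ad s G x \<tau> \<alpha> \<beta> = 0"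
  by (auto simp: ad_def)

lemma ad_in_tensor_square:
  assumes "x \<in> V" "\<tau> \<in> tensor_square s V" shows "ad s G x \<tau> \<in> tensor_square s V"
proof (rule tensor_square_map[OF assms(2), where T = "ad s G x"])
  fix u v assume "u \<in> V" "v \<in> V"
  then show "ad s G x (tensor s V u v) \<in> tensor_square s V"
    using assms by (simp add: ad_tensor[OF G] tensor_square_add tensor_in_tensor_square brk_closed)
qed (auto simp: ad_def fun_eq_iff)

lemma wedge_iff: "\<tau> \<in> wedge_square s V \<longleftrightarrow> \<tau> \<in> tensor_square s V \<and> (\<forall>\<alpha> \<beta>. \<tau> \<alpha> \<beta> = - \<tau> \<beta> \<alpha>)"
  by (rule wedge_square_iff[OF vector_space_axioms subspace])

lemma ad_in_wedge_square:
  assumes "x \<in> V" "\<tau> \<in> wedge_square s V" shows "ad s G x \<tau> \<in> wedge_square s V"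
proof -
  have \<tau>: "\<tau> \<in> tensor_square s V" "\<And>\<alpha> \<beta>. \<tau> \<alpha> \<beta> = - \<tau> \<beta> \<alpha>"
    using assms(2) unfolding wedge_iff by blast+
  have "ad s G x \<tau> \<alpha> \<beta> = - ad s G x \<tau> \<beta> \<alpha>" for \<alpha> \<beta>
    using \<tau>(2)[of "coad G x \<alpha>" \<beta>] \<tau>(2)[of \<alpha> "coad G x \<beta>"] 
    by (cases "\<alpha> \<in> D \<and> \<beta> \<in> D") (auto simp: ad_apply ad_outside)
  then show ?thesis unfolding wedge_iff using ad_in_tensor_square[OF assms(1) \<tau>(1)] by blast
qed

lemma ad_linear:
  assumes "\<tau> \<in> tensor_square s V"
  shows "linear_on s scale2 V (\<lambda>x. ad s G x \<tau>)"
  unfolding linear_on_def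
proof (intro conjI ballI allI ext)
  fix x y \<alpha> \<beta> assume xy: "x \<in> V" "y \<in> V"
  show "ad s G (x + y) \<tau> \<alpha> \<beta> = (ad s G x \<tau> + ad s G y \<tau>) \<alpha> \<beta>"
    using assms xy
    by (cases "\<alpha> \<in> D \<and> \<beta> \<in> D")
       (auto simp: ad_outside ad_apply coad_linear coad_in_dual tensor_add_left tensor_add_right algebra_simps)
next
  fix k x \<alpha> \<beta> assume x: "x \<in> V"
  show "ad s G (s k x) \<tau> \<alpha> \<beta> = scale2 k (ad s G x \<tau>) \<alpha> \<beta>"
    using assms x
    by (cases "\<alpha> \<in> D \<and> \<beta> \<in> D")
       (auto simp: ad_outside ad_apply coad_linear coad_in_dual tensor_scale_left tensor_scale_right
          scale2_def algebra_simps)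
qed

lemma ad_brk:
  assumes "\<tau> \<in> tensor_square s V" "x \<in> V" "y \<in> V"
  shows "ad s G (brk G x y) \<tau> = ad s G x (ad s G y \<tau>) - ad s G y (ad s G x \<tau>)"
proof (intro ext)
  fix \<alpha> \<beta>
  show "ad s G (brk G x y) \<tau> \<alpha> \<beta> = (ad s G x (ad s G y \<tau>) - ad s G y (ad s G x \<tau>)) \<alpha> \<beta>"
    using assms
    by (cases "\<alpha> \<in> D \<and> \<beta> \<in> D")
       (auto simp: ad_outside ad_apply coad_brk coad_in_dual tensor_diff_left tensor_diff_right algebra_simps)
qed

lemma coad_functional_in_dual:
  assumes "\<tau> \<in> tensor_square s V" "\<alpha> \<in> D" "\<beta> \<in> D"
  shows "cut_to V (\<lambda>y. \<tau> (coad G y \<alpha>) \<beta>) \<in> D"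
proof (rule cut_to_in_dual[OF vector_space_axioms subspace])
  show "linear_on s (*) V (\<lambda>y. \<tau> (coad G y \<alpha>) \<beta>)"
    using assms tensor_add_left[OF assms(1)] tensor_scale_left[OF assms(1)]
    by (simp add: linear_on_def coad_linear coad_in_dual)
qed

lemma bracket_12_13_coad:
  "bracket_12_13 G d t \<alpha> \<beta> \<gamma> = d (cut_to V (\<lambda>a. t (coad G a \<alpha>) \<gamma>)) \<beta>"
  by (simp add: bracket_12_13_def coad_def)

text \<open>Exchanging the two tensors exchanges the two arguments of the bracket, whence the sign, and the two
  remaining legs.\<close>

lemma bracket_12_13_swap:
  assumes d: "d \<in> tensor_square s V" and t: "t \<in> tensor_square s V"
    and D: "\<alpha> \<in> D" "\<beta> \<in> D" "\<gamma> \<in> D"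
  shows "bracket_12_13 G d t \<alpha> \<beta> \<gamma> = - bracket_12_13 G t d \<alpha> \<gamma> \<beta>"
proof -
  obtain m :: nat and a b where d': "\<forall>i<m. a i \<in> V \<and> b i \<in> V"
    "\<forall>\<alpha>\<in>D. \<forall>\<beta>\<in>D. d \<alpha> \<beta> = (\<Sum>i<m. \<alpha> (a i) * \<beta> (b i))"
    using tensor_square_expansion[OF d] by blast
  obtain n :: nat and u v where t': "\<forall>i<n. u i \<in> V \<and> v i \<in> V"
    "\<forall>\<alpha>\<in>D. \<forall>\<beta>\<in>D. t \<alpha> \<beta> = (\<Sum>i<n. \<alpha> (u i) * \<beta> (v i))"
    using tensor_square_expansion[OF t] by blast
  have 1: "bracket_12_13 G d t \<alpha> \<beta> \<gamma> = (\<Sum>i<m. \<Sum>j<n. \<alpha> (brk G (a i) (u j)) * \<gamma> (v j) * \<beta> (b i))"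
    using d' t' D coad_functional_in_dual[OF t D(1,3)]
    by (simp add: bracket_12_13_coad cut_to_apply coad_in_dual coad_apply sum_distrib_right)
  have 2: "bracket_12_13 G t d \<alpha> \<gamma> \<beta> = (\<Sum>j<n. \<Sum>i<m. \<alpha> (brk G (u j) (a i)) * \<beta> (b i) * \<gamma> (v j))"
    using d' t' D coad_functional_in_dual[OF d D(1,2)]
    by (simp add: bracket_12_13_coad cut_to_apply coad_in_dual coad_apply sum_distrib_right)
  have 3: "\<alpha> (brk G (u j) (a i)) = - \<alpha> (brk G (a i) (u j))" if "i < m" "j < n" for i j
    using D_minus[OF D(1), of "brk G (a i) (u j)"] brk_anti[of "a i" "u j"] d' t' that
    by (simp add: brk_closed)
  show ?thesis
    unfolding 1 2 by (subst sum.swap) (simp add: 3 mult.assoc mult.commute[of "\<gamma> _"] flip: sum_negf)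
qed

lemma schouten_commute:
  assumes "d \<in> tensor_square s V" "t \<in> tensor_square s V" "\<alpha> \<in> D" "\<beta> \<in> D" "\<gamma> \<in> D"
  shows "schouten G d t \<alpha> \<beta> \<gamma> = schouten G t d \<alpha> \<beta> \<gamma>"
  using assms unfolding schouten_def
  by (simp add: bracket_12_13_swap[of d t])

text \<open>Derivations of a Lie algebra act on the tensors built from its bracket; for \<open>ad\<^sub>x\<close> this is the Jacobi identity.\<close>

lemma bracket_12_13_derivation:
  assumes d: "d \<in> tensor_square s V" and t: "t \<in> tensor_square s V" and x: "x \<in> V"
    and D: "\<alpha> \<in> D" "\<beta> \<in> D" "\<gamma> \<in> D"
  shows "bracket_12_13 G (ad s G x d) t \<alpha> \<beta> \<gamma> + bracket_12_13 G d (ad s G x t) \<alpha> \<beta> \<gamma> =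
    bracket_12_13 G d t (coad G x \<alpha>) \<beta> \<gamma> + bracket_12_13 G d t \<alpha> (coad G x \<beta>) \<gamma> +
    bracket_12_13 G d t \<alpha> \<beta> (coad G x \<gamma>)"
proof -
  define \<phi> where "\<phi> = cut_to V (\<lambda>c. t (coad G c \<alpha>) \<gamma>)"
  define B where "B = cut_to V (\<lambda>c. t (coad G c (coad G x \<alpha>)) \<gamma>)"
  define C where "C = cut_to V (\<lambda>c. t (coad G c \<alpha>) (coad G x \<gamma>))"
  have in_D: "\<phi> \<in> D" "B \<in> D" "C \<in> D" "coad G x \<phi> \<in> D"
    unfolding \<phi>_def B_def C_def using t x D by (auto intro!: coad_functional_in_dual coad_in_dual)
  \<comment> \<open>Moving \<open>x\<close> past \<open>c\<close> costs a bracket \<open>[x, c]\<close>, which is the action of \<open>x\<close> on the functional \<open>\<phi>\<close> of \<open>c\<close>.\<close>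
  have "cut_to V (\<lambda>c. ad s G x t (coad G c \<alpha>) \<gamma>) = (B - coad G x \<phi>) + C"
  proof
    fix c
    show "cut_to V (\<lambda>c. ad s G x t (coad G c \<alpha>) \<gamma>) c = ((B - coad G x \<phi>) + C) c"
    proof (cases "c \<in> V")
      case True
      then have "coad G x \<phi> c = t (coad G c (coad G x \<alpha>)) \<gamma> - t (coad G x (coad G c \<alpha>)) \<gamma>"
        using x D tensor_diff_left[OF t]
        by (simp add: coad_apply \<phi>_def cut_to_apply brk_closed coad_brk coad_in_dual)
      then show ?thesis
        using True x D by (simp add: B_def C_def cut_to_apply ad_apply coad_in_dual)
    next
      case False
      then show ?thesis by (simp add: B_def C_def coad_def cut_to_def)
    qed
  qed
  then have "bracket_12_13 G d (ad s G x t) \<alpha> \<beta> \<gamma> = d B \<beta> - d (coad G x \<phi>) \<beta> + d C \<beta>"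
    using in_D D tensor_add_left[OF d] tensor_diff_left[OF d]
    by (simp add: bracket_12_13_coad dual_diff)
  moreover have "bracket_12_13 G (ad s G x d) t \<alpha> \<beta> \<gamma> = d (coad G x \<phi>) \<beta> + d \<phi> (coad G x \<beta>)"
    using in_D D x by (simp add: bracket_12_13_coad ad_apply flip: \<phi>_def)
  ultimately show ?thesis
    by (simp add: bracket_12_13_coad B_def C_def \<phi>_def)
qed

text \<open>The derivation rule gives one term for each argument of \<open>[t, t]\<close>, and the two agree by symmetry.\<close>

lemma schouten_derivation:
  assumes t: "t \<in> tensor_square s V" and x: "x \<in> V" and D: "\<alpha> \<in> D" "\<beta> \<in> D" "\<gamma> \<in> D"
  shows "2 * schouten G (ad s G x t) t \<alpha> \<beta> \<gamma> =
    schouten G t t (coad G x \<alpha>) \<beta> \<gamma> + schouten G t t \<alpha> (coad G x \<beta>) \<gamma> + schouten G t t \<alpha> \<beta> (coad G x \<gamma>)"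
proof -
  have double: "2 * schouten G (ad s G x t) t \<alpha> \<beta> \<gamma> =
    schouten G (ad s G x t) t \<alpha> \<beta> \<gamma> + schouten G t (ad s G x t) \<alpha> \<beta> \<gamma>"
    using schouten_commute[OF ad_in_tensor_square[OF x t] t D] by simp
  have der: "bracket_12_13 G (ad s G x t) t \<alpha> \<beta> \<gamma> =
      bracket_12_13 G t t (coad G x \<alpha>) \<beta> \<gamma> + bracket_12_13 G t t \<alpha> (coad G x \<beta>) \<gamma> +
      bracket_12_13 G t t \<alpha> \<beta> (coad G x \<gamma>) - bracket_12_13 G t (ad s G x t) \<alpha> \<beta> \<gamma>"
    if "\<alpha> \<in> D" "\<beta> \<in> D" "\<gamma> \<in> D" for \<alpha> \<beta> \<gamma>
    using bracket_12_13_derivation[OF t t x that] by (simp add: algebra_simps)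
  have "schouten G (ad s G x t) t \<alpha> \<beta> \<gamma> + schouten G t (ad s G x t) \<alpha> \<beta> \<gamma> =
    schouten G t t (coad G x \<alpha>) \<beta> \<gamma> + schouten G t t \<alpha> (coad G x \<beta>) \<gamma> + schouten G t t \<alpha> \<beta> (coad G x \<gamma>)"
    unfolding schouten_def der[OF D(1,2,3)] der[OF D(2,3,1)] der[OF D(3,1,2)] der[OF D(1,3,2)]
      der[OF D(2,1,3)] der[OF D(3,2,1)]
    by (simp add: algebra_simps)
  with double show ?thesis by simp
qed

lemma ad_functional:
  assumes "t \<in> wedge_square s V" "\<alpha> \<in> D" "\<beta> \<in> D"
  shows "cut_to V (\<lambda>y. ad s G y t \<alpha> \<beta>) =
    cut_to V (\<lambda>y. t (coad G y \<alpha>) \<beta>) - cut_to V (\<lambda>y. t (coad G y \<beta>) \<alpha>)"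
proof
  fix y
  have "t \<alpha> (coad G y \<beta>) = - t (coad G y \<beta>) \<alpha>"
    using assms(1) unfolding wedge_iff by blast
  then show "cut_to V (\<lambda>y. ad s G y t \<alpha> \<beta>) y =
    (cut_to V (\<lambda>y. t (coad G y \<alpha>) \<beta>) - cut_to V (\<lambda>y. t (coad G y \<beta>) \<alpha>)) y"
    using assms by (simp add: cut_to_def ad_apply)
qed

lemma ad_functional_in_dual:
  assumes "t \<in> wedge_square s V" "\<alpha> \<in> D" "\<beta> \<in> D"
  shows "cut_to V (\<lambda>y. ad s G y t \<alpha> \<beta>) \<in> D"
proof -
  have "t \<in> tensor_square s V" using assms(1) unfolding wedge_iff by blast
  then show ?thesis
    unfolding ad_functional[OF assms] using assms(2,3) by (intro dual_diff coad_functional_in_dual)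
qed

text \<open>The cyclic sum below is what appears when one cobracket of the form \<open>y \<mapsto> [y, t]\<close> is composed with
  another one in the dual Jacobi identity. Skew-symmetry of \<open>t\<close> turns its six terms into those of the
  Schouten bracket.\<close>

lemma schouten_cyclic:
  assumes d: "d \<in> tensor_square s V" and t: "t \<in> wedge_square s V"
    and D: "\<alpha> \<in> D" "\<beta> \<in> D" "\<gamma> \<in> D"
  shows "d (cut_to V (\<lambda>y. ad s G y t \<alpha> \<beta>)) \<gamma> + d (cut_to V (\<lambda>y. ad s G y t \<beta> \<gamma>)) \<alpha>
    + d (cut_to V (\<lambda>y. ad s G y t \<gamma> \<alpha>)) \<beta> = - schouten G d t \<alpha> \<beta> \<gamma>"
proof -
  have t': "t \<in> tensor_square s V" using t unfolding wedge_iff by blast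
  have eq: "d (cut_to V (\<lambda>y. ad s G y t \<alpha> \<beta>)) \<gamma> =
      bracket_12_13 G d t \<alpha> \<gamma> \<beta> - bracket_12_13 G d t \<beta> \<gamma> \<alpha>"
    if "\<alpha> \<in> D" "\<beta> \<in> D" "\<gamma> \<in> D" for \<alpha> \<beta> \<gamma>
    using tensor_diff_left[OF d] coad_functional_in_dual[OF t'] that
    by (simp add: ad_functional[OF t] bracket_12_13_coad)
  show ?thesis
    unfolding eq[OF D(1,2,3)] eq[OF D(2,3,1)] eq[OF D(3,1,2)] schouten_def by (simp add: algebra_simps)
qed

lemma cobr_wedge: "x \<in> V \<Longrightarrow> cobr G x \<in> wedge_square s V"
  using G by (simp add: lie_bialgebra_def)

lemma cobr_tensor: "x \<in> V \<Longrightarrow> cobr G x \<in> tensor_square s V"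
  using cobr_wedge unfolding wedge_iff by blast

lemma cobr_cocycle:
  "x \<in> V \<Longrightarrow> y \<in> V \<Longrightarrow> cobr G (brk G x y) = ad s G x (cobr G y) - ad s G y (cobr G x)"
  using G by (simp add: lie_bialgebra_def)

lemma dual_brk_closed: "\<alpha> \<in> D \<Longrightarrow> \<beta> \<in> D \<Longrightarrow> dual_brk G \<alpha> \<beta> \<in> D"
  by (rule dual_brk_in_dual[OF G])

lemma dual_brk_apply: "x \<in> V \<Longrightarrow> dual_brk G \<alpha> \<beta> x = cobr G x \<alpha> \<beta>"
  by (simp add: dual_brk_def cut_to_apply)

lemma co_jacobi:
  assumes x: "x \<in> V" and D: "\<alpha> \<in> D" "\<beta> \<in> D" "\<gamma> \<in> D"
  shows "cobr G x (dual_brk G \<alpha> \<beta>) \<gamma> + cobr G x (dual_brk G \<beta> \<gamma>) \<alpha> + cobr G x (dual_brk G \<gamma> \<alpha>) \<beta> = 0"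
proof -
  have anti: "cobr G x \<phi> \<psi> = - cobr G x \<psi> \<phi>" for \<phi> \<psi>
    using cobr_wedge[OF x] unfolding wedge_iff by blast
  have "dual_brk G \<alpha> (dual_brk G \<beta> \<gamma>) + dual_brk G \<beta> (dual_brk G \<gamma> \<alpha>) + dual_brk G \<gamma> (dual_brk G \<alpha> \<beta>) = 0"
    using G D by (simp add: lie_bialgebra_def lie_bracket_on_def)
  then have "dual_brk G \<alpha> (dual_brk G \<beta> \<gamma>) x + dual_brk G \<beta> (dual_brk G \<gamma> \<alpha>) x
      + dual_brk G \<gamma> (dual_brk G \<alpha> \<beta>) x = 0"
    by (metis plus_fun_apply zero_fun_apply)
  then show ?thesis
    using anti[of "dual_brk G \<alpha> \<beta>" \<gamma>] anti[of "dual_brk G \<beta> \<gamma>" \<alpha>] anti[of "dual_brk G \<gamma> \<alpha>" \<beta>]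
    unfolding dual_brk_apply[OF x] by algebra
qed

text \<open>The cocycle condition read on functionals: the obstruction for \<open>x\<close> to act on the dual bracket
  by derivations is the action of the dual on \<open>\<delta>(x)\<close>.\<close>

lemma ad_cobr_functional:
  assumes "x \<in> V" "\<alpha> \<in> D" "\<beta> \<in> D"
  shows "cut_to V (\<lambda>y. ad s G y (cobr G x) \<alpha> \<beta>) =
    (dual_brk G (coad G x \<alpha>) \<beta> + dual_brk G \<alpha> (coad G x \<beta>)) - coad G x (dual_brk G \<alpha> \<beta>)"
proof (rule dual_eqI[OF ad_functional_in_dual])
  fix y assume y: "y \<in> V"
  have "cobr G (brk G x y) \<alpha> \<beta> = ad s G x (cobr G y) \<alpha> \<beta> - ad s G y (cobr G x) \<alpha> \<beta>"
    using cobr_cocycle[OF assms(1) y] by simp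
  moreover have "coad G x (dual_brk G \<alpha> \<beta>) y = cobr G (brk G x y) \<alpha> \<beta>"
    using assms y by (simp add: coad_apply dual_brk_apply brk_closed)
  ultimately show "cut_to V (\<lambda>y. ad s G y (cobr G x) \<alpha> \<beta>) y =
    ((dual_brk G (coad G x \<alpha>) \<beta> + dual_brk G \<alpha> (coad G x \<beta>)) - coad G x (dual_brk G \<alpha> \<beta>)) y"
    using assms y by (simp add: cut_to_apply dual_brk_apply ad_apply[of \<alpha> \<beta> x])
qed (use assms in \<open>auto intro!: dual_diff dual_add dual_brk_closed coad_in_dual cobr_wedge\<close>)

end

text \<open>Skew-symmetry and bilinearity of the dual bracket are automatic once the cobracket takes values in
  \<open>\<and>\<^sup>2 V\<close>, so only the Jacobi identity has to be checked, in its cyclic form.\<close>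

lemma lie_bialgebraI:
  fixes s :: "'k::real_normed_field \<Rightarrow> 'v::ab_group_add \<Rightarrow> 'v" and H :: "('k, 'v) bialg"
  defines "V \<equiv> underlying H"
  assumes vs: "vector_space s" and fd: "fin_dim_subspace s V" and br: "lie_bracket_on s V (brk H)"
    and wedge: "\<And>x. x \<in> V \<Longrightarrow> cobr H x \<in> wedge_square s V"
    and lin: "linear_on s scale2 V (cobr H)"
    and cocycle: "\<And>x y. x \<in> V \<Longrightarrow> y \<in> V \<Longrightarrow>
      cobr H (brk H x y) = ad s H x (cobr H y) - ad s H y (cobr H x)"
    and jacobi: "\<And>x \<alpha> \<beta> \<gamma>. x \<in> V \<Longrightarrow> \<alpha> \<in> dual s V \<Longrightarrow> \<beta> \<in> dual s V \<Longrightarrow> \<gamma> \<in> dual s V \<Longrightarrow>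
      cobr H x (dual_brk H \<alpha> \<beta>) \<gamma> + cobr H x (dual_brk H \<beta> \<gamma>) \<alpha> + cobr H x (dual_brk H \<gamma> \<alpha>) \<beta> = 0"
  shows "lie_bialgebra s H"
proof -
  have sub: "module.subspace s V" using fd by (simp add: fin_dim_subspace_def)
  have ts: "cobr H x \<in> tensor_square s V" and anti: "cobr H x \<alpha> \<beta> = - cobr H x \<beta> \<alpha>" if "x \<in> V" for x \<alpha> \<beta>
    using wedge[OF that] unfolding wedge_square_iff[OF vs sub] by blast+
  have app: "dual_brk H \<alpha> \<beta> x = cobr H x \<alpha> \<beta>" if "x \<in> V" for x \<alpha> \<beta>
    using that by (simp add: dual_brk_def cut_to_apply V_def)
  have outside: "dual_brk H \<alpha> \<beta> x = 0" if "x \<notin> V" for x \<alpha> \<beta>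
    using that by (simp add: dual_brk_def cut_to_def V_def)
  have closed: "dual_brk H \<alpha> \<beta> \<in> dual s V" for \<alpha> \<beta>
    unfolding dual_brk_def V_def[symmetric]
  proof (rule cut_to_in_dual[OF vs sub])
    show "linear_on s (*) V (\<lambda>x. cobr H x \<alpha> \<beta>)"
      using lin by (simp add: linear_on_def scale2_def)
  qed
  have "lie_bracket_on dual_scale (dual s V) (dual_brk H)"
    unfolding lie_bracket_on_def linear_on_def
  proof (intro conjI ballI allI closed ext)
    fix \<alpha> \<beta> \<gamma> x assume D: "\<alpha> \<in> dual s V" "\<beta> \<in> dual s V" "\<gamma> \<in> dual s V"
    show "dual_brk H \<alpha> (\<beta> + \<gamma>) x = (dual_brk H \<alpha> \<beta> + dual_brk H \<alpha> \<gamma>) x"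
      using tensor_add_right[OF ts D] by (cases "x \<in> V") (simp_all add: app outside)
    show "dual_brk H (\<beta> + \<gamma>) \<alpha> x = (dual_brk H \<beta> \<alpha> + dual_brk H \<gamma> \<alpha>) x"
      using tensor_add_left[OF ts D(2,3,1)] by (cases "x \<in> V") (simp_all add: app outside)
    show "(dual_brk H \<alpha> (dual_brk H \<beta> \<gamma>) + dual_brk H \<beta> (dual_brk H \<gamma> \<alpha>) + dual_brk H \<gamma> (dual_brk H \<alpha> \<beta>)) x = 0 x"
    proof (cases "x \<in> V")
      case True
      show ?thesis
        using jacobi[OF True D] anti[OF True, of "dual_brk H \<alpha> \<beta>" \<gamma>] anti[OF True, of "dual_brk H \<beta> \<gamma>" \<alpha>]
          anti[OF True, of "dual_brk H \<gamma> \<alpha>" \<beta>]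
        unfolding plus_fun_apply zero_fun_apply app[OF True] by algebra
    qed (simp add: outside)
  next
    fix \<alpha> \<beta> k x assume D: "\<alpha> \<in> dual s V" "\<beta> \<in> dual s V"
    show "dual_brk H \<alpha> (dual_scale k \<beta>) x = dual_scale k (dual_brk H \<alpha> \<beta>) x"
      using tensor_scale_right[OF ts D] by (cases "x \<in> V") (simp_all add: app outside dual_scale_def[of k "dual_brk H \<alpha> \<beta>"])
    show "dual_brk H (dual_scale k \<beta>) \<alpha> x = dual_scale k (dual_brk H \<beta> \<alpha>) x"
      using tensor_scale_left[OF ts D(2,1)] by (cases "x \<in> V") (simp_all add: app outside dual_scale_def[of k "dual_brk H \<beta> \<alpha>"])
  next
    fix \<alpha> x
    show "dual_brk H \<alpha> \<alpha> x = 0 x"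
    proof (cases "x \<in> V")
      case True
      have "2 * cobr H x \<alpha> \<alpha> = 0" using anti[OF True, of \<alpha> \<alpha>] by algebra
      then show ?thesis by (simp add: app[OF True])
    qed (simp add: outside)
  qed
  then show ?thesis
    unfolding lie_bialgebra_def V_def[symmetric]
    using vs fd br wedge lin cocycle by blast
qed

context lie_bialg
begin

text \<open>Only the Jacobi identity of the twisted dual bracket is not formal. Let \<open>E\<close> be the extended cobracket of
  \<open>t\<close> and expand the cyclic sum of \<open>\<delta>\<^sub>t(x)([\<alpha>, \<beta>]\<^sub>t, \<gamma>)\<close> in powers of \<open>t\<close>. The constant term is the Jacobi
  identity of \<open>\<delta>\<close>. In the linear term, the part in which \<open>t\<close> twists the inner bracket is a Schouten
  bracket of \<open>\<delta>(x)\<close> and \<open>t\<close>; by the symmetry of that bracket it may be written with \<open>\<delta>(x)\<close> inside and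
  \<open>t\<close> outside, and then the cocycle condition turns the whole linear term into \<open>- [x, E]\<close>. The quadratic
  term is \<open>- [[x, t], t] = - 1/2 [x, [t, t]]\<close>. The total is \<open>- [x, E + 1/2 [t, t]] = 0\<close>.\<close>

theorem lie_bialgebra_twist:
  assumes tw: "twisting_element s G t"
  shows "lie_bialgebra s (twist s G t)"
proof (rule lie_bialgebraI)
  let ?H = "twist s G t"
  have H: "underlying ?H = V" "brk ?H = brk G" "cobr ?H x = cobr G x - ad s G x t" "ad s ?H = ad s G" for x
    by (simp_all add: twist_def ad_def fun_eq_iff)
  have tW: "t \<in> wedge_square s V" and tE: "\<And>\<alpha> \<beta> \<gamma>. \<alpha> \<in> D \<Longrightarrow> \<beta> \<in> D \<Longrightarrow> \<gamma> \<in> D \<Longrightarrow>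
     cobr_ext G t \<alpha> \<beta> \<gamma> + 1 / 2 * schouten G t t \<alpha> \<beta> \<gamma> = 0"
    using tw unfolding twisting_element_def by blast+
  then have t: "t \<in> tensor_square s V" and anti: "t \<alpha> \<beta> = - t \<beta> \<alpha>" for \<alpha> \<beta> unfolding wedge_iff by blast+
  show "vector_space s" by (rule vector_space_axioms)
  show "fin_dim_subspace s (underlying ?H)" "lie_bracket_on s (underlying ?H) (brk ?H)"
    using G by (simp_all add: H lie_bialgebra_def)
  show "cobr ?H x \<in> wedge_square s (underlying ?H)" if "x \<in> underlying ?H" for x
  proof -
    have x: "x \<in> V" using that by (simp add: H)
    have "cobr G x + - ad s G x t \<in> tensor_square s V"
      by (intro tensor_square_add tensor_square_uminus vector_space_axioms subspace
            cobr_tensor ad_in_tensor_square x t)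
    moreover have "(cobr G x - ad s G x t) \<alpha> \<beta> = - (cobr G x - ad s G x t) \<beta> \<alpha>" for \<alpha> \<beta>
    proof -
      have "cobr G x \<alpha> \<beta> = - cobr G x \<beta> \<alpha>" "ad s G x t \<alpha> \<beta> = - ad s G x t \<beta> \<alpha>"
        using cobr_wedge[OF x] ad_in_wedge_square[OF x tW] unfolding wedge_iff by blast+
      then show ?thesis by simp
    qed
    ultimately show ?thesis unfolding H wedge_iff by simp
  qed
  show "linear_on s scale2 (underlying ?H) (cobr ?H)"
  proof -
    have "linear_on s scale2 V (cobr G)" using G by (simp add: lie_bialgebra_def)
    with ad_linear[OF t] show ?thesis
      by (simp add: linear_on_def H scale2_def fun_eq_iff algebra_simps)
  qed
  show "cobr ?H (brk ?H x y) = ad s ?H x (cobr ?H y) - ad s ?H y (cobr ?H x)"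
    if "x \<in> underlying ?H" "y \<in> underlying ?H" for x y
  proof -
    have ad_diff: "ad s G x (a - b) = ad s G x a - ad s G x b" for x a b
      by (simp add: ad_def fun_eq_iff)
    show ?thesis using that by (simp add: H cobr_cocycle ad_brk[OF t] ad_diff)
  qed
  show "cobr ?H x (dual_brk ?H \<alpha> \<beta>) \<gamma> + cobr ?H x (dual_brk ?H \<beta> \<gamma>) \<alpha> + cobr ?H x (dual_brk ?H \<gamma> \<alpha>) \<beta> = 0"
    if "x \<in> underlying ?H" "\<alpha> \<in> dual s (underlying ?H)" "\<beta> \<in> dual s (underlying ?H)"
      "\<gamma> \<in> dual s (underlying ?H)" for x \<alpha> \<beta> \<gamma>
  proof -
    have x: "x \<in> V" and D: "\<alpha> \<in> D" "\<beta> \<in> D" "\<gamma> \<in> D" using that by (simp_all add: H)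
    note in_D = D coad_in_dual[OF x D(1)] coad_in_dual[OF x D(2)] coad_in_dual[OF x D(3)]
    define \<phi> where "\<phi> \<alpha> \<beta> = cut_to V (\<lambda>y. ad s G y t \<alpha> \<beta>)" for \<alpha> \<beta>
    have \<phi>: "\<phi> \<alpha> \<beta> \<in> D" if "\<alpha> \<in> D" "\<beta> \<in> D" for \<alpha> \<beta>
      unfolding \<phi>_def by (rule ad_functional_in_dual[OF tW that])
    have H_brk: "dual_brk ?H \<alpha> \<beta> = dual_brk G \<alpha> \<beta> - \<phi> \<alpha> \<beta>" for \<alpha> \<beta>
      by (simp add: dual_brk_def H \<phi>_def cut_to_def fun_eq_iff)
    have expand: "cobr ?H x (dual_brk ?H \<alpha> \<beta>) \<gamma> =
        cobr G x (dual_brk G \<alpha> \<beta>) \<gamma> - cobr G x (\<phi> \<alpha> \<beta>) \<gamma>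
        - (t (coad G x (dual_brk G \<alpha> \<beta>)) \<gamma> + t (dual_brk G \<alpha> \<beta>) (coad G x \<gamma>)) + ad s G x t (\<phi> \<alpha> \<beta>) \<gamma>"
      if "\<alpha> \<in> D" "\<beta> \<in> D" "\<gamma> \<in> D" for \<alpha> \<beta> \<gamma>
      using that x tensor_diff_left[OF cobr_tensor[OF x]] tensor_diff_left[OF ad_in_tensor_square[OF x t]]
      by (simp add: H H_brk \<phi> dual_brk_closed ad_apply[of "dual_brk G \<alpha> \<beta>" \<gamma>])
    have ad_cobr: "t (cut_to V (\<lambda>y. ad s G y (cobr G x) \<alpha> \<beta>)) \<gamma> =
      t (dual_brk G (coad G x \<alpha>) \<beta>) \<gamma> + t (dual_brk G \<alpha> (coad G x \<beta>)) \<gamma> - t (coad G x (dual_brk G \<alpha> \<beta>)) \<gamma>"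
      if "\<alpha> \<in> D" "\<beta> \<in> D" "\<gamma> \<in> D" for \<alpha> \<beta> \<gamma>
      using that x tensor_diff_left[OF t] tensor_add_left[OF t]
      by (simp add: ad_cobr_functional coad_in_dual dual_brk_closed dual_add)
    \<comment> \<open>Both sides are the Schouten bracket of \<open>\<delta>(x)\<close> and \<open>t\<close>, with the roles of inner and outer tensor exchanged.\<close>
    have sym: "cobr G x (\<phi> \<alpha> \<beta>) \<gamma> + cobr G x (\<phi> \<beta> \<gamma>) \<alpha> + cobr G x (\<phi> \<gamma> \<alpha>) \<beta> =
        t (cut_to V (\<lambda>y. ad s G y (cobr G x) \<alpha> \<beta>)) \<gamma> + t (cut_to V (\<lambda>y. ad s G y (cobr G x) \<beta> \<gamma>)) \<alpha>
        + t (cut_to V (\<lambda>y. ad s G y (cobr G x) \<gamma> \<alpha>)) \<beta>"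
      unfolding \<phi>_def schouten_cyclic[OF cobr_tensor[OF x] tW D] schouten_cyclic[OF t cobr_wedge[OF x] D]
      using schouten_commute[OF cobr_tensor[OF x] t D] by simp
    have quad: "ad s G x t (\<phi> \<alpha> \<beta>) \<gamma> + ad s G x t (\<phi> \<beta> \<gamma>) \<alpha> + ad s G x t (\<phi> \<gamma> \<alpha>) \<beta> =
        - schouten G (ad s G x t) t \<alpha> \<beta> \<gamma>"
      unfolding \<phi>_def by (rule schouten_cyclic[OF ad_in_tensor_square[OF x t] tW D])
    have E: "2 * cobr_ext G t \<alpha> \<beta> \<gamma> + schouten G t t \<alpha> \<beta> \<gamma> = 0"
      if "\<alpha> \<in> D" "\<beta> \<in> D" "\<gamma> \<in> D" for \<alpha> \<beta> \<gamma>
      using tE[OF that] by (simp add: field_simps)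
    let ?J = "cobr ?H x (dual_brk ?H \<alpha> \<beta>) \<gamma> + cobr ?H x (dual_brk ?H \<beta> \<gamma>) \<alpha> + cobr ?H x (dual_brk ?H \<gamma> \<alpha>) \<beta>"
    let ?K = "\<lambda>\<alpha> \<beta> \<gamma>. t (coad G x (dual_brk G \<alpha> \<beta>)) \<gamma> + t (dual_brk G \<alpha> \<beta>) (coad G x \<gamma>)"
    have "?J = (cobr G x (dual_brk G \<alpha> \<beta>) \<gamma> + cobr G x (dual_brk G \<beta> \<gamma>) \<alpha> + cobr G x (dual_brk G \<gamma> \<alpha>) \<beta>)
      - (cobr G x (\<phi> \<alpha> \<beta>) \<gamma> + cobr G x (\<phi> \<beta> \<gamma>) \<alpha> + cobr G x (\<phi> \<gamma> \<alpha>) \<beta>)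
      - (?K \<alpha> \<beta> \<gamma> + ?K \<beta> \<gamma> \<alpha> + ?K \<gamma> \<alpha> \<beta>)
      + (ad s G x t (\<phi> \<alpha> \<beta>) \<gamma> + ad s G x t (\<phi> \<beta> \<gamma>) \<alpha> + ad s G x t (\<phi> \<gamma> \<alpha>) \<beta>)"
      unfolding expand[OF D(1,2,3)] expand[OF D(2,3,1)] expand[OF D(3,1,2)] by (simp add: algebra_simps)
    also have "\<dots> = - (cobr_ext G t (coad G x \<alpha>) \<beta> \<gamma> + cobr_ext G t \<alpha> (coad G x \<beta>) \<gamma>
        + cobr_ext G t \<alpha> \<beta> (coad G x \<gamma>)) - schouten G (ad s G x t) t \<alpha> \<beta> \<gamma>"
      unfolding co_jacobi[OF x D] sym quad ad_cobr[OF D(1,2,3)] ad_cobr[OF D(2,3,1)] ad_cobr[OF D(3,1,2)] cobr_ext_def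
      by (simp add: algebra_simps)
    finally have "2 * ?J = - (2 * cobr_ext G t (coad G x \<alpha>) \<beta> \<gamma> + 2 * cobr_ext G t \<alpha> (coad G x \<beta>) \<gamma>
        + 2 * cobr_ext G t \<alpha> \<beta> (coad G x \<gamma>)) - 2 * schouten G (ad s G x t) t \<alpha> \<beta> \<gamma>"
      by (simp only: right_diff_distrib distrib_left mult_minus_right)
    also have "\<dots> = - (2 * cobr_ext G t (coad G x \<alpha>) \<beta> \<gamma> + schouten G t t (coad G x \<alpha>) \<beta> \<gamma>)
        - (2 * cobr_ext G t \<alpha> (coad G x \<beta>) \<gamma> + schouten G t t \<alpha> (coad G x \<beta>) \<gamma>)
        - (2 * cobr_ext G t \<alpha> \<beta> (coad G x \<gamma>) + schouten G t t \<alpha> \<beta> (coad G x \<gamma>))"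
      unfolding schouten_derivation[OF t x D] by (simp add: algebra_simps)
    finally have "2 * ?J = 0"
      unfolding E[OF in_D(4,2,3)] E[OF in_D(1,5,3)] E[OF in_D(1,2,6)] by simp
    then show ?thesis unfolding mult_eq_0_iff by simp
  qed
qed

end


section \<open>Products of Lie bialgebras\<close>

text \<open>The transpose of the inclusion of the factor \<open>j\<close>. Elements of the product pair with functionals
  through the legs, which reduces each axiom for the product to the axioms for the factors.\<close>

definition leg :: "(nat \<Rightarrow> ('k::field, 'v::ab_group_add) bialg) \<Rightarrow> nat \<Rightarrow> ((nat \<Rightarrow> 'v) \<Rightarrow> 'k) \<Rightarrow> ('v \<Rightarrow> 'k)"
  where "leg G j \<alpha> = cut_to (underlying (G j)) (\<lambda>x. \<alpha> (incl j x))"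

locale prod_lie_bialg =
  fixes s :: "'k::real_normed_field \<Rightarrow> 'v::ab_group_add \<Rightarrow> 'v" and J :: "nat set" and G :: "nat \<Rightarrow> ('k, 'v) bialg"
  assumes finite_J: "finite J" and vs: "vector_space s" and factor: "j \<in> J \<Longrightarrow> lie_bialg s (G j)"
begin

abbreviation "W \<equiv> prod_space J G"
abbreviation "sW \<equiv> prod_scale s"
abbreviation "PG \<equiv> prod_bialg s J G"

lemma prod_bialg_sel: "underlying PG = W" "brk PG x y j = (if j \<in> J then brk (G j) (x j) (y j) else 0)"
  "cobr PG x = prod_tensor s J G (\<lambda>j. cobr (G j) (x j))"
  by (simp_all add: prod_bialg_def)

lemma prod_vector_space: "vector_space sW"
proof -
  interpret vector_space s by (rule vs)
  show ?thesis
    by unfold_locales (simp_all add: prod_scale_def fun_eq_iff scale_right_distrib scale_left_distrib)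
qed

lemma W_component: "x \<in> W \<Longrightarrow> j \<in> J \<Longrightarrow> x j \<in> underlying (G j)"
  by (simp add: prod_space_def)

lemma incl_in_W: "j \<in> J \<Longrightarrow> x \<in> underlying (G j) \<Longrightarrow> incl j x \<in> W"
  using lie_bialg.V_closed(3)[OF factor] by (auto simp: prod_space_def incl_def)

lemma W_subspace: "module.subspace sW W"
proof -
  interpret vector_space s by (rule vs)
  interpret W: vector_space sW by (rule prod_vector_space)
  show ?thesis
    unfolding W.subspace_def using lie_bialg.V_closed[OF factor]
    by (auto simp: prod_space_def prod_scale_def)
qed

lemma W_decompose: "x \<in> W \<Longrightarrow> x = (\<Sum>j\<in>J. incl j (x j))"
proof
  fix i assume x: "x \<in> W"
  have "(\<Sum>j\<in>K. incl j (x j)) i = (\<Sum>j\<in>K. if j = i then x j else 0)" for K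
    by (induction K rule: infinite_finite_induct) (auto simp: incl_def)
  then show "x i = (\<Sum>j\<in>J. incl j (x j)) i"
    using x finite_J by (simp add: prod_space_def)
qed

lemma W_fin_dim: "fin_dim_subspace sW W"
proof -
  interpret vector_space s by (rule vs)
  interpret W: vector_space sW by (rule prod_vector_space)
  have "\<exists>B. finite B \<and> underlying (G j) = span B" if "j \<in> J" for j
    using lie_bialg.G[OF factor[OF that]] by (simp add: lie_bialgebra_def fin_dim_subspace_def)
  then obtain B where B: "finite (B j)" "underlying (G j) = span (B j)" if "j \<in> J" for j
    by metis
  let ?B = "\<Union>j\<in>J. incl j ` B j"
  have "incl j y \<in> W.span ?B" if "j \<in> J" "y \<in> span (B j)" for j y
    using that(2)
  proof (induction rule: span_induct_alt)
    case base
    have "incl j (0::'v) = 0" by (auto simp: incl_def fun_eq_iff)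
    then show ?case by (simp only: W.span_zero)
  next
    case (step c x y)
    have "incl j (s c x + y) = sW c (incl j x) + incl j y"
      by (auto simp: incl_def prod_scale_def fun_eq_iff)
    moreover have "incl j x \<in> W.span ?B" using step that(1) by (intro W.span_base) blast
    ultimately show ?case using step by (simp only: W.span_add W.span_scale)
  qed
  then have "x \<in> W.span ?B" if "x \<in> W" for x
    using W_decompose[OF that] W_component[OF that] B(2) W.span_sum[of J "\<lambda>j. incl j (x j)" ?B] by simp
  moreover have "W.span ?B \<subseteq> W"
    using B(2) by (intro W.span_minimal W_subspace) (auto intro!: incl_in_W span_base)
  ultimately show ?thesis
    unfolding fin_dim_subspace_def using finite_J B(1) W_subspace by (intro conjI exI[of _ ?B]) auto
qed

lemma leg_in_dual: 
  assumes "j \<in> J" "\<alpha> \<in> dual sW W" shows "leg G j \<alpha> \<in> dual s (underlying (G j))"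
  unfolding leg_def
proof (rule cut_to_in_dual[OF vs lie_bialg.subspace[OF factor[OF assms(1)]]])
  interpret vector_space s by (rule vs)
  have 1: "incl j (x + y) = incl j x + incl j y" "incl j (s c x) = sW c (incl j x)" for c x y
    by (auto simp: incl_def prod_scale_def fun_eq_iff)
  show "linear_on s (*) (underlying (G j)) (\<lambda>x. \<alpha> (incl j x))"
    using assms incl_in_W[OF assms(1)] unfolding linear_on_def 1 by (simp add: dual_def linear_on_def)
qed

lemma leg_apply: "x \<in> underlying (G j) \<Longrightarrow> leg G j \<alpha> x = \<alpha> (incl j x)"
  by (simp add: leg_def cut_to_apply)

lemma prod_tensor_apply:
  "prod_tensor s J G A \<alpha> \<beta> = (if \<alpha> \<in> dual sW W \<and> \<beta> \<in> dual sW W then \<Sum>j\<in>J. A j (leg G j \<alpha>) (leg G j \<beta>) else 0)"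
proof -
  have "(\<Sum>j\<in>K. push (underlying (G j)) sW W (incl j) (A j)) \<alpha> \<beta> =
    (\<Sum>j\<in>K. push (underlying (G j)) sW W (incl j) (A j) \<alpha> \<beta>)" for K
    by (induction K rule: infinite_finite_induct) auto
  then show ?thesis unfolding prod_tensor_def by (auto simp: push_def leg_def)
qed

lemma prod_tensor_in_tensor_square:
  assumes "\<And>j. j \<in> J \<Longrightarrow> A j \<in> tensor_square s (underlying (G j))"
  shows "prod_tensor s J G A \<in> tensor_square sW W"
  unfolding prod_tensor_def
proof (intro tensor_square_sum push_in_tensor_square[OF assms vs])
  interpret vector_space s by (rule vs)
  fix j assume j: "j \<in> J"
  show "module.subspace s (underlying (G j))" by (rule lie_bialg.subspace[OF factor[OF j]])
  show "linear_on s sW (underlying (G j)) (incl j)"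
    by (auto simp: linear_on_def incl_def prod_scale_def fun_eq_iff)
qed (auto intro: incl_in_W)

lemma brk_zero_right: "j \<in> J \<Longrightarrow> x \<in> underlying (G j) \<Longrightarrow> brk (G j) x 0 = 0"
proof -
  assume j: "j \<in> J" and x: "x \<in> underlying (G j)"
  interpret lie_bialg s "G j" by (rule factor[OF j])
  show ?thesis using brk_scale(2)[of 0 x 0] x V_closed(3) by simp
qed

lemma prod_lie_bracket: "lie_bracket_on sW W (brk PG)"
proof -
  note L = lie_bialg.G[OF factor, unfolded lie_bialgebra_def lie_bracket_on_def linear_on_def]
  interpret vector_space s by (rule vs)
  show ?thesis
    unfolding lie_bracket_on_def linear_on_def
  proof (intro conjI ballI allI)
    fix x y assume xy: "x \<in> W" "y \<in> W"
    show "brk PG x y \<in> W" "brk PG x x = 0" using L xy by (auto simp: prod_space_def prod_bialg_sel fun_eq_iff)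
  next
    fix x y z assume xy: "x \<in> W" "y \<in> W" "z \<in> W"
    show "brk PG x (y + z) = brk PG x y + brk PG x z" "brk PG (y + z) x = brk PG y x + brk PG z x"
      using L xy by (auto simp: prod_space_def prod_bialg_sel fun_eq_iff)
    show "brk PG x (brk PG y z) + brk PG y (brk PG z x) + brk PG z (brk PG x y) = 0"
      using L xy by (auto simp: prod_space_def prod_bialg_sel fun_eq_iff)
  next
    fix x y c assume xy: "x \<in> W" "y \<in> W"
    show "brk PG x (sW c y) = sW c (brk PG x y)" "brk PG (sW c y) x = sW c (brk PG y x)"
      using L xy by (auto simp: prod_space_def prod_bialg_sel fun_eq_iff prod_scale_def)
  qed
qed

lemma W_coad_in_dual:
  assumes "x \<in> W" "\<alpha> \<in> dual sW W" shows "coad PG x \<alpha> \<in> dual sW W"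
  unfolding coad_def prod_bialg_sel(1)
proof (rule cut_to_in_dual[OF prod_vector_space W_subspace])
  show "linear_on sW (*) W (\<lambda>u. \<alpha> (brk PG x u))"
    using prod_lie_bracket assms by (simp add: lie_bracket_on_def linear_on_def dual_def)
qed

lemma leg_coad:
  assumes j: "j \<in> J" and x: "x \<in> W"
  shows "leg G j (coad PG x \<alpha>) = coad (G j) (x j) (leg G j \<alpha>)"
proof
  fix y
  show "leg G j (coad PG x \<alpha>) y = coad (G j) (x j) (leg G j \<alpha>) y"
  proof (cases "y \<in> underlying (G j)")
    case True
    have "brk PG x (incl j y) = incl j (brk (G j) (x j) y)"
      using j brk_zero_right W_component[OF x] by (auto simp: incl_def prod_bialg_sel fun_eq_iff)
    then show ?thesis
      using True incl_in_W[OF j True] lie_bialg.brk_closed[OF factor[OF j] W_component[OF x j] True]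
      by (simp add: leg_apply coad_def cut_to_apply prod_bialg_sel)
  qed (simp add: leg_def coad_def cut_to_def)
qed

lemma leg_dual_brk:
  assumes j: "j \<in> J" and D: "\<alpha> \<in> dual sW W" "\<beta> \<in> dual sW W"
  shows "leg G j (dual_brk PG \<alpha> \<beta>) = dual_brk (G j) (leg G j \<alpha>) (leg G j \<beta>)"
proof
  fix y
  show "leg G j (dual_brk PG \<alpha> \<beta>) y = dual_brk (G j) (leg G j \<alpha>) (leg G j \<beta>) y"
  proof (cases "y \<in> underlying (G j)")
    case True
    have zero: "cobr (G i) 0 \<phi> \<psi> = 0" if "i \<in> J" for i \<phi> \<psi>
    proof -
      interpret lie_bialg s "G i" by (rule factor[OF that])
      have "cobr (G i) (s 0 0) = scale2 0 (cobr (G i) 0)"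
        using G V_closed(3) unfolding lie_bialgebra_def linear_on_def by blast
      then show ?thesis by (simp add: scale2_def)
    qed
    have "cobr PG (incl j y) \<alpha> \<beta> = (\<Sum>i\<in>J. if i = j then cobr (G j) y (leg G j \<alpha>) (leg G j \<beta>) else 0)"
      using D zero by (auto simp: prod_bialg_sel prod_tensor_apply incl_def intro!: sum.cong)
    then show ?thesis
      using True j finite_J incl_in_W[OF j True] 
      by (simp add: leg_apply dual_brk_def cut_to_apply prod_bialg_sel(1))
  qed (simp add: leg_def dual_brk_def cut_to_def)
qed

theorem lie_bialgebra_prod: "lie_bialgebra sW PG"
proof (rule lie_bialgebraI)
  show "vector_space sW" by (rule prod_vector_space)
  show "fin_dim_subspace sW (underlying PG)" "lie_bracket_on sW (underlying PG) (brk PG)"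
    by (simp_all add: prod_bialg_sel W_fin_dim prod_lie_bracket)
  show "cobr PG x \<in> wedge_square sW (underlying PG)" if "x \<in> underlying PG" for x
  proof -
    have "cobr PG x \<alpha> \<beta> = - cobr PG x \<beta> \<alpha>" for \<alpha> \<beta>
    proof -
      have "cobr (G j) (x j) \<phi> \<psi> = - cobr (G j) (x j) \<psi> \<phi>" if "j \<in> J" for j \<phi> \<psi>
        using lie_bialg.cobr_wedge[OF factor[OF that] W_component] \<open>x \<in> underlying PG\<close> that
        unfolding prod_bialg_sel lie_bialg.wedge_iff[OF factor[OF that]] by blast
      then have "(\<Sum>j\<in>J. cobr (G j) (x j) (leg G j \<alpha>) (leg G j \<beta>)) = 
        (\<Sum>j\<in>J. - cobr (G j) (x j) (leg G j \<beta>) (leg G j \<alpha>))" by (intro sum.cong refl)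
      then show ?thesis by (simp add: prod_bialg_sel prod_tensor_apply sum_negf)
    qed
    moreover have "cobr PG x \<in> tensor_square sW W"
      using that lie_bialg.cobr_tensor[OF factor W_component]
      unfolding prod_bialg_sel by (intro prod_tensor_in_tensor_square) blast
    ultimately show ?thesis
      unfolding prod_bialg_sel(1) wedge_square_iff[OF prod_vector_space W_subspace] by blast
  qed
  have lin: "cobr (G j) (x + y) = cobr (G j) x + cobr (G j) y" "cobr (G j) (s c x) = scale2 c (cobr (G j) x)"
    if "j \<in> J" "x \<in> underlying (G j)" "y \<in> underlying (G j)" for j c x y
    using lie_bialg.G[OF factor[OF that(1)]] that by (simp_all add: lie_bialgebra_def linear_on_def)
  show "linear_on sW scale2 (underlying PG) (cobr PG)"
    unfolding linear_on_def prod_bialg_sel(1)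
  proof (intro conjI ballI allI ext)
    fix x y \<alpha> \<beta> assume "x \<in> W" "y \<in> W"
    then show "cobr PG (x + y) \<alpha> \<beta> = (cobr PG x + cobr PG y) \<alpha> \<beta>"
      by (simp add: prod_bialg_sel prod_tensor_apply lin W_component flip: sum.distrib)
  next
    fix c x \<alpha> \<beta> assume "x \<in> W"
    with lin(2)[OF _ W_component W_component] show "cobr PG (sW c x) \<alpha> \<beta> = scale2 c (cobr PG x) \<alpha> \<beta>"
      by (simp add: prod_bialg_sel prod_tensor_apply lin W_component prod_scale_def scale2_def sum_distrib_left)
  qed
  show "cobr PG (brk PG x y) = ad sW PG x (cobr PG y) - ad sW PG y (cobr PG x)"
    if "x \<in> underlying PG" "y \<in> underlying PG" for x y
  proof (intro ext)
    fix \<alpha> \<beta>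
    have xy: "x \<in> W" "y \<in> W" using that by (simp_all add: prod_bialg_sel)
    show "cobr PG (brk PG x y) \<alpha> \<beta> = (ad sW PG x (cobr PG y) - ad sW PG y (cobr PG x)) \<alpha> \<beta>"
    proof (cases "\<alpha> \<in> dual sW W \<and> \<beta> \<in> dual sW W")
      case True
      have ad: "ad sW PG x (cobr PG y) \<alpha> \<beta> =
        (\<Sum>j\<in>J. ad s (G j) (x j) (cobr (G j) (y j)) (leg G j \<alpha>) (leg G j \<beta>))"
        if xy: "x \<in> W" "y \<in> W" for x y
      proof -
        have "ad sW PG x (cobr PG y) \<alpha> \<beta> = cobr PG y (coad PG x \<alpha>) \<beta> + cobr PG y \<alpha> (coad PG x \<beta>)"
          using True by (simp add: ad_def coad_def prod_bialg_sel(1))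
        also have "\<dots> = (\<Sum>j\<in>J. ad s (G j) (x j) (cobr (G j) (y j)) (leg G j \<alpha>) (leg G j \<beta>))"
          using True xy lie_bialg.ad_apply[OF factor]
          by (simp add: prod_bialg_sel(3) prod_tensor_apply W_coad_in_dual leg_coad leg_in_dual flip: sum.distrib)
        finally show ?thesis .
      qed
      have "cobr PG (brk PG x y) \<alpha> \<beta> = (\<Sum>j\<in>J. ad s (G j) (x j) (cobr (G j) (y j)) (leg G j \<alpha>) (leg G j \<beta>)
          - ad s (G j) (y j) (cobr (G j) (x j)) (leg G j \<alpha>) (leg G j \<beta>))"
        using True lie_bialg.cobr_cocycle[OF factor] W_component[OF xy(1)] W_component[OF xy(2)]
        by (simp add: prod_bialg_sel prod_tensor_apply)
      then show ?thesis using ad[OF xy] ad[OF xy(2,1)] by (simp add: sum_subtractf)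
    next
      case False
      then show ?thesis by (auto simp: prod_bialg_sel prod_tensor_apply ad_def)
    qed
  qed
  show "cobr PG x (dual_brk PG \<alpha> \<beta>) \<gamma> + cobr PG x (dual_brk PG \<beta> \<gamma>) \<alpha> + cobr PG x (dual_brk PG \<gamma> \<alpha>) \<beta> = 0"
    if x: "x \<in> underlying PG" and D: "\<alpha> \<in> dual sW (underlying PG)" "\<beta> \<in> dual sW (underlying PG)"
      "\<gamma> \<in> dual sW (underlying PG)" for x \<alpha> \<beta> \<gamma>
  proof -
    have closed: "dual_brk PG \<phi> \<psi> \<in> dual sW W" if "\<phi> \<in> dual sW W" "\<psi> \<in> dual sW W" for \<phi> \<psi>
      unfolding dual_brk_def prod_bialg_sel(1)
    proof (rule cut_to_in_dual[OF prod_vector_space W_subspace])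
      show "linear_on sW (*) W (\<lambda>x. cobr PG x \<phi> \<psi>)"
        using \<open>linear_on sW scale2 (underlying PG) (cobr PG)\<close>
        by (simp add: linear_on_def scale2_def prod_bialg_sel(1))
    qed
    have D': "\<alpha> \<in> dual sW W" "\<beta> \<in> dual sW W" "\<gamma> \<in> dual sW W" using D by (simp_all add: prod_bialg_sel)
    have "cobr (G j) (x j) (dual_brk (G j) (leg G j \<alpha>) (leg G j \<beta>)) (leg G j \<gamma>) 
      + cobr (G j) (x j) (dual_brk (G j) (leg G j \<beta>) (leg G j \<gamma>)) (leg G j \<alpha>)
      + cobr (G j) (x j) (dual_brk (G j) (leg G j \<gamma>) (leg G j \<alpha>)) (leg G j \<beta>) = 0" if "j \<in> J" for j
      using x D' that by (intro lie_bialg.co_jacobi[OF factor[OF that]] W_component leg_in_dual) (auto simp: prod_bialg_sel)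
    then have "(\<Sum>j\<in>J. cobr (G j) (x j) (dual_brk (G j) (leg G j \<alpha>) (leg G j \<beta>)) (leg G j \<gamma>) 
      + cobr (G j) (x j) (dual_brk (G j) (leg G j \<beta>) (leg G j \<gamma>)) (leg G j \<alpha>)
      + cobr (G j) (x j) (dual_brk (G j) (leg G j \<gamma>) (leg G j \<alpha>)) (leg G j \<beta>)) = 0" by simp
    then show ?thesis
      using D' closed by (simp add: prod_bialg_sel(3) prod_tensor_apply leg_dual_brk flip: sum.distrib)
  qed
qed

end


section \<open>Smooth functions in coordinates\<close>

lemma topspace_coord_space: "topspace (coord_space I) = PiE I (\<lambda>_. UNIV)"
  by (simp add: coord_space_def)

lemma continuous_map_binop:
  fixes h :: "'a::topological_space \<Rightarrow> 'b::topological_space \<Rightarrow> 'c::topological_space"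
  assumes "continuous_on UNIV (\<lambda>(a, b). h a b)"
    "continuous_map X euclidean f" "continuous_map X euclidean g"
  shows "continuous_map X euclidean (\<lambda>x. h (f x) (g x))"
proof -
  have "continuous_map X (prod_topology euclidean euclidean) (\<lambda>x. (f x, g x))"
    unfolding continuous_map_pairwise using assms(2,3) by (simp add: o_def)
  from continuous_map_compose[OF this, of euclidean "\<lambda>(a, b). h a b"] assms(1)
  show ?thesis by (simp add: o_def)
qed

lemma continuous_map_ring_ops:
  fixes f g :: "'a \<Rightarrow> 'k::real_normed_field"
  assumes "continuous_map X euclidean f" "continuous_map X euclidean g"
  shows "continuous_map X euclidean (\<lambda>x. f x + g x)" "continuous_map X euclidean (\<lambda>x. f x * g x)"
  by (rule continuous_map_binop[OF _ assms], auto simp: case_prod_unfold intro!: continuous_intros)+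

text \<open>A coordinate line through a point of an open set stays in it for small displacements, so partial
  derivatives on open sets are local.\<close>

lemma eventually_coordinate_line:
  assumes W: "openin (coord_space I) W" and x: "x \<in> W" and i: "i \<in> I"
  shows "eventually (\<lambda>z. x(i := z) \<in> W) (nhds (x i))"
proof -
  have ext: "x \<in> extensional I"
    using openin_subset[OF W] x by (auto simp: topspace_coord_space PiE_def)
  have "continuous_map euclidean (coord_space I) (\<lambda>z. x(i := z))"
    unfolding coord_space_def continuous_map_componentwise
  proof (intro conjI ballI)
    fix j assume "j \<in> I"
    show "continuous_map euclidean euclidean (\<lambda>z. (x(i := z)) j)" by (cases "j = i") auto
  qed (use ext i in \<open>auto simp: extensional_def\<close>)
  from openin_continuous_map_preimage[OF this W] have "open {z. x(i := z) \<in> W}" by simp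
  then show ?thesis using x by (auto simp: eventually_nhds)
qed

lemma partial_cong:
  assumes "openin (coord_space I) W" "x \<in> W" "i \<in> I" "\<And>y. y \<in> W \<Longrightarrow> f y = g y"
  shows "partial i f x = partial i g x"
  unfolding partial_def
  by (rule deriv_cong_ev[OF eventually_mono[OF eventually_coordinate_line[OF assms(1-3)]]]) (auto intro: assms(4))

lemma line_differentiable_cong:
  assumes "openin (coord_space I) W" "x \<in> W" "i \<in> I" "\<And>y. y \<in> W \<Longrightarrow> f y = g y"
    and "(\<lambda>z. f (x(i := z))) field_differentiable at (x i)"
  shows "(\<lambda>z. g (x(i := z))) field_differentiable at (x i)"
proof -
  have "eventually (\<lambda>z. f (x(i := z)) = g (x(i := z))) (nhds (x i))"
    by (rule eventually_mono[OF eventually_coordinate_line[OF assms(1-3)]]) (auto intro: assms(4))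
  from DERIV_cong_ev[OF refl this refl] assms(5) show ?thesis
    by (simp add: field_differentiable_def)
qed

text \<open>Coordinate expressions are arbitrary outside the image of their chart, so functions can only be compared on \<open>W\<close>.\<close>

lemma Ck_on_cong:
  assumes "openin (coord_space I) W" "\<And>y. y \<in> W \<Longrightarrow> f y = g y" "Ck_on k I W f"
  shows "Ck_on k I W g"
  using assms(2,3)
proof (induction k arbitrary: f g)
  case 0
  then show ?case by (auto intro: continuous_map_eq)
next
  case (Suc k)
  have "continuous_map (subtopology (coord_space I) W) euclidean g"
    using Suc.prems by (auto intro: continuous_map_eq)
  moreover have "Ck_on k I W (partial i g)" if "i \<in> I" for i
  proof (rule Suc.IH[of "partial i f"])
    show "partial i f y = partial i g y" if "y \<in> W" for y
      by (rule partial_cong[OF assms(1) that \<open>i \<in> I\<close> Suc.prems(1)])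
    show "Ck_on k I W (partial i f)" using Suc.prems(2) \<open>i \<in> I\<close> by simp
  qed
  moreover have "(\<lambda>z. g (x(i := z))) field_differentiable at (x i)" if "i \<in> I" "x \<in> W" for i x
    using line_differentiable_cong[OF assms(1) that(2,1), of f g] Suc.prems that by simp
  ultimately show ?case by simp
qed

lemma Ck_on_Suc_D: "Ck_on (Suc k) I W f \<Longrightarrow> Ck_on k I W f"
  by (induction k arbitrary: f) auto

lemma Ck_on_const: "Ck_on k I W (\<lambda>_. b)"
proof (induction k arbitrary: b)
  case (Suc k)
  have "partial i (\<lambda>_. b) = (\<lambda>_. 0)" for i :: 'a by (simp add: partial_def fun_eq_iff)
  then show ?case using Suc[of 0] by simp
qed simp

lemma partial_add:
  assumes "(\<lambda>z. f (x(i := z))) field_differentiable at (x i)" "(\<lambda>z. g (x(i := z))) field_differentiable at (x i)"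
  shows "partial i (\<lambda>y. f y + g y) x = partial i f x + partial i g x"
  unfolding partial_def
  by (rule DERIV_imp_deriv) (intro DERIV_add; use assms in \<open>simp add: DERIV_deriv_iff_field_differentiable\<close>)

lemma partial_mult:
  assumes "(\<lambda>z. f (x(i := z))) field_differentiable at (x i)" "(\<lambda>z. g (x(i := z))) field_differentiable at (x i)"
  shows "partial i (\<lambda>y. f y * g y) x = partial i f x * g x + f x * partial i g x"
proof -
  have "((\<lambda>z. f (x(i := z)) * g (x(i := z))) has_field_derivative
     deriv (\<lambda>z. f (x(i := z))) (x i) * g (x(i := x i)) + deriv (\<lambda>z. g (x(i := z))) (x i) * f (x(i := x i))) (at (x i))"
    by (rule DERIV_mult) (use assms in \<open>simp_all add: DERIV_deriv_iff_field_differentiable\<close>)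
  then show ?thesis unfolding partial_def by (simp add: DERIV_imp_deriv mult.commute)
qed

lemma Ck_on_add:
  assumes W: "openin (coord_space I) W" and "Ck_on k I W f" "Ck_on k I W g"
  shows "Ck_on k I W (\<lambda>x. f x + g x)"
  using assms(2,3)
proof (induction k arbitrary: f g)
  case 0
  then show ?case by (simp add: continuous_map_ring_ops)
next
  case (Suc k)
  have "Ck_on k I W (partial i (\<lambda>x. f x + g x))" if "i \<in> I" for i
  proof (rule Ck_on_cong[OF W])
    show "Ck_on k I W (\<lambda>x. partial i f x + partial i g x)" using Suc that by simp
    show "partial i f x + partial i g x = partial i (\<lambda>x. f x + g x) x" if "x \<in> W" for x
      using partial_add[of f x i g] Suc.prems that \<open>i \<in> I\<close> by simp
  qed
  moreover have "continuous_map (subtopology (coord_space I) W) euclidean (\<lambda>x. f x + g x)"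
    using Suc.prems by (simp add: continuous_map_ring_ops)
  ultimately show ?case using Suc.prems by (auto intro!: field_differentiable_add)
qed

lemma Ck_on_mult:
  assumes W: "openin (coord_space I) W" and "Ck_on k I W f" "Ck_on k I W g"
  shows "Ck_on k I W (\<lambda>x. f x * g x)"
  using assms(2,3)
proof (induction k arbitrary: f g)
  case 0
  then show ?case by (simp add: continuous_map_ring_ops)
next
  case (Suc k)
  have "Ck_on k I W (partial i (\<lambda>x. f x * g x))" if "i \<in> I" for i
  proof (rule Ck_on_cong[OF W])
    show "Ck_on k I W (\<lambda>x. partial i f x * g x + f x * partial i g x)"
      using Suc.prems that by (intro Ck_on_add[OF W] Suc.IH) (simp_all add: Ck_on_Suc_D del: Ck_on.simps(2), simp_all)
    show "partial i f x * g x + f x * partial i g x = partial i (\<lambda>x. f x * g x) x" if "x \<in> W" for x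
      using partial_mult[of f x i g] Suc.prems that \<open>i \<in> I\<close> by simp
  qed
  moreover have "continuous_map (subtopology (coord_space I) W) euclidean (\<lambda>x. f x * g x)"
    using Suc.prems by (simp add: continuous_map_ring_ops)
  ultimately show ?case using Suc.prems by (auto intro!: field_differentiable_mult)
qed


section \<open>Functions on a chart\<close>

definition smooth_in :: "('a, 'c, 'i, 'k::real_normed_field) manifold \<Rightarrow> 'c \<Rightarrow> ('a \<Rightarrow> 'k) \<Rightarrow> bool"
  where "smooth_in M c h \<longleftrightarrow> smooth_on (idx M) (coord M c ` chart_dom M c) (in_chart M c h)"

locale chart =
  fixes M :: "('a, 'c, 'i, 'k::real_normed_field) manifold" and c :: 'c
  assumes manifold: "is_manifold M" and chart: "c \<in> charts M"
begin

lemma finite_idx: "finite (idx M)" using manifold by (simp add: is_manifold_def)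

lemma open_image: "openin (coord_space (idx M)) (coord M c ` chart_dom M c)"
  using manifold chart by (simp add: is_manifold_def)

lemma inj_coord: "inj_on (coord M c) (chart_dom M c)"
proof -
  have "chart_dom M c \<subseteq> topspace (mtop M)"
    using manifold chart by (auto simp: is_manifold_def)
  moreover have "inj_on (coord M c) (topspace (subtopology (mtop M) (chart_dom M c)))"
    using manifold chart homeomorphic_imp_injective_map by (fastforce simp: is_manifold_def)
  ultimately show ?thesis by (simp add: Int_absorb1)
qed

lemma in_chart_coord: "p \<in> chart_dom M c \<Longrightarrow> in_chart M c h (coord M c p) = h p"
  by (simp add: in_chart_def inj_coord)

lemma in_chart_cong:
  "(\<And>q. q \<in> chart_dom M c \<Longrightarrow> f q = g q) \<Longrightarrow> y \<in> coord M c ` chart_dom M c \<Longrightarrow> in_chart M c f y = in_chart M c g y"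
  by (auto simp: in_chart_coord)

lemma chart_deriv_cong:
  assumes "p \<in> chart_dom M c" "d \<in> idx M" "\<And>q. q \<in> chart_dom M c \<Longrightarrow> f q = g q"
  shows "chart_deriv M c d f p = chart_deriv M c d g p"
  unfolding chart_deriv_def
  by (rule partial_cong[OF open_image imageI[OF assms(1)] assms(2) in_chart_cong[OF assms(3)]])

lemma smooth_in_cong:
  assumes "\<And>q. q \<in> chart_dom M c \<Longrightarrow> f q = g q" "smooth_in M c f"
  shows "smooth_in M c g"
  using assms(2) Ck_on_cong[OF open_image, of "in_chart M c f" "in_chart M c g"] in_chart_cong[of f g, OF assms(1)]
  unfolding smooth_in_def smooth_on_def by blast

lemma smooth_in_const: "smooth_in M c (\<lambda>_. b)"
  by (simp add: smooth_in_def smooth_on_def in_chart_def Ck_on_const)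

lemma smooth_in_add: "smooth_in M c f \<Longrightarrow> smooth_in M c g \<Longrightarrow> smooth_in M c (\<lambda>q. f q + g q)"
  using Ck_on_add[OF open_image] by (simp add: smooth_in_def smooth_on_def in_chart_def)

lemma smooth_in_mult: "smooth_in M c f \<Longrightarrow> smooth_in M c g \<Longrightarrow> smooth_in M c (\<lambda>q. f q * g q)"
  using Ck_on_mult[OF open_image] by (simp add: smooth_in_def smooth_on_def in_chart_def)

lemma smooth_in_sum: "(\<And>i. i \<in> S \<Longrightarrow> smooth_in M c (f i)) \<Longrightarrow> smooth_in M c (\<lambda>q. \<Sum>i\<in>S. f i q)"
  by (induction S rule: infinite_finite_induct) (auto intro: smooth_in_const smooth_in_add)

lemma smooth_in_differentiable:
  assumes "smooth_in M c f" "p \<in> chart_dom M c" "d \<in> idx M"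
  shows "(\<lambda>z. in_chart M c f ((coord M c p)(d := z))) field_differentiable at (coord M c p d)"
proof -
  have "Ck_on (Suc 0) (idx M) (coord M c ` chart_dom M c) (in_chart M c f)"
    using assms(1) unfolding smooth_in_def smooth_on_def by blast
  then show ?thesis using assms(2,3) by simp
qed

context
  fixes p d assumes p: "p \<in> chart_dom M c" and d: "d \<in> idx M"
begin

lemma chart_deriv_const: "chart_deriv M c d (\<lambda>_. b) p = 0"
  by (simp add: chart_deriv_def in_chart_def partial_def)

lemma chart_deriv_add:
  assumes "smooth_in M c f" "smooth_in M c g"
  shows "chart_deriv M c d (\<lambda>q. f q + g q) p = chart_deriv M c d f p + chart_deriv M c d g p"
  using partial_add[OF smooth_in_differentiable[OF assms(1) p d] smooth_in_differentiable[OF assms(2) p d]]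
  by (simp add: chart_deriv_def in_chart_def)

lemma chart_deriv_mult:
  assumes "smooth_in M c f" "smooth_in M c g"
  shows "chart_deriv M c d (\<lambda>q. f q * g q) p = chart_deriv M c d f p * g p + f p * chart_deriv M c d g p"
  using partial_mult[OF smooth_in_differentiable[OF assms(1) p d] smooth_in_differentiable[OF assms(2) p d]]
    in_chart_coord[OF p]
  by (simp add: chart_deriv_def) (simp add: in_chart_def)

lemma chart_deriv_cmult:
  assumes "smooth_in M c f"
  shows "chart_deriv M c d (\<lambda>q. b * f q) p = b * chart_deriv M c d f p"
  using chart_deriv_mult[OF smooth_in_const assms] by (simp add: chart_deriv_const)

lemma chart_deriv_sum:
  assumes "\<And>i. i \<in> S \<Longrightarrow> smooth_in M c (f i)"
  shows "chart_deriv M c d (\<lambda>q. \<Sum>i\<in>S. f i q) p = (\<Sum>i\<in>S. chart_deriv M c d (f i) p)"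
  using assms
  by (induction S rule: infinite_finite_induct)
     (auto simp: chart_deriv_const chart_deriv_add smooth_in_sum)

end

end


section \<open>Twisting a Poisson space\<close>

text \<open>Left and right actions are treated at once: a sign \<open>\<epsilon>\<close> equal to \<open>1\<close> stands for left and \<open>-1\<close> for
  right.\<close>

definition signed_action :: "'k::real_normed_field \<Rightarrow> ('k \<Rightarrow> 'v::ab_group_add \<Rightarrow> 'v) \<Rightarrow> ('k, 'v) bialg
    \<Rightarrow> ('a, 'c, 'i, 'k) manifold \<Rightarrow> ('v \<Rightarrow> ('a, 'c, 'i, 'k) vfield) \<Rightarrow> bool"
  where "signed_action \<epsilon> s G M \<sigma> \<longleftrightarrow> linear_to_vector_fields s (underlying G) M \<sigma> \<and>
    (\<forall>x\<in>underlying G. \<forall>y\<in>underlying G.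
      vf_eq M (\<sigma> (brk G x y)) (\<lambda>c p a. - \<epsilon> * vf_bracket M (\<sigma> x) (\<sigma> y) c p a))"

definition signed_poisson_space :: "'k::real_normed_field \<Rightarrow> ('k \<Rightarrow> 'v::ab_group_add \<Rightarrow> 'v) \<Rightarrow> ('k, 'v) bialg
    \<Rightarrow> ('a, 'c, 'i, 'k) manifold \<Rightarrow> ('a, 'c, 'i, 'k) tfield \<Rightarrow> ('v \<Rightarrow> ('a, 'c, 'i, 'k) vfield) \<Rightarrow> bool"
  where "signed_poisson_space \<epsilon> s G M P \<sigma> \<longleftrightarrow>
    lie_bialgebra s G \<and> poisson_structure M P \<and> signed_action \<epsilon> s G M \<sigma> \<and>
    (\<forall>x\<in>underlying G. tf_eq M (vf_tf_bracket M (\<sigma> x) P) (act (underlying G) \<sigma> (cobr G x)))"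

lemma left_poisson_space_iff: "left_poisson_space s G M P \<sigma> \<longleftrightarrow> signed_poisson_space 1 s G M P \<sigma>"
  by (simp add: left_poisson_space_def signed_poisson_space_def left_action_def signed_action_def vf_eq_def)

lemma right_poisson_space_iff: "right_poisson_space s G M P \<sigma> \<longleftrightarrow> signed_poisson_space (- 1) s G M P \<sigma>"
  by (simp add: right_poisson_space_def signed_poisson_space_def right_action_def signed_action_def vf_eq_def)

lemma tensor_lincomb2_left:
  assumes "\<tau> \<in> tensor_square s V" "\<phi> \<in> dual s V" "\<beta> \<in> dual s V" "finite I"
    and "\<And>d. d \<in> I \<Longrightarrow> f d \<in> dual s V" "\<And>d. d \<in> I \<Longrightarrow> g d \<in> dual s V"
    and "\<And>x. x \<in> V \<Longrightarrow> \<phi> x = (\<Sum>d\<in>I. k d * f d x + l d * g d x)"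
  shows "\<tau> \<phi> \<beta> = (\<Sum>d\<in>I. k d * \<tau> (f d) \<beta> + l d * \<tau> (g d) \<beta>)"
proof -
  have "case_sum f g d \<in> dual s V" if "d \<in> I <+> I" for d
    using that assms(5,6) by auto
  from tensor_lincomb_left[OF assms(1-3) this, where I = "I <+> I" and k = "case_sum k l"] assms(4,7) show ?thesis
    by (simp add: sum.Plus sum.distrib)
qed

lemma tensor_lincomb3_left:
  assumes "\<tau> \<in> tensor_square s V" "\<phi> \<in> dual s V" "\<beta> \<in> dual s V" "finite I"
    and "\<And>d. d \<in> I \<Longrightarrow> f d \<in> dual s V" "\<And>d. d \<in> I \<Longrightarrow> g d \<in> dual s V" "\<And>d. d \<in> I \<Longrightarrow> h d \<in> dual s V"
    and "\<And>x. x \<in> V \<Longrightarrow> \<phi> x = (\<Sum>d\<in>I. k d * f d x + l d * g d x + m d * h d x)"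
  shows "\<tau> \<phi> \<beta> = (\<Sum>d\<in>I. k d * \<tau> (f d) \<beta> + l d * \<tau> (g d) \<beta> + m d * \<tau> (h d) \<beta>)"
proof -
  have "case_sum f (case_sum g h) d \<in> dual s V" if "d \<in> I <+> I <+> I" for d
    using that assms(5-7) by auto
  from tensor_lincomb_left[OF assms(1-3) this, where I = "I <+> I <+> I" and k = "case_sum k (case_sum l m)"] assms(4,8) show ?thesis
    by (simp add: sum.Plus sum.distrib add.assoc)
qed

locale action = lie_bialg s G for s :: "'k::real_normed_field \<Rightarrow> 'v::ab_group_add \<Rightarrow> 'v" and G +
  fixes \<epsilon> :: 'k and M :: "('a, 'c, 'i, 'k) manifold" and \<sigma>
  assumes sign: "\<epsilon> * \<epsilon> = 1" and manifold: "is_manifold M" and action: "signed_action \<epsilon> s G M \<sigma>"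

locale action_chart = action s G \<epsilon> M \<sigma> + chart M c
  for s :: "'k::real_normed_field \<Rightarrow> 'v::ab_group_add \<Rightarrow> 'v" and G \<epsilon>
    and M :: "('a, 'c, 'i, 'k) manifold" and \<sigma> and c :: 'c
begin

lemma smooth_\<sigma>: "x \<in> V \<Longrightarrow> a \<in> idx M \<Longrightarrow> smooth_in M c (\<lambda>q. \<sigma> x c q a)"
  using action chart by (simp add: signed_action_def linear_to_vector_fields_def vector_field_def smooth_in_def)

lemma \<sigma>_add: "x \<in> V \<Longrightarrow> y \<in> V \<Longrightarrow> q \<in> chart_dom M c \<Longrightarrow> a \<in> idx M \<Longrightarrow> \<sigma> (x + y) c q a = \<sigma> x c q a + \<sigma> y c q a"
  and \<sigma>_scale: "x \<in> V \<Longrightarrow> q \<in> chart_dom M c \<Longrightarrow> a \<in> idx M \<Longrightarrow> \<sigma> (s k x) c q a = k * \<sigma> x c q a"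
  using action chart by (simp_all add: signed_action_def linear_to_vector_fields_def vf_eq_def)

text \<open>Components of \<open>\<sigma> x\<close> at \<open>p\<close>, and their derivatives, as functionals of \<open>x\<close>. Then \<open>\<sigma>(t)\<^sup>a\<^sup>b\<close> is the value of
  \<open>t\<close> on two such functionals, and the calculus of \<open>\<sigma>(t)\<close> becomes linear algebra.\<close>

definition frame :: "'a \<Rightarrow> 'i \<Rightarrow> 'v \<Rightarrow> 'k"
  where "frame p a = cut_to V (\<lambda>x. \<sigma> x c p a)"

definition dframe :: "'a \<Rightarrow> 'i \<Rightarrow> 'i \<Rightarrow> 'v \<Rightarrow> 'k"
  where "dframe p d a = cut_to V (\<lambda>x. chart_deriv M c d (\<lambda>q. \<sigma> x c q a) p)"

lemma act_frame: "act V \<sigma> \<tau> c p a b = \<tau> (frame p a) (frame p b)"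
  by (simp add: act_def frame_def)

lemma frame_in_dual: "p \<in> chart_dom M c \<Longrightarrow> a \<in> idx M \<Longrightarrow> frame p a \<in> D"
  unfolding frame_def
  by (rule cut_to_in_dual[OF vector_space_axioms subspace]) (simp add: linear_on_def \<sigma>_add \<sigma>_scale)

lemma frame_apply: "x \<in> V \<Longrightarrow> frame p a x = \<sigma> x c p a"
  and dframe_apply: "x \<in> V \<Longrightarrow> dframe p d a x = chart_deriv M c d (\<lambda>q. \<sigma> x c q a) p"
  by (simp_all add: frame_def dframe_def cut_to_apply)

lemma dframe_in_dual:
  assumes "p \<in> chart_dom M c" "a \<in> idx M" "d \<in> idx M" shows "dframe p d a \<in> D"
  unfolding dframe_def
proof (rule cut_to_in_dual[OF vector_space_axioms subspace])
  have "chart_deriv M c d (\<lambda>q. \<sigma> (x + y) c q a) p = 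
      chart_deriv M c d (\<lambda>q. \<sigma> x c q a) p + chart_deriv M c d (\<lambda>q. \<sigma> y c q a) p" if "x \<in> V" "y \<in> V" for x y
    using chart_deriv_cong[OF assms(1,3), of "\<lambda>q. \<sigma> (x + y) c q a" "\<lambda>q. \<sigma> x c q a + \<sigma> y c q a"]
      chart_deriv_add[OF assms(1,3) smooth_\<sigma>[OF that(1) assms(2)] smooth_\<sigma>[OF that(2) assms(2)]] that assms(2)
    by (simp add: \<sigma>_add)
  moreover have "chart_deriv M c d (\<lambda>q. \<sigma> (s k x) c q a) p = k * chart_deriv M c d (\<lambda>q. \<sigma> x c q a) p"
    if "x \<in> V" for k x
    using chart_deriv_cong[OF assms(1,3), of "\<lambda>q. \<sigma> (s k x) c q a" "\<lambda>q. k * \<sigma> x c q a"]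
      chart_deriv_cmult[OF assms(1,3) smooth_\<sigma>[OF that(1) assms(2)]] that assms(2)
    by (simp add: \<sigma>_scale)
  ultimately show "linear_on s (*) V (\<lambda>x. chart_deriv M c d (\<lambda>q. \<sigma> x c q a) p)"
    by (simp add: linear_on_def)
qed

text \<open>Along a sum of decomposable tensors this is the product rule for \<open>\<Sum> \<sigma>(u)\<^sup>a \<sigma>(v)\<^sup>b\<close>; the sum is then
  folded back into \<open>\<tau>\<close>, so that no choice of decomposition is visible any more.\<close>

lemma act_smooth:
  assumes \<tau>: "\<tau> \<in> tensor_square s V" and ab: "a \<in> idx M" "b \<in> idx M"
  shows "smooth_in M c (\<lambda>q. act V \<sigma> \<tau> c q a b)"
    and "p \<in> chart_dom M c \<Longrightarrow> d \<in> idx M \<Longrightarrow> chart_deriv M c d (\<lambda>q. act V \<sigma> \<tau> c q a b) p =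
      \<tau> (dframe p d a) (frame p b) + \<tau> (frame p a) (dframe p d b)"
proof -
  obtain m :: nat and u v where uv: "\<forall>i<m. u i \<in> V \<and> v i \<in> V"
    "\<forall>\<alpha>\<in>D. \<forall>\<beta>\<in>D. \<tau> \<alpha> \<beta> = (\<Sum>i<m. \<alpha> (u i) * \<beta> (v i))"
    using tensor_square_expansion[OF \<tau>] by blast
  let ?f = "\<lambda>q. \<Sum>i<m. \<sigma> (u i) c q a * \<sigma> (v i) c q b"
  have eq: "?f q = act V \<sigma> \<tau> c q a b" if "q \<in> chart_dom M c" for q
    using uv frame_in_dual[OF that] ab by (simp add: act_frame frame_apply)
  have sm: "smooth_in M c (\<lambda>q. \<sigma> (u i) c q a)" "smooth_in M c (\<lambda>q. \<sigma> (v i) c q b)" if "i < m" for i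
    using that uv ab smooth_\<sigma> by auto
  then show "smooth_in M c (\<lambda>q. act V \<sigma> \<tau> c q a b)"
    by (intro smooth_in_cong[OF eq] smooth_in_sum smooth_in_mult) auto
  assume pd: "p \<in> chart_dom M c" "d \<in> idx M"
  have "chart_deriv M c d (\<lambda>q. act V \<sigma> \<tau> c q a b) p = chart_deriv M c d ?f p"
    by (rule chart_deriv_cong[OF pd]) (simp add: eq)
  also have "\<dots> = (\<Sum>i<m. chart_deriv M c d (\<lambda>q. \<sigma> (u i) c q a * \<sigma> (v i) c q b) p)"
    by (rule chart_deriv_sum[OF pd]) (auto intro: smooth_in_mult sm)
  also have "\<dots> = (\<Sum>i<m. dframe p d a (u i) * frame p b (v i) + frame p a (u i) * dframe p d b (v i))"
    using uv sm by (intro sum.cong refl) (simp add: chart_deriv_mult[OF pd] frame_apply dframe_apply)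
  also have "\<dots> = \<tau> (dframe p d a) (frame p b) + \<tau> (frame p a) (dframe p d b)"
    using uv(2) frame_in_dual[OF pd(1)] dframe_in_dual[OF pd(1) _ pd(2)] ab by (simp add: sum.distrib)
  finally show "chart_deriv M c d (\<lambda>q. act V \<sigma> \<tau> c q a b) p =
      \<tau> (dframe p d a) (frame p b) + \<tau> (frame p a) (dframe p d b)" .
qed

text \<open>Compatibility of the action with brackets, read on functionals. Lie algebra brackets of \<open>\<tau>\<close> evaluated
  on the frame become derivatives of components of vector fields, and conversely.\<close>

lemma coad_frame:
  assumes "p \<in> chart_dom M c" "a \<in> idx M" "x \<in> V" "y \<in> V"
  shows "coad G x (frame p a) y =
    (\<Sum>d\<in>idx M. (- \<epsilon> * frame p d x) * dframe p d a y + (\<epsilon> * dframe p d a x) * frame p d y)"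
proof -
  have "\<sigma> (brk G x y) c p a = - \<epsilon> * vf_bracket M (\<sigma> x) (\<sigma> y) c p a"
    using action assms chart by (simp add: signed_action_def vf_eq_def)
  then show ?thesis
    using assms by (simp add: coad_apply frame_apply dframe_apply brk_closed vf_bracket_def sum_distrib_left algebra_simps)
qed

lemma coad_frame_left:
  assumes "\<tau> \<in> tensor_square s V" "p \<in> chart_dom M c" "a \<in> idx M" "x \<in> V" "\<beta> \<in> D"
  shows "\<tau> (coad G x (frame p a)) \<beta> =
    (\<Sum>d\<in>idx M. (- \<epsilon> * frame p d x) * \<tau> (dframe p d a) \<beta> + (\<epsilon> * dframe p d a x) * \<tau> (frame p d) \<beta>)"
  using assms coad_frame[OF assms(2-4)]
  by (intro tensor_lincomb2_left[OF assms(1)]) (auto intro: coad_in_dual frame_in_dual dframe_in_dual finite_idx)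

lemma coad_frame_right:
  assumes "\<tau> \<in> tensor_square s V" "p \<in> chart_dom M c" "a \<in> idx M" "x \<in> V" "\<beta> \<in> D"
  shows "\<tau> \<beta> (coad G x (frame p a)) =
    (\<Sum>d\<in>idx M. (- \<epsilon> * frame p d x) * \<tau> \<beta> (dframe p d a) + (\<epsilon> * dframe p d a x) * \<tau> \<beta> (frame p d))"
  using coad_frame_left[OF tensor_square_swap[OF assms(1)] assms(2-5)] .

text \<open>Expanding the coadjoint action on the frame produces the three terms of the Lie derivative, multiplied
  by \<open>\<epsilon> * \<epsilon> = 1\<close>.\<close>

lemma lie_derivative_act:
  assumes \<tau>: "\<tau> \<in> tensor_square s V" and p: "p \<in> chart_dom M c" and ab: "a \<in> idx M" "b \<in> idx M" and x: "x \<in> V"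
  shows "vf_tf_bracket M (\<sigma> x) (act V \<sigma> \<tau>) c p a b = - \<epsilon> * act V \<sigma> (ad s G x \<tau>) c p a b"
proof -
  have "- \<epsilon> * act V \<sigma> (ad s G x \<tau>) c p a b = - \<epsilon> * \<tau> (coad G x (frame p a)) (frame p b)
     + - \<epsilon> * \<tau> (frame p a) (coad G x (frame p b))"
    using frame_in_dual[OF p] ab by (simp add: act_frame ad_apply algebra_simps)
  also have "\<dots> = (\<Sum>d\<in>idx M. - \<epsilon> * ((- \<epsilon> * frame p d x) * \<tau> (dframe p d a) (frame p b) + (\<epsilon> * dframe p d a x) * \<tau> (frame p d) (frame p b))
     + - \<epsilon> * ((- \<epsilon> * frame p d x) * \<tau> (frame p a) (dframe p d b) + (\<epsilon> * dframe p d b x) * \<tau> (frame p a) (frame p d)))"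
    unfolding coad_frame_left[OF \<tau> p ab(1) x frame_in_dual[OF p ab(2)]]
      coad_frame_right[OF \<tau> p ab(2) x frame_in_dual[OF p ab(1)]]
    by (simp only: sum_distrib_left sum.distrib[symmetric])
  also have "\<dots> = (\<Sum>d\<in>idx M. (\<epsilon> * \<epsilon>) * (frame p d x * (\<tau> (dframe p d a) (frame p b) + \<tau> (frame p a) (dframe p d b))
     - \<tau> (frame p d) (frame p b) * dframe p d a x - \<tau> (frame p a) (frame p d) * dframe p d b x))"
    by (intro sum.cong refl) (simp add: algebra_simps)
  also have "\<dots> = vf_tf_bracket M (\<sigma> x) (act V \<sigma> \<tau>) c p a b"
    using \<tau> p ab x by (simp add: sign vf_tf_bracket_def act_smooth(2) frame_apply dframe_apply cong: sum.cong)
      (simp add: act_frame)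
  finally show ?thesis by simp
qed

text \<open>With \<open>X\<^sub>d\<^sub>i = t(e\<^sub>d, e\<^sub>i)\<close> and \<open>Z\<^sub>d\<^sub>i\<^sub>j = t(\<partial>\<^sub>d e\<^sub>i, e\<^sub>j)\<close> for the frame \<open>e\<close>, both sides are the same
  quadratic expression in \<open>X\<close> and \<open>Z\<close>. Only first derivatives of the vector fields occur.\<close>

lemma tf_bracket_act:
  assumes tW: "t \<in> wedge_square s V" and p: "p \<in> chart_dom M c" and abe: "a \<in> idx M" "b \<in> idx M" "e \<in> idx M"
  shows "tf_bracket M (act V \<sigma> t) (act V \<sigma> t) c p a b e = - \<epsilon> * schouten G t t (frame p a) (frame p b) (frame p e)"
proof -
  have t: "t \<in> tensor_square s V" and anti: "\<And>\<alpha> \<beta>. t \<alpha> \<beta> = - t \<beta> \<alpha>" using tW unfolding wedge_iff by blast+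
  note fr = frame_in_dual[OF p] dframe_in_dual[OF p]
  define X where "X d i = t (frame p d) (frame p i)" for d i
  define Z where "Z d i j = t (dframe p d i) (frame p j)" for d i j
  have X': "t (frame p i) (frame p d) = - X d i" for d i unfolding X_def by (rule anti)
  have dT: "chart_deriv M c d (\<lambda>q. act V \<sigma> t c q i j) p = Z d i j - Z d j i" if "d \<in> idx M" "i \<in> idx M" "j \<in> idx M" for d i j
    using act_smooth(2)[OF t that(2,3) p that(1)] anti[of "frame p i" "dframe p d j"] by (simp add: Z_def)
  have F: "bracket_12_13 G t t (frame p i) (frame p j) (frame p k) = 
      - \<epsilon> * (\<Sum>d\<in>idx M. Z d i k * X d j - X d k * Z d i j)" if "i \<in> idx M" "j \<in> idx M" "k \<in> idx M" for i j k
  proof -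
    have "t (cut_to V (\<lambda>y. t (coad G y (frame p i)) (frame p k))) (frame p j) = 
       (\<Sum>d\<in>idx M. (- \<epsilon> * Z d i k) * t (frame p d) (frame p j) + (\<epsilon> * X d k) * t (dframe p d i) (frame p j))"
    proof (rule tensor_lincomb2_left[OF t])
      show "cut_to V (\<lambda>y. t (coad G y (frame p i)) (frame p k)) \<in> D"
        using that fr by (intro coad_functional_in_dual t) auto
      fix y assume "y \<in> V"
      then show "cut_to V (\<lambda>y. t (coad G y (frame p i)) (frame p k)) y =
        (\<Sum>d\<in>idx M. - \<epsilon> * Z d i k * frame p d y + \<epsilon> * X d k * dframe p d i y)"
        using that fr coad_frame_left[OF t p that(1) _ fr(1)[OF that(3)]]
        by (simp add: cut_to_apply X_def Z_def algebra_simps)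
    qed (use that fr finite_idx in auto)
    then show ?thesis
      unfolding bracket_12_13_coad by (simp add: X_def Z_def sum_distrib_left algebra_simps)
  qed
  have "- \<epsilon> * schouten G t t (frame p a) (frame p b) (frame p e) = (\<epsilon> * \<epsilon>) * (\<Sum>d\<in>idx M.
      (Z d a e * X d b - X d e * Z d a b) + (Z d b a * X d e - X d a * Z d b e) + (Z d e b * X d a - X d b * Z d e a)
      - (Z d a b * X d e - X d b * Z d a e) - (Z d b e * X d a - X d e * Z d b a) - (Z d e a * X d b - X d a * Z d e b))"
    unfolding schouten_def
    by (simp only: F abe sum.distrib sum_subtractf) (simp add: algebra_simps)
  also have "\<dots> = tf_bracket M (act V \<sigma> t) (act V \<sigma> t) c p a b e"
    unfolding tf_bracket_def sign mult_1_left
    by (intro sum.cong refl) (simp add: dT abe, simp add: act_frame X' algebra_simps)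
  finally show ?thesis by simp
qed

text \<open>The condition \<open>[\<sigma>(x), P] = \<sigma>(\<delta>(x))\<close> says that the dual bracket of two frame functionals is a
  combination of the frame and its derivatives, with coefficients from \<open>P\<close> and its derivatives. Inserting
  this in \<open>t\<close> gives the mixed Schouten bracket term by term.\<close>

lemma tf_bracket_poisson_act:
  assumes tW: "t \<in> wedge_square s V" and p: "p \<in> chart_dom M c" and abe: "a \<in> idx M" "b \<in> idx M" "e \<in> idx M"
    and P: "bivector_field M P" and lie: "\<And>x. x \<in> V \<Longrightarrow> tf_eq M (vf_tf_bracket M (\<sigma> x) P) (act V \<sigma> (cobr G x))"
  shows "tf_bracket M P (act V \<sigma> t) c p a b e = - cobr_ext G t (frame p a) (frame p b) (frame p e)"
proof -
  have t: "t \<in> tensor_square s V" and anti: "\<And>\<alpha> \<beta>. t \<alpha> \<beta> = - t \<beta> \<alpha>" using tW unfolding wedge_iff by blast+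
  note fr = frame_in_dual[OF p] dframe_in_dual[OF p]
  define X where "X d i = t (frame p d) (frame p i)" for d i
  define Z where "Z d i j = t (dframe p d i) (frame p j)" for d i j
  define dP where "dP d i j = chart_deriv M c d (\<lambda>q. P c q i j) p" for d i j
  have X': "t (frame p i) (frame p d) = - X d i" for d i unfolding X_def by (rule anti)
  have dT: "chart_deriv M c d (\<lambda>q. act V \<sigma> t c q i j) p = Z d i j - Z d j i" if "d \<in> idx M" "i \<in> idx M" "j \<in> idx M" for d i j
    using act_smooth(2)[OF t that(2,3) p that(1)] anti[of "frame p i" "dframe p d j"] by (simp add: Z_def)
  have P_anti: "P c p i j = - P c p j i" if "i \<in> idx M" "j \<in> idx M" for i j
    using P chart p that unfolding bivector_field_def tf_eq_def by blast
  have B: "t (dual_brk G (frame p i) (frame p j)) (frame p k) = 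
      (\<Sum>d\<in>idx M. dP d i j * X d k + P c p j d * Z d i k - P c p i d * Z d j k)"
    if "i \<in> idx M" "j \<in> idx M" "k \<in> idx M" for i j k
  proof -
    have "t (dual_brk G (frame p i) (frame p j)) (frame p k) = 
      (\<Sum>d\<in>idx M. dP d i j * t (frame p d) (frame p k) + P c p j d * t (dframe p d i) (frame p k) 
         + (- P c p i d) * t (dframe p d j) (frame p k))"
    proof (rule tensor_lincomb3_left[OF t])
      fix x assume x: "x \<in> V"
      have "vf_tf_bracket M (\<sigma> x) P c p i j = cobr G x (frame p i) (frame p j)"
        using lie[OF x] chart p that by (simp add: tf_eq_def act_frame)
      then have "dual_brk G (frame p i) (frame p j) x = vf_tf_bracket M (\<sigma> x) P c p i j"
        by (simp add: dual_brk_apply x)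
      also have "\<dots> = (\<Sum>d\<in>idx M. dP d i j * frame p d x + P c p j d * dframe p d i x + - P c p i d * dframe p d j x)"
        unfolding vf_tf_bracket_def
      proof (rule sum.cong[OF refl])
        fix d assume "d \<in> idx M"
        then show "\<sigma> x c p d * chart_deriv M c d (\<lambda>q. P c q i j) p - P c p d j * chart_deriv M c d (\<lambda>q. \<sigma> x c q i) p
            - P c p i d * chart_deriv M c d (\<lambda>q. \<sigma> x c q j) p =
          dP d i j * frame p d x + P c p j d * dframe p d i x + - P c p i d * dframe p d j x"
          using P_anti[of d j] that x by (simp add: dP_def frame_apply dframe_apply mult.commute)
      qed
      finally show "dual_brk G (frame p i) (frame p j) x =
        (\<Sum>d\<in>idx M. dP d i j * frame p d x + P c p j d * dframe p d i x + - P c p i d * dframe p d j x)" .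
    qed (use that fr finite_idx dual_brk_closed in auto)
    then show ?thesis by (simp add: X_def Z_def)
  qed
  have "- cobr_ext G t (frame p a) (frame p b) (frame p e) = (\<Sum>d\<in>idx M.
     - ((dP d a b * X d e + P c p b d * Z d a e - P c p a d * Z d b e)
      + (dP d b e * X d a + P c p e d * Z d b a - P c p b d * Z d e a)
      + (dP d e a * X d b + P c p a d * Z d e b - P c p e d * Z d a b)))"
    unfolding cobr_ext_def by (simp only: B abe sum.distrib sum_negf)
  also have "\<dots> = tf_bracket M P (act V \<sigma> t) c p a b e"
    unfolding tf_bracket_def
    by (intro sum.cong refl) (simp add: dT abe, simp add: act_frame X' dP_def algebra_simps)
  finally show ?thesis by simp
qed

end

lemma (in action) act_tensor_field:
  assumes \<tau>: "\<tau> \<in> tensor_square s V"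
  shows "tensor_field M (act V \<sigma> \<tau>)"
  unfolding tensor_field_def
proof (intro conjI ballI)
  fix c a b assume c: "c \<in> charts M" and ab: "a \<in> idx M" "b \<in> idx M"
  interpret action_chart s G \<epsilon> M \<sigma> c by unfold_locales (auto simp: manifold c)
  show "smooth_on (idx M) (coord M c ` chart_dom M c) (in_chart M c (\<lambda>p. act V \<sigma> \<tau> c p a b))"
    using act_smooth(1)[OF \<tau> ab] by (simp add: smooth_in_def)
next
  fix c c' p a b assume c: "c \<in> charts M" "c' \<in> charts M" and p: "p \<in> chart_dom M c \<inter> chart_dom M c'"
    and ab: "a \<in> idx M" "b \<in> idx M"
  interpret c: action_chart s G \<epsilon> M \<sigma> c by unfold_locales (auto simp: manifold c)
  interpret c': action_chart s G \<epsilon> M \<sigma> c' by unfold_locales (auto simp: manifold c)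
  let ?J = "\<lambda>d a. chart_deriv M c d (\<lambda>q. coord M c' q a) p"
  have p': "p \<in> chart_dom M c" "p \<in> chart_dom M c'" using p by auto
  have fr: "c'.frame p i x = (\<Sum>d\<in>idx M. ?J d i * c.frame p d x)" if "i \<in> idx M" "x \<in> V" for i x
    using action c p that
    by (simp add: c.frame_apply c'.frame_apply signed_action_def linear_to_vector_fields_def vector_field_def)
  have "act V \<sigma> \<tau> c' p a b = (\<Sum>d\<in>idx M. ?J d a * \<tau> (c.frame p d) (c'.frame p b))"
    unfolding c'.act_frame using ab p' fr
    by (intro tensor_lincomb_left[OF \<tau>]) (auto intro: c.frame_in_dual c'.frame_in_dual)
  also have "\<dots> = (\<Sum>d\<in>idx M. ?J d a * (\<Sum>e\<in>idx M. ?J e b * \<tau> (c.frame p d) (c.frame p e)))"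
    using ab p' fr
    by (intro sum.cong refl arg_cong2[where f = "(*)"] tensor_lincomb_right[OF \<tau>])
       (auto intro: c.frame_in_dual c'.frame_in_dual)
  finally show "act V \<sigma> \<tau> c' p a b = (\<Sum>d\<in>idx M. \<Sum>e\<in>idx M. ?J d a * ?J e b * act V \<sigma> \<tau> c p d e)"
    by (simp add: c.act_frame sum_distrib_left mult.assoc)
qed

text \<open>By the two preceding brackets, \<open>[P + \<epsilon> \<sigma>(t), P + \<epsilon> \<sigma>(t)]\<close> is
  \<open>- 2 \<epsilon> (\<delta>(t) + 1/2 [t, t])\<close> evaluated on the frame, hence zero. The twisted cobracket is the one for
  which the action stays compatible: \<open>[\<sigma>(x), \<epsilon> \<sigma>(t)] = - \<sigma>([x, t])\<close>.\<close>

theorem signed_poisson_space_twist: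
  assumes sp: "signed_poisson_space \<epsilon> s G M P \<sigma>" and \<epsilon>: "\<epsilon> * \<epsilon> = 1" and tw: "twisting_element s G t"
  defines "R \<equiv> \<lambda>c p a b. P c p a b + \<epsilon> * act (underlying G) \<sigma> t c p a b"
  shows "signed_poisson_space \<epsilon> s (twist s G t) M R \<sigma>"
proof -
  from sp have G: "lie_bialgebra s G" and P: "poisson_structure M P" and act: "signed_action \<epsilon> s G M \<sigma>"
    and lie: "\<And>x. x \<in> underlying G \<Longrightarrow> tf_eq M (vf_tf_bracket M (\<sigma> x) P) (act (underlying G) \<sigma> (cobr G x))"
    by (auto simp: signed_poisson_space_def)
  have M: "is_manifold M" and bP: "bivector_field M P" and tP: "tensor_field M P"
    using P by (auto simp: poisson_structure_def bivector_field_def)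
  interpret action s G \<epsilon> M \<sigma> by unfold_locales (use G \<epsilon> M act in auto)
  have tW: "t \<in> wedge_square s V" and tE: "\<And>\<alpha> \<beta> \<gamma>. \<alpha> \<in> D \<Longrightarrow> \<beta> \<in> D \<Longrightarrow> \<gamma> \<in> D \<Longrightarrow>
     cobr_ext G t \<alpha> \<beta> \<gamma> + 1 / 2 * schouten G t t \<alpha> \<beta> \<gamma> = 0"
    using tw unfolding twisting_element_def by blast+
  have t: "t \<in> tensor_square s V" and anti: "\<And>\<alpha> \<beta>. t \<alpha> \<beta> = - t \<beta> \<alpha>" using tW unfolding wedge_iff by blast+
  let ?T = "act V \<sigma> t"
  have ch: "action_chart s G \<epsilon> M \<sigma> c" if "c \<in> charts M" for c
    by unfold_locales (auto simp: manifold that)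
  have smP: "smooth_in M c (\<lambda>q. P c q a b)" if "c \<in> charts M" "a \<in> idx M" "b \<in> idx M" for c a b
    using tP that by (simp add: tensor_field_def smooth_in_def)
  have dR: "chart_deriv M c d (\<lambda>q. R c q a b) p = chart_deriv M c d (\<lambda>q. P c q a b) p + \<epsilon> * chart_deriv M c d (\<lambda>q. ?T c q a b) p"
    if "c \<in> charts M" "p \<in> chart_dom M c" "a \<in> idx M" "b \<in> idx M" "d \<in> idx M" for c p a b d
  proof -
    interpret action_chart s G \<epsilon> M \<sigma> c by (rule ch[OF that(1)])
    show ?thesis unfolding R_def
      using smP[OF that(1,3,4)] act_smooth(1)[OF t that(3,4)] that
      by (simp add: chart_deriv_add chart_deriv_cmult smooth_in_mult smooth_in_const)
  qed
  have "tensor_field M R"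
    unfolding tensor_field_def
  proof (intro conjI ballI)
    fix c a b assume c: "c \<in> charts M" and ab: "a \<in> idx M" "b \<in> idx M"
    interpret action_chart s G \<epsilon> M \<sigma> c by (rule ch[OF c])
    show "smooth_on (idx M) (coord M c ` chart_dom M c) (in_chart M c (\<lambda>p. R c p a b))"
      using smooth_in_add[OF smP[OF c ab] smooth_in_mult[OF smooth_in_const act_smooth(1)[OF t ab]]]
      by (simp add: smooth_in_def R_def)
  next
    fix c c' p a b assume c: "c \<in> charts M" "c' \<in> charts M" "p \<in> chart_dom M c \<inter> chart_dom M c'" "a \<in> idx M" "b \<in> idx M"
    have 1: "S c' p a b = (\<Sum>d\<in>idx M. \<Sum>e\<in>idx M. chart_deriv M c d (\<lambda>q. coord M c' q a) p *
         chart_deriv M c e (\<lambda>q. coord M c' q b) p * S c p d e)" if "tensor_field M S" for S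
      using that c unfolding tensor_field_def by blast
    show "R c' p a b = (\<Sum>d\<in>idx M. \<Sum>e\<in>idx M. chart_deriv M c d (\<lambda>q. coord M c' q a) p *
         chart_deriv M c e (\<lambda>q. coord M c' q b) p * R c p d e)"
      using 1[OF tP] 1[OF act_tensor_field[OF t]]
      by (simp add: R_def distrib_left sum.distrib sum_distrib_left mult.assoc mult.left_commute[of _ \<epsilon>])
  qed
  moreover have "R c p a b = - R c p b a"
    if "c \<in> charts M" "p \<in> chart_dom M c" "a \<in> idx M" "b \<in> idx M" for c p a b
  proof -
    have "P c p a b = - P c p b a" using bP that unfolding bivector_field_def tf_eq_def by blast
    moreover have "?T c p a b = - ?T c p b a" unfolding act_def by (rule anti)
    ultimately show ?thesis unfolding R_def by simp
  qed
  ultimately have bR: "bivector_field M R" unfolding bivector_field_def tf_eq_def by blast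
  have jacobi: "tf_bracket M R R c p a b e = 0"
    if c: "c \<in> charts M" and p: "p \<in> chart_dom M c" and abe: "a \<in> idx M" "b \<in> idx M" "e \<in> idx M" for c p a b e
  proof -
    interpret action_chart s G \<epsilon> M \<sigma> c by (rule ch[OF c])
    have "tf_bracket M R R c p a b e = tf_bracket M P P c p a b e + 2 * \<epsilon> * tf_bracket M P ?T c p a b e
        + (\<epsilon> * \<epsilon>) * tf_bracket M ?T ?T c p a b e"
      unfolding tf_bracket_def sum_distrib_left sum.distrib[symmetric]
      by (intro sum.cong refl) (simp add: dR[OF c p] abe, simp add: R_def algebra_simps)
    also have "\<dots> = - (2 * \<epsilon>) * (cobr_ext G t (frame p a) (frame p b) (frame p e)
        + 1 / 2 * schouten G t t (frame p a) (frame p b) (frame p e))"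
      using P c p abe
      by (simp add: poisson_structure_def tf_bracket_act[OF tW p abe] tf_bracket_poisson_act[OF tW p abe bP lie] \<epsilon> algebra_simps)
    also have "\<dots> = 0" by (simp only: tE frame_in_dual[OF p] abe mult_zero_right)
    finally show ?thesis .
  qed
  have "vf_tf_bracket M (\<sigma> x) R c p a b = act V \<sigma> (cobr G x - ad s G x t) c p a b"
    if x: "x \<in> V" and c: "c \<in> charts M" and p: "p \<in> chart_dom M c" and ab: "a \<in> idx M" "b \<in> idx M" for x c p a b
  proof -
    interpret action_chart s G \<epsilon> M \<sigma> c by (rule ch[OF c])
    have "vf_tf_bracket M (\<sigma> x) R c p a b = vf_tf_bracket M (\<sigma> x) P c p a b + \<epsilon> * vf_tf_bracket M (\<sigma> x) ?T c p a b"
      unfolding vf_tf_bracket_def sum_distrib_left sum.distrib[symmetric]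
      by (intro sum.cong refl) (simp add: dR[OF c p] ab, simp add: R_def algebra_simps)
    also have "\<dots> = act V \<sigma> (cobr G x) c p a b - (\<epsilon> * \<epsilon>) * act V \<sigma> (ad s G x t) c p a b"
      using lie[OF x] c p ab by (simp add: tf_eq_def lie_derivative_act[OF t p ab x])
    finally show ?thesis by (simp add: \<epsilon> act_def)
  qed
  with act bR jacobi M lie_bialgebra_twist[OF tw] show ?thesis
    unfolding signed_poisson_space_def poisson_structure_def
    by (simp add: twist_def signed_action_def tf_eq_def)
qed


section \<open>Product manifolds\<close>

text \<open>Boxes of basic open sets form a basis; they are countably many because the index set is finite.\<close>

lemma second_countable_product_topology:
  assumes K: "finite K" and X: "\<And>j. j \<in> K \<Longrightarrow> second_countable (X j)"
  shows "second_countable (product_topology X K)"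
proof -
  have "\<forall>j\<in>K. \<exists>\<B>. countable \<B> \<and> (\<forall>V\<in>\<B>. openin (X j) V) \<and>
      (\<forall>U x. openin (X j) U \<and> x \<in> U \<longrightarrow> (\<exists>V\<in>\<B>. x \<in> V \<and> V \<subseteq> U))"
    using X by (simp add: second_countable_def)
  from bchoice[OF this] obtain \<B> where \<B>: "\<forall>j\<in>K. countable (\<B> j) \<and> (\<forall>V\<in>\<B> j. openin (X j) V) \<and>
      (\<forall>U x. openin (X j) U \<and> x \<in> U \<longrightarrow> (\<exists>V\<in>\<B> j. x \<in> V \<and> V \<subseteq> U))" ..
  have B: "countable (\<B> j)" "V \<in> \<B> j \<Longrightarrow> openin (X j) V"
    "openin (X j) U \<Longrightarrow> x \<in> U \<Longrightarrow> \<exists>V\<in>\<B> j. x \<in> V \<and> V \<subseteq> U" if "j \<in> K" for j U V x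
    using \<B> that by blast+
  let ?C = "Pi\<^sub>E K ` (\<Pi>\<^sub>E j\<in>K. \<B> j)"
  have cnt: "countable ?C" using countable_PiE[OF K B(1)] by (rule countable_image)
  have op: "openin (product_topology X K) V" if "V \<in> ?C" for V
  proof -
    obtain S where S: "S \<in> (\<Pi>\<^sub>E j\<in>K. \<B> j)" "V = Pi\<^sub>E K S" using \<open>V \<in> ?C\<close> by blast
    have "openin (X j) (S j)" if "j \<in> K" for j using B(2)[OF that PiE_mem[OF S(1) that]] .
    then show ?thesis using K unfolding S(2) openin_PiE_gen by simp
  qed
  have ref: "\<exists>V\<in>?C. x \<in> V \<and> V \<subseteq> U" if U: "openin (product_topology X K) U" "x \<in> U" for U x
  proof -
    obtain S where S: "\<forall>j\<in>K. openin (X j) (S j)" "x \<in> Pi\<^sub>E K S" "Pi\<^sub>E K S \<subseteq> U"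
      using U unfolding openin_product_topology_alt by blast
    have "\<exists>V\<in>\<B> j. x j \<in> V \<and> V \<subseteq> S j" if "j \<in> K" for j
      using S(1,2) that by (intro B(3)) auto
    then have "\<forall>j\<in>K. \<exists>V. V \<in> \<B> j \<and> x j \<in> V \<and> V \<subseteq> S j" by blast
    from bchoice[OF this] obtain V where V: "\<forall>j\<in>K. V j \<in> \<B> j \<and> x j \<in> V j \<and> V j \<subseteq> S j" ..
    have "Pi\<^sub>E K (restrict V K) \<in> ?C" using V by (intro imageI) auto
    moreover have "x \<in> Pi\<^sub>E K (restrict V K)" using V S(2) by (auto simp: PiE_iff)
    moreover have "Pi\<^sub>E K (restrict V K) \<subseteq> U" using V S(3) by (intro subset_trans[OF PiE_mono S(3)]) auto
    ultimately show ?thesis by (intro bexI[of _ "Pi\<^sub>E K (restrict V K)"] conjI)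
  qed
  show ?thesis
    unfolding second_countable_def
  proof (intro exI[of _ ?C] conjI ballI allI impI)
    show "\<exists>V\<in>?C. x \<in> V \<and> V \<subseteq> U" if "openin (product_topology X K) U \<and> x \<in> U" for U x
      using that by (elim conjE) (rule ref)
  qed (rule cnt op, assumption?)+
qed

locale manifold_family =
  fixes K :: "nat set" and Y :: "nat \<Rightarrow> ('a, 'c, 'i, 'k::real_normed_field) manifold"
  assumes finite_K: "finite K" and factor_manifold: "j \<in> K \<Longrightarrow> is_manifold (Y j)"
begin

abbreviation "M \<equiv> prod_manifold K Y"

definition slot :: "nat \<Rightarrow> (nat \<times> 'i \<Rightarrow> 'k) \<Rightarrow> 'i \<Rightarrow> 'k"
  where "slot j x = (\<lambda>a\<in>idx (Y j). x (j, a))"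

lemma prod_manifold_sel:
  "mtop M = product_topology (\<lambda>j. mtop (Y j)) K" "idx M = (SIGMA j:K. idx (Y j))"
  "charts M = (\<Pi>\<^sub>E j\<in>K. charts (Y j))" "chart_dom M c = (\<Pi>\<^sub>E j\<in>K. chart_dom (Y j) (c j))"
  by (simp_all add: prod_manifold_def)

lemma coord_prod: "j \<in> K \<Longrightarrow> a \<in> idx (Y j) \<Longrightarrow> coord M c p (j, a) = coord (Y j) (c j) (p j) a"
  by (simp add: prod_manifold_def)

lemma coord_extensional: "coord M c p \<in> extensional (idx M)"
  by (simp add: prod_manifold_def)

lemma finite_idx_prod: "finite (idx M)"
  using finite_K factor_manifold by (auto simp: prod_manifold_sel is_manifold_def)

lemma continuous_slot:
  assumes "j \<in> K" shows "continuous_map (coord_space (idx M)) (coord_space (idx (Y j))) (slot j)"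
  unfolding coord_space_def continuous_map_componentwise
proof (intro conjI ballI)
  fix a assume a: "a \<in> idx (Y j)"
  then show "continuous_map (product_topology (\<lambda>_. euclidean) (idx M)) euclidean (\<lambda>x. slot j x a)"
    using continuous_map_product_projection[of "(j, a)" "idx M" "\<lambda>_. euclidean"] assms
    by (simp add: slot_def prod_manifold_sel)
qed (auto simp: slot_def)

lemma factor_chart: "c \<in> charts M \<Longrightarrow> j \<in> K \<Longrightarrow> chart (Y j) (c j)"
  using factor_manifold by (auto simp: chart_def prod_manifold_sel)

lemma factor_dom: "p \<in> chart_dom M c \<Longrightarrow> j \<in> K \<Longrightarrow> p j \<in> chart_dom (Y j) (c j)"
  by (auto simp: prod_manifold_sel)

lemma slot_coord:
  assumes "c \<in> charts M" "j \<in> K" "p j \<in> chart_dom (Y j) (c j)"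
  shows "slot j (coord M c p) = coord (Y j) (c j) (p j)"
proof -
  interpret chart "Y j" "c j" by (rule factor_chart[OF assms(1,2)])
  have "coord (Y j) (c j) (p j) \<in> extensional (idx (Y j))"
    using openin_subset[OF open_image] assms(3) by (auto simp: topspace_coord_space PiE_def)
  then show ?thesis using assms(2) by (auto simp: slot_def coord_prod extensional_def fun_eq_iff)
qed

lemma slots_eqI:
  assumes "x \<in> extensional (idx M)" "y \<in> extensional (idx M)" "\<And>j. j \<in> K \<Longrightarrow> slot j x = slot j y"
  shows "x = y"
proof (rule extensionalityI[OF assms(1,2)])
  fix i assume "i \<in> idx M"
  then obtain j a where i: "i = (j, a)" "j \<in> K" "a \<in> idx (Y j)" by (auto simp: prod_manifold_sel)
  have "slot j x a = slot j y a" using assms(3)[OF i(2)] by simp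
  then show "x i = y i" using i by (simp add: slot_def)
qed

text \<open>Stated for boxes inside a chart, so that it serves both for chart images and for overlaps of charts.\<close>

lemma coord_image:
  assumes c: "c \<in> charts M" and S: "\<And>j. j \<in> K \<Longrightarrow> S j \<subseteq> chart_dom (Y j) (c j)"
  shows "coord M c ` (\<Pi>\<^sub>E j\<in>K. S j) =
    {x \<in> topspace (coord_space (idx M)). \<forall>j\<in>K. slot j x \<in> coord (Y j) (c j) ` S j}"
proof (intro set_eqI iffI)
  fix x assume "x \<in> coord M c ` (\<Pi>\<^sub>E j\<in>K. S j)"
  then obtain p where p: "p \<in> (\<Pi>\<^sub>E j\<in>K. S j)" "x = coord M c p" by blast
  have "slot j x \<in> coord (Y j) (c j) ` S j" if "j \<in> K" for j
    using slot_coord[OF c that] p that S[OF that] by auto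
  then show "x \<in> {x \<in> topspace (coord_space (idx M)). \<forall>j\<in>K. slot j x \<in> coord (Y j) (c j) ` S j}"
    using p(2) coord_extensional by (auto simp: topspace_coord_space PiE_def)
next
  fix x assume "x \<in> {x \<in> topspace (coord_space (idx M)). \<forall>j\<in>K. slot j x \<in> coord (Y j) (c j) ` S j}"
  then have x: "x \<in> extensional (idx M)" "\<And>j. j \<in> K \<Longrightarrow> \<exists>q\<in>S j. slot j x = coord (Y j) (c j) q"
    by (auto simp: topspace_coord_space PiE_def)
  then obtain p where p: "\<And>j. j \<in> K \<Longrightarrow> p j \<in> S j \<and> slot j x = coord (Y j) (c j) (p j)" by metis
  have "x = coord M c (restrict p K)"
  proof (rule slots_eqI[OF x(1) coord_extensional])
    fix j assume j: "j \<in> K"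
    have "restrict p K j \<in> chart_dom (Y j) (c j)" using p[OF j] S[OF j] j by auto
    then show "slot j x = slot j (coord M c (restrict p K))"
      using slot_coord[OF c j] p[OF j] j by simp
  qed
  then show "x \<in> coord M c ` (\<Pi>\<^sub>E j\<in>K. S j)" using p by auto
qed

lemma open_coord_image:
  assumes c: "c \<in> charts M" and S: "\<And>j. j \<in> K \<Longrightarrow> S j \<subseteq> chart_dom (Y j) (c j)"
    and op: "\<And>j. j \<in> K \<Longrightarrow> openin (coord_space (idx (Y j))) (coord (Y j) (c j) ` S j)"
  shows "openin (coord_space (idx M)) (coord M c ` (\<Pi>\<^sub>E j\<in>K. S j))"
proof -
  have "{x \<in> topspace (coord_space (idx M)). \<forall>j\<in>L. slot j x \<in> coord (Y j) (c j) ` S j} =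
    topspace (coord_space (idx M)) \<inter>
    (\<Inter>j\<in>L. {x \<in> topspace (coord_space (idx M)). slot j x \<in> coord (Y j) (c j) ` S j})" for L by auto
  moreover have "openin (coord_space (idx M)) (topspace (coord_space (idx M)) \<inter>
    (\<Inter>j\<in>K. {x \<in> topspace (coord_space (idx M)). slot j x \<in> coord (Y j) (c j) ` S j}))"
    using finite_K openin_continuous_map_preimage[OF continuous_slot op]
    by (intro openin_Int_Inter) auto
  ultimately show ?thesis by (simp only: coord_image[OF c S])
qed

lemma inj_coord_prod:
  assumes c: "c \<in> charts M" shows "inj_on (coord M c) (chart_dom M c)"
proof (rule inj_onI)
  fix p q assume pq: "p \<in> chart_dom M c" "q \<in> chart_dom M c" "coord M c p = coord M c q"
  have "p j = q j" if "j \<in> K" for j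
  proof -
    interpret chart "Y j" "c j" by (rule factor_chart[OF c that])
    have "coord (Y j) (c j) (p j) = coord (Y j) (c j) (q j)"
      using slot_coord[OF c that] factor_dom[OF _ that] pq by metis
    then show ?thesis using inj_onD[OF inj_coord] factor_dom[OF _ that] pq by blast
  qed
  then show "p = q" using pq(1,2) by (intro PiE_ext) (auto simp: prod_manifold_sel)
qed

lemma image_chart_dom:
  assumes c: "c \<in> charts M" and x: "x \<in> coord M c ` chart_dom M c" and j: "j \<in> K"
  shows "slot j x \<in> coord (Y j) (c j) ` chart_dom (Y j) (c j)"
    and "in_chart M c (\<lambda>q. h (q j)) x = in_chart (Y j) (c j) h (slot j x)"
proof -
  interpret chart "Y j" "c j" by (rule factor_chart[OF c j])
  obtain p where p: "p \<in> chart_dom M c" "x = coord M c p" using x by blast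
  have pj: "p j \<in> chart_dom (Y j) (c j)" by (rule factor_dom[OF p(1) j])
  show "slot j x \<in> coord (Y j) (c j) ` chart_dom (Y j) (c j)"
    unfolding p(2) slot_coord[where p = p, OF c j pj] using pj by simp
  show "in_chart M c (\<lambda>q. h (q j)) x = in_chart (Y j) (c j) h (slot j x)"
    unfolding p(2) slot_coord[where p = p, OF c j pj] in_chart_coord[OF pj]
    by (simp add: in_chart_def inj_coord_prod[OF c] p(1))
qed

lemma slot_update:
  assumes "i \<in> K" "a \<in> idx (Y l)"
  shows "slot i (x((l, a) := z)) = (if l = i then (slot i x)(a := z) else slot i x)"
  using assms by (auto simp: slot_def fun_eq_iff)

text \<open>A function of the coordinates of one factor has zero derivatives in the directions of the other
  factors. This is the only form of the chain rule that products require.\<close>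

lemma partial_slot:
  assumes "i \<in> K" "a \<in> idx (Y l)"
  shows "partial (l, a) (\<lambda>x. f (slot i x)) x = (if l = i then partial a f (slot i x) else 0)"
  using assms unfolding partial_def slot_update[OF assms] by (auto simp: slot_def)

lemma Ck_on_slot:
  assumes i: "i \<in> K" and sub: "\<And>x. x \<in> W \<Longrightarrow> slot i x \<in> W'" and W: "openin (coord_space (idx M)) W"
    and "Ck_on k (idx (Y i)) W' f"
  shows "Ck_on k (idx M) W (\<lambda>x. f (slot i x))"
  using assms(4)
proof (induction k arbitrary: f)
  have cont: "continuous_map (subtopology (coord_space (idx M)) W) euclidean (\<lambda>x. f (slot i x))"
    if "continuous_map (subtopology (coord_space (idx (Y i))) W') euclidean f" for f :: "('i \<Rightarrow> 'k) \<Rightarrow> 'k"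
  proof -
    have "continuous_map (subtopology (coord_space (idx M)) W) (subtopology (coord_space (idx (Y i))) W') (slot i)"
      using sub by (auto simp: continuous_map_in_subtopology intro!: continuous_map_from_subtopology continuous_slot i)
    from continuous_map_compose[OF this that] show ?thesis by (simp add: o_def)
  qed
  {
    case 0
    then show ?case using cont by simp
  next
    case (Suc k)
    have "Ck_on k (idx M) W (partial (l, a) (\<lambda>x. f (slot i x)))" if "l \<in> K" "a \<in> idx (Y l)" for l a
    proof (cases "l = i")
      case True
      have "partial (l, a) (\<lambda>x. f (slot i x)) = (\<lambda>x. partial a f (slot i x))"
        using partial_slot[OF i that(2)] True by (simp add: fun_eq_iff)
      then show ?thesis using Suc that True by simp
    next
      case False
      have "partial (l, a) (\<lambda>x. f (slot i x)) = (\<lambda>x. 0)"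
        using partial_slot[OF i that(2)] False by (simp add: fun_eq_iff)
      then show ?thesis by (simp add: Ck_on_const)
    qed
    moreover have "(\<lambda>z. f (slot i (x((l, a) := z)))) field_differentiable at (x (l, a))"
      if "l \<in> K" "a \<in> idx (Y l)" "x \<in> W" for l a x
    proof (cases "l = i")
      case True
      have "(\<lambda>z. f ((slot i x)(a := z))) field_differentiable at (slot i x a)"
        using Suc.prems sub[OF that(3)] that(2) True by simp
      moreover have "slot i x a = x (i, a)" using that(2) True by (simp add: slot_def)
      ultimately show ?thesis using that(2) True by (simp add: slot_update[OF i])
    qed (simp add: slot_update[OF i that(2)])
    ultimately show ?case using Suc.prems cont by (auto simp: prod_manifold_sel(2))
  }
qed

lemma open_chart_image: "c \<in> charts M \<Longrightarrow> openin (coord_space (idx M)) (coord M c ` chart_dom M c)"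
  unfolding prod_manifold_sel(4) by (rule open_coord_image) (auto intro: chart.open_image factor_chart)

text \<open>Charts, their inverses and the transition functions are formed slot by slot, so each property follows
  from the factors, the finiteness of \<open>K\<close> giving openness of boxes.\<close>

theorem is_manifold_prod: "is_manifold M"
proof -
  have haus: "Hausdorff_space (mtop M)"
    using factor_manifold by (simp add: prod_manifold_sel(1) Hausdorff_space_product_topology is_manifold_def)
  have sec: "second_countable (mtop M)"
    unfolding prod_manifold_sel(1)
    by (rule second_countable_product_topology[OF finite_K]) (use factor_manifold in \<open>simp add: is_manifold_def\<close>)
  have union: "(\<Union>c\<in>charts M. chart_dom M c) = topspace (mtop M)"
  proof (intro equalityI subsetI)
    fix p assume "p \<in> (\<Union>c\<in>charts M. chart_dom M c)"
    then obtain c where c: "c \<in> charts M" "p \<in> chart_dom M c" by blast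
    have "p j \<in> topspace (mtop (Y j))" if "j \<in> K" for j
    proof -
      have "openin (mtop (Y j)) (chart_dom (Y j) (c j))"
        using factor_manifold[OF that] c(1) that by (auto simp: is_manifold_def prod_manifold_sel)
      then show ?thesis using openin_subset factor_dom[OF c(2) that] by blast
    qed
    then show "p \<in> topspace (mtop M)" using c(2) by (auto simp: prod_manifold_sel PiE_iff)
  next
    fix p assume p: "p \<in> topspace (mtop M)"
    have "\<exists>c\<in>charts (Y j). p j \<in> chart_dom (Y j) c" if "j \<in> K" for j
    proof -
      have "p j \<in> topspace (mtop (Y j))" using p that by (auto simp: prod_manifold_sel)
      also have "\<dots> = (\<Union>c\<in>charts (Y j). chart_dom (Y j) c)"
        using factor_manifold[OF that] by (simp add: is_manifold_def)
      finally show ?thesis by blast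
    qed
    then obtain c where c: "\<And>j. j \<in> K \<Longrightarrow> c j \<in> charts (Y j) \<and> p j \<in> chart_dom (Y j) (c j)" by metis
    have "restrict c K \<in> charts M" "p \<in> chart_dom M (restrict c K)"
      using c p by (auto simp: prod_manifold_sel PiE_iff)
    then show "p \<in> (\<Union>c\<in>charts M. chart_dom M c)" by blast
  qed
  have odom: "openin (mtop M) (chart_dom M c)" if "c \<in> charts M" for c
  proof -
    have "openin (mtop (Y j)) (chart_dom (Y j) (c j))" if "j \<in> K" for j
      using factor_manifold[OF that] \<open>c \<in> charts M\<close> that by (auto simp: is_manifold_def prod_manifold_sel)
    then show ?thesis using finite_K by (simp add: prod_manifold_sel openin_PiE_gen)
  qed
  have homeo: "homeomorphic_map (subtopology (mtop M) (chart_dom M c))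
      (subtopology (coord_space (idx M)) (coord M c ` chart_dom M c)) (coord M c)" if c: "c \<in> charts M" for c
  proof -
    let ?dom = "\<lambda>j. subtopology (mtop (Y j)) (chart_dom (Y j) (c j))"
    let ?im = "\<lambda>j. subtopology (coord_space (idx (Y j))) (coord (Y j) (c j) ` chart_dom (Y j) (c j))"
    have hom: "homeomorphic_map (?dom j) (?im j) (coord (Y j) (c j))"
      and sub: "chart_dom (Y j) (c j) \<subseteq> topspace (mtop (Y j))" if "j \<in> K" for j
      using factor_manifold[OF that] c that by (auto simp: is_manifold_def prod_manifold_sel)
    have "\<exists>g. homeomorphic_maps (?dom j) (?im j) (coord (Y j) (c j)) g" if "j \<in> K" for j
      using hom[OF that] by (simp add: homeomorphic_map_maps)
    then obtain g where g: "\<And>j. j \<in> K \<Longrightarrow> homeomorphic_maps (?dom j) (?im j) (coord (Y j) (c j)) (g j)" by metis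
    have g_coord: "g j (coord (Y j) (c j) q) = q" if "j \<in> K" "q \<in> chart_dom (Y j) (c j)" for j q
      using g[OF that(1)] that(2) sub[OF that(1)] by (auto simp: homeomorphic_maps_def)
    define h where "h x = (\<lambda>j\<in>K. g j (slot j x))" for x
    have h_coord: "h (coord M c p) = p" if "p \<in> chart_dom M c" for p
    proof (rule PiE_ext[of _ K "\<lambda>_. UNIV"])
      fix j assume j: "j \<in> K"
      show "h (coord M c p) j = p j"
        using j slot_coord[where p = p, OF c j factor_dom[OF that j]] g_coord[OF j factor_dom[OF that j]] by (simp add: h_def)
    qed (use that in \<open>auto simp: h_def prod_manifold_sel\<close>)
    have "continuous_map (subtopology (mtop M) (chart_dom M c)) (coord_space (idx M)) (coord M c)"
      unfolding coord_space_def continuous_map_componentwise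
    proof (intro conjI ballI)
      fix i assume "i \<in> idx M"
      then obtain j a where i: "i = (j, a)" "j \<in> K" "a \<in> idx (Y j)" by (auto simp: prod_manifold_sel)
      have "continuous_map (subtopology (mtop M) (chart_dom M c)) (?dom j) (\<lambda>p. p j)"
        unfolding continuous_map_in_subtopology
        using i(2) factor_dom
        by (auto simp: prod_manifold_sel(1) intro!: continuous_map_from_subtopology continuous_map_product_projection)
      moreover have "continuous_map (?dom j) (coord_space (idx (Y j))) (coord (Y j) (c j))"
        using g[OF i(2)] by (auto simp: homeomorphic_maps_def continuous_map_in_subtopology)
      moreover have "continuous_map (coord_space (idx (Y j))) euclidean (\<lambda>x. x a)"
        unfolding coord_space_def by (rule continuous_map_product_projection[OF i(3)])
      ultimately have "continuous_map (subtopology (mtop M) (chart_dom M c)) euclidean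
         ((\<lambda>x. x a) \<circ> (coord (Y j) (c j) \<circ> (\<lambda>p. p j)))" by (intro continuous_map_compose)
      then show "continuous_map (subtopology (mtop M) (chart_dom M c)) euclidean (\<lambda>p. coord M c p i)"
        using i by (simp add: coord_prod o_def)
    qed (use coord_extensional in auto)
    moreover have "continuous_map (subtopology (coord_space (idx M)) (coord M c ` chart_dom M c)) (mtop M) h"
      unfolding prod_manifold_sel(1) continuous_map_componentwise
    proof (intro conjI ballI)
      fix j assume j: "j \<in> K"
      have "continuous_map (subtopology (coord_space (idx M)) (coord M c ` chart_dom M c)) (?im j) (slot j)"
        unfolding continuous_map_in_subtopology
        using image_chart_dom(1)[OF c _ j] by (auto intro!: continuous_map_from_subtopology continuous_slot j)
      moreover have "continuous_map (?im j) (mtop (Y j)) (g j)"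
        using g[OF j] by (auto simp: homeomorphic_maps_def continuous_map_in_subtopology)
      ultimately have "continuous_map (subtopology (coord_space (idx M)) (coord M c ` chart_dom M c)) (mtop (Y j)) (g j \<circ> slot j)"
        by (rule continuous_map_compose)
      then show "continuous_map (subtopology (coord_space (idx M)) (coord M c ` chart_dom M c)) (mtop (Y j)) (\<lambda>x. h x j)"
        using j by (simp add: h_def o_def)
    qed (auto simp: h_def)
    ultimately have "homeomorphic_maps (subtopology (mtop M) (chart_dom M c))
      (subtopology (coord_space (idx M)) (coord M c ` chart_dom M c)) (coord M c) h"
      unfolding homeomorphic_maps_def continuous_map_in_subtopology using h_coord by auto
    then show ?thesis by (rule homeomorphic_maps_imp_map)
  qed
  have smooth: "smooth_on (idx M) (coord M c ` (chart_dom M c \<inter> chart_dom M c')) (in_chart M c (\<lambda>p. coord M c' p i))"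
    if c: "c \<in> charts M" "c' \<in> charts M" and i: "i \<in> idx M" for c c' i
  proof -
    obtain j a where ja: "i = (j, a)" "j \<in> K" "a \<in> idx (Y j)" using i by (auto simp: prod_manifold_sel)
    let ?S = "\<lambda>j. chart_dom (Y j) (c j) \<inter> chart_dom (Y j) (c' j)"
    have dom: "chart_dom M c \<inter> chart_dom M c' = (\<Pi>\<^sub>E j\<in>K. ?S j)"
      by (auto simp: prod_manifold_sel)
    have op: "openin (coord_space (idx (Y l))) (coord (Y l) (c l) ` ?S l)" if l: "l \<in> K" for l
    proof -
      have 1: "homeomorphic_map (subtopology (mtop (Y l)) (chart_dom (Y l) (c l)))
        (subtopology (coord_space (idx (Y l))) (coord (Y l) (c l) ` chart_dom (Y l) (c l))) (coord (Y l) (c l))"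
        and 2: "openin (mtop (Y l)) (chart_dom (Y l) (c l))" "openin (mtop (Y l)) (chart_dom (Y l) (c' l))"
        and 3: "openin (coord_space (idx (Y l))) (coord (Y l) (c l) ` chart_dom (Y l) (c l))"
        using factor_manifold[OF l] c l by (auto simp: is_manifold_def prod_manifold_sel)
      have "openin (subtopology (mtop (Y l)) (chart_dom (Y l) (c l))) (?S l)"
        using 2 by (simp add: openin_open_subtopology openin_Int)
      then have "openin (subtopology (coord_space (idx (Y l))) (coord (Y l) (c l) ` chart_dom (Y l) (c l))) (coord (Y l) (c l) ` ?S l)"
        using homeomorphic_imp_open_map[OF 1] unfolding open_map_def by blast
      then show ?thesis using openin_open_subtopology[OF 3] by blast
    qed
    let ?W = "coord M c ` (\<Pi>\<^sub>E j\<in>K. ?S j)"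
    have W: "openin (coord_space (idx M)) ?W" by (rule open_coord_image[OF c(1) _ op]) auto
    have slot_W: "slot j x \<in> coord (Y j) (c j) ` ?S j" if "x \<in> ?W" for x
      using that ja(2) coord_image[OF c(1), of ?S] by auto
    have sm: "smooth_on (idx (Y j)) (coord (Y j) (c j) ` ?S j) (in_chart (Y j) (c j) (\<lambda>p. coord (Y j) (c' j) p a))"
    proof -
      have "c j \<in> charts (Y j)" "c' j \<in> charts (Y j)" using c ja(2) by (auto simp: prod_manifold_sel)
      then show ?thesis using factor_manifold[OF ja(2)] ja(3) unfolding is_manifold_def by blast
    qed
    have eq: "in_chart (Y j) (c j) (\<lambda>p. coord (Y j) (c' j) p a) (slot j x) = in_chart M c (\<lambda>p. coord M c' p i) x"
      if "x \<in> ?W" for x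
    proof -
      have "x \<in> coord M c ` chart_dom M c" using that dom by blast
      from image_chart_dom(2)[OF c(1) this ja(2), of "\<lambda>p. coord (Y j) (c' j) p a"] show ?thesis
        using ja by (simp add: coord_prod)
    qed
    show ?thesis
      unfolding dom smooth_on_def
    proof
      fix k
      have "Ck_on k (idx (Y j)) (coord (Y j) (c j) ` ?S j) (in_chart (Y j) (c j) (\<lambda>p. coord (Y j) (c' j) p a))"
        using sm unfolding smooth_on_def ..
      from Ck_on_cong[OF W eq Ck_on_slot[OF ja(2) slot_W W this]]
      show "Ck_on k (idx M) ?W (in_chart M c (\<lambda>p. coord M c' p i))" .
    qed
  qed
  show ?thesis
    unfolding is_manifold_def
    by (intro conjI ballI; (rule haus sec finite_idx_prod union odom open_chart_image homeo smooth; assumption))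
qed

lemma prod_chart: "c \<in> charts M \<Longrightarrow> chart M c"
  by (simp add: chart_def is_manifold_prod)

lemma smooth_in_prod:
  assumes c: "c \<in> charts M" and j: "j \<in> K" and h: "smooth_in (Y j) (c j) h"
  shows "smooth_in M c (\<lambda>q. h (q j))"
  unfolding smooth_in_def smooth_on_def
proof
  fix k
  have "Ck_on k (idx (Y j)) (coord (Y j) (c j) ` chart_dom (Y j) (c j)) (in_chart (Y j) (c j) h)"
    using h unfolding smooth_in_def smooth_on_def ..
  from Ck_on_slot[OF j image_chart_dom(1)[OF c _ j] open_chart_image[OF c] this]
  have "Ck_on k (idx M) (coord M c ` chart_dom M c) (\<lambda>x. in_chart (Y j) (c j) h (slot j x))" .
  from Ck_on_cong[OF open_chart_image[OF c] image_chart_dom(2)[OF c _ j, symmetric] this]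
  show "Ck_on k (idx M) (coord M c ` chart_dom M c) (in_chart M c (\<lambda>q. h (q j)))" .
qed

lemma chart_deriv_prod:
  assumes c: "c \<in> charts M" and p: "p \<in> chart_dom M c" and i: "i \<in> K" and l: "l \<in> K" "d \<in> idx (Y l)"
  shows "chart_deriv M c (l, d) (\<lambda>q. h (q i)) p = (if l = i then chart_deriv (Y i) (c i) d h (p i) else 0)"
proof -
  have "partial (l, d) (in_chart M c (\<lambda>q. h (q i))) (coord M c p) =
      partial (l, d) (\<lambda>x. in_chart (Y i) (c i) h (slot i x)) (coord M c p)"
    by (rule partial_cong[OF open_chart_image[OF c] imageI[OF p] _ image_chart_dom(2)[OF c _ i]])
      (use l in \<open>simp_all add: prod_manifold_sel(2)\<close>)
  also have "\<dots> = (if l = i then chart_deriv (Y i) (c i) d h (p i) else 0)"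
    using partial_slot[OF i l(2)] slot_coord[where p = p, OF c i factor_dom[OF p i]] by (simp add: chart_deriv_def)
  finally show ?thesis by (simp add: chart_deriv_def)
qed

lemma sum_idx_factor:
  assumes i: "i \<in> K" and F: "\<And>l d. l \<in> K \<Longrightarrow> l \<noteq> i \<Longrightarrow> d \<in> idx (Y l) \<Longrightarrow> F (l, d) = 0"
  shows "sum F (idx M) = (\<Sum>d\<in>idx (Y i). F (i, d))"
proof -
  have "sum F (idx M) = sum F (Pair i ` idx (Y i))"
    using i F finite_idx_prod by (intro sum.mono_neutral_right) (auto simp: prod_manifold_sel(2))
  then show ?thesis by (simp add: sum.reindex inj_on_def)
qed

end


section \<open>Products of Poisson spaces\<close>

context manifold_family
begin

lemma factor_charts: "c \<in> charts M \<Longrightarrow> j \<in> K \<Longrightarrow> c j \<in> charts (Y j)"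
  by (auto simp: prod_manifold_sel)

lemma idx_prod_iff: "(j, a) \<in> idx M \<longleftrightarrow> j \<in> K \<and> a \<in> idx (Y j)"
  by (simp add: prod_manifold_sel)

lemma coord_deriv:
  assumes "c \<in> charts M" "p \<in> chart_dom M c" "(j, a) \<in> idx M" "(l, d) \<in> idx M"
  shows "chart_deriv M c (l, d) (\<lambda>q. coord M c' q (j, a)) p =
    (if l = j then chart_deriv (Y j) (c j) d (\<lambda>q. coord (Y j) (c' j) q a) (p j) else 0)"
  using chart_deriv_prod[OF assms(1,2), of j l d "\<lambda>q. coord (Y j) (c' j) q a"] assms(3,4)
  by (simp add: idx_prod_iff coord_prod)

lemma vector_field_prod:
  assumes X: "\<And>j. j \<in> K \<Longrightarrow> vector_field (Y j) (X j)"
  shows "vector_field M (prod_vf X)"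
  unfolding vector_field_def
proof (intro conjI ballI)
  fix c i assume c: "c \<in> charts M" and "i \<in> idx M"
  then obtain j a where i: "i = (j, a)" "j \<in> K" "a \<in> idx (Y j)" by (auto simp: prod_manifold_sel)
  have "smooth_in (Y j) (c j) (\<lambda>p. X j (c j) p a)"
    using X[OF i(2)] factor_charts[OF c i(2)] i(3) by (simp add: vector_field_def smooth_in_def)
  from smooth_in_prod[OF c i(2) this]
  show "smooth_on (idx M) (coord M c ` chart_dom M c) (in_chart M c (\<lambda>p. prod_vf X c p i))"
    by (simp add: smooth_in_def prod_vf_def i)
next
  fix c c' p i assume c: "c \<in> charts M" "c' \<in> charts M" and p: "p \<in> chart_dom M c \<inter> chart_dom M c'" and "i \<in> idx M"
  then obtain j a where i: "i = (j, a)" "j \<in> K" "a \<in> idx (Y j)" by (auto simp: prod_manifold_sel)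
  have p': "p \<in> chart_dom M c" "p \<in> chart_dom M c'" using p by auto
  have "(\<Sum>d\<in>idx M. chart_deriv M c d (\<lambda>q. coord M c' q i) p * prod_vf X c p d) =
     (\<Sum>d\<in>idx (Y j). chart_deriv M c (j, d) (\<lambda>q. coord M c' q i) p * prod_vf X c p (j, d))"
    using i by (intro sum_idx_factor) (auto simp: coord_deriv[OF c(1) p'(1)] idx_prod_iff)
  also have "\<dots> = (\<Sum>d\<in>idx (Y j). chart_deriv (Y j) (c j) d (\<lambda>q. coord (Y j) (c' j) q a) (p j) * X j (c j) (p j) d)"
    using i by (intro sum.cong refl) (simp add: coord_deriv[OF c(1) p'(1)] idx_prod_iff prod_vf_def)
  also have "\<dots> = X j (c' j) (p j) a"
    using X[OF i(2)] factor_charts[OF c(1) i(2)] factor_charts[OF c(2) i(2)] factor_dom[OF p'(1) i(2)] factor_dom[OF p'(2) i(2)] i(3)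
    by (simp add: vector_field_def)
  finally show "prod_vf X c' p i = (\<Sum>d\<in>idx M. chart_deriv M c d (\<lambda>q. coord M c' q i) p * prod_vf X c p d)"
    by (simp add: i prod_vf_def)
qed

lemma prod_tf_deriv:
  assumes "c \<in> charts M" "p \<in> chart_dom M c" "(j, a) \<in> idx M" "(l, b) \<in> idx M" "(i, d) \<in> idx M"
  shows "chart_deriv M c (i, d) (\<lambda>q. prod_tf T c q (j, a) (l, b)) p =
    (if i = j \<and> j = l then chart_deriv (Y j) (c j) d (\<lambda>q. T j (c j) q a b) (p j) else 0)"
proof (cases "j = l")
  case True
  then show ?thesis
    using chart_deriv_prod[OF assms(1,2), of j i d "\<lambda>q. T j (c j) q a b"] assms(3-5)
    by (simp add: idx_prod_iff prod_tf_def)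
qed (simp add: prod_tf_def chart_deriv_def in_chart_def partial_def)

lemma vf_deriv:
  assumes "c \<in> charts M" "p \<in> chart_dom M c" "(j, a) \<in> idx M" "(i, d) \<in> idx M"
  shows "chart_deriv M c (i, d) (\<lambda>q. prod_vf X c q (j, a)) p =
    (if i = j then chart_deriv (Y j) (c j) d (\<lambda>q. X j (c j) q a) (p j) else 0)"
  using chart_deriv_prod[OF assms(1,2), of j i d "\<lambda>q. X j (c j) q a"] assms(3,4)
  by (simp add: idx_prod_iff prod_vf_def)

lemma tensor_field_prod:
  assumes T: "\<And>j. j \<in> K \<Longrightarrow> tensor_field (Y j) (T j)"
  shows "tensor_field M (prod_tf T)"
  unfolding tensor_field_def
proof (intro conjI ballI)
  fix c i k assume c: "c \<in> charts M" and "i \<in> idx M" "k \<in> idx M"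
  then obtain j a l b where i: "i = (j, a)" "j \<in> K" "a \<in> idx (Y j)" "k = (l, b)" "l \<in> K" "b \<in> idx (Y l)"
    by (auto simp: prod_manifold_sel)
  have "smooth_in M c (\<lambda>p. prod_tf T c p i k)"
  proof (cases "j = l")
    case True
    have "smooth_in (Y j) (c j) (\<lambda>p. T j (c j) p a b)"
      using T[OF i(2)] factor_charts[OF c i(2)] i True by (simp add: tensor_field_def smooth_in_def)
    from smooth_in_prod[OF c i(2) this] show ?thesis by (simp add: prod_tf_def i True)
  qed (simp add: prod_tf_def i chart.smooth_in_const[OF prod_chart[OF c]])
  then show "smooth_on (idx M) (coord M c ` chart_dom M c) (in_chart M c (\<lambda>p. prod_tf T c p i k))"
    by (simp add: smooth_in_def)
next
  fix c c' p i k assume c: "c \<in> charts M" "c' \<in> charts M" and p: "p \<in> chart_dom M c \<inter> chart_dom M c'"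
    and "i \<in> idx M" "k \<in> idx M"
  then obtain j a l b where i: "i = (j, a)" "j \<in> K" "a \<in> idx (Y j)" "k = (l, b)" "l \<in> K" "b \<in> idx (Y l)"
    by (auto simp: prod_manifold_sel)
  have p': "p \<in> chart_dom M c" "p \<in> chart_dom M c'" using p by auto
  note [simp] = coord_deriv[OF c(1) p'(1)] idx_prod_iff
  let ?D = "\<lambda>d i. chart_deriv M c d (\<lambda>q. coord M c' q i) p"
  have "(\<Sum>d\<in>idx M. \<Sum>e\<in>idx M. ?D d i * ?D e k * prod_tf T c p d e) =
     (\<Sum>d\<in>idx (Y j). \<Sum>e\<in>idx M. ?D (j, d) i * ?D e k * prod_tf T c p (j, d) e)"
    using i by (intro sum_idx_factor) auto
  also have "\<dots> = (\<Sum>d\<in>idx (Y j). \<Sum>e\<in>idx (Y l). ?D (j, d) i * ?D (l, e) k * prod_tf T c p (j, d) (l, e))"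
    using i by (intro sum.cong refl sum_idx_factor) auto
  also have "\<dots> = prod_tf T c' p i k"
  proof (cases "j = l")
    case True
    have "T j (c' j) (p j) a b = (\<Sum>d\<in>idx (Y j). \<Sum>e\<in>idx (Y j).
         chart_deriv (Y j) (c j) d (\<lambda>q. coord (Y j) (c' j) q a) (p j) *
         chart_deriv (Y j) (c j) e (\<lambda>q. coord (Y j) (c' j) q b) (p j) * T j (c j) (p j) d e)"
      using T[OF i(2)] factor_charts[OF c(1) i(2)] factor_charts[OF c(2) i(2)] factor_dom[OF p'(1) i(2)] factor_dom[OF p'(2) i(2)] i True
      unfolding tensor_field_def by blast
    then show ?thesis using i True by (simp add: prod_tf_def)
  qed (simp add: prod_tf_def i)
  finally show "prod_tf T c' p i k = (\<Sum>d\<in>idx M. \<Sum>e\<in>idx M. ?D d i * ?D e k * prod_tf T c p d e)" by simp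
qed

lemma vf_bracket_prod:
  assumes c: "c \<in> charts M" and p: "p \<in> chart_dom M c" and j: "j \<in> K" "a \<in> idx (Y j)"
  shows "vf_bracket M (prod_vf X) (prod_vf X') c p (j, a) = vf_bracket (Y j) (X j) (X' j) (c j) (p j) a"
proof -
  note [simp] = vf_deriv[OF c p] idx_prod_iff
  have "vf_bracket M (prod_vf X) (prod_vf X') c p (j, a) = (\<Sum>d\<in>idx (Y j).
    prod_vf X c p (j, d) * chart_deriv M c (j, d) (\<lambda>q. prod_vf X' c q (j, a)) p -
    prod_vf X' c p (j, d) * chart_deriv M c (j, d) (\<lambda>q. prod_vf X c q (j, a)) p)"
    unfolding vf_bracket_def using j by (intro sum_idx_factor) auto
  then show ?thesis using j by (simp add: vf_bracket_def) (simp add: prod_vf_def)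
qed

lemma vf_tf_bracket_prod:
  assumes c: "c \<in> charts M" and p: "p \<in> chart_dom M c" and j: "j \<in> K" "a \<in> idx (Y j)" and l: "l \<in> K" "b \<in> idx (Y l)"
  shows "vf_tf_bracket M (prod_vf X) (prod_tf T) c p (j, a) (l, b) =
    prod_tf (\<lambda>j. vf_tf_bracket (Y j) (X j) (T j)) c p (j, a) (l, b)"
proof -
  note [simp] = vf_deriv[OF c p] prod_tf_deriv[OF c p] idx_prod_iff
  let ?F = "\<lambda>d. prod_vf X c p d * chart_deriv M c d (\<lambda>q. prod_tf T c q (j, a) (l, b)) p
    - prod_tf T c p d (l, b) * chart_deriv M c d (\<lambda>q. prod_vf X c q (j, a)) p
    - prod_tf T c p (j, a) d * chart_deriv M c d (\<lambda>q. prod_vf X c q (l, b)) p"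
  have F0: "?F (i, d) = 0" if "i \<in> K" "d \<in> idx (Y i)" "\<not> (i = j \<and> j = l)" for i d
    using that j l by simp (auto simp: prod_tf_def)
  show ?thesis
  proof (cases "j = l")
    case True
    have "sum ?F (idx M) = (\<Sum>d\<in>idx (Y j). ?F (j, d))"
      by (rule sum_idx_factor[OF j(1)]) (rule F0, auto)
    then show ?thesis
      using j l True by (simp add: vf_tf_bracket_def) (simp add: prod_vf_def prod_tf_def)
  next
    case False
    have "sum ?F (idx M) = 0"
    proof (rule sum.neutral, rule ballI)
      fix i assume "i \<in> idx M"
      then show "?F i = 0" using F0[of "fst i" "snd i"] False by (auto simp: prod_manifold_sel(2))
    qed
    then show ?thesis using False by (simp add: vf_tf_bracket_def prod_tf_def)
  qed
qed

text \<open>A summand \<open>P\<^sup>a\<^sup>d \<partial>\<^sub>d P\<^sup>b\<^sup>e\<close> can only be nonzero if all four indices belong to the same factor.\<close>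

lemma tf_bracket_prod:
  assumes c: "c \<in> charts M" and p: "p \<in> chart_dom M c" and j: "j \<in> K" "a \<in> idx (Y j)" and l: "l \<in> K" "b \<in> idx (Y l)"
    and m: "m \<in> K" "e \<in> idx (Y m)"
  shows "tf_bracket M (prod_tf T) (prod_tf T) c p (j, a) (l, b) (m, e) =
    (if j = l \<and> l = m then tf_bracket (Y j) (T j) (T j) (c j) (p j) a b e else 0)"
proof -
  note [simp] = prod_tf_deriv[OF c p] idx_prod_iff
  let ?P = "prod_tf T"
  let ?F = "\<lambda>d. ?P c p (j, a) d * chart_deriv M c d (\<lambda>q. ?P c q (l, b) (m, e)) p
    + ?P c p (j, a) d * chart_deriv M c d (\<lambda>q. ?P c q (l, b) (m, e)) p
    + ?P c p (l, b) d * chart_deriv M c d (\<lambda>q. ?P c q (m, e) (j, a)) p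
    + ?P c p (l, b) d * chart_deriv M c d (\<lambda>q. ?P c q (m, e) (j, a)) p
    + ?P c p (m, e) d * chart_deriv M c d (\<lambda>q. ?P c q (j, a) (l, b)) p
    + ?P c p (m, e) d * chart_deriv M c d (\<lambda>q. ?P c q (j, a) (l, b)) p"
  have Z: "?P c p (j', a') (i, d) * chart_deriv M c (i, d) (\<lambda>q. ?P c q (l', b') (m', e')) p = 0"
    if "l' \<in> K" "b' \<in> idx (Y l')" "m' \<in> K" "e' \<in> idx (Y m')" "i \<in> K" "d \<in> idx (Y i)"
      "\<not> (i = j' \<and> i = l' \<and> i = m')" for i d j' a' l' b' m' e'
    unfolding prod_tf_deriv[OF c p idx_prod_iff[THEN iffD2, OF conjI[OF that(1,2)]]
        idx_prod_iff[THEN iffD2, OF conjI[OF that(3,4)]] idx_prod_iff[THEN iffD2, OF conjI[OF that(5,6)]]]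
    using that(7) by (auto simp: prod_tf_def)
  have F0: "?F (i, d) = 0" if "i \<in> K" "d \<in> idx (Y i)" "\<not> (i = j \<and> j = l \<and> l = m)" for i d
  proof -
    have n: "\<not> (i = j \<and> i = l \<and> i = m)" "\<not> (i = l \<and> i = m \<and> i = j)" "\<not> (i = m \<and> i = j \<and> i = l)"
      using that(3) by blast+
    show ?thesis
      by (simp only: Z[OF l m that(1,2) n(1)] Z[OF m j that(1,2) n(2)] Z[OF j l that(1,2) n(3)] add_0_left)
  qed
  show ?thesis
  proof (cases "j = l \<and> l = m")
    case True
    have "sum ?F (idx M) = (\<Sum>d\<in>idx (Y j). ?F (j, d))"
      by (rule sum_idx_factor[OF j(1)]) (rule F0, auto)
    then show ?thesis
      using j l m True by (simp add: tf_bracket_def) (simp add: prod_tf_def)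
  next
    case False
    have s0: "sum ?F (idx M) = 0"
    proof (rule sum.neutral, rule ballI)
      fix i assume "i \<in> idx M"
      then show "?F i = 0" using F0[of "fst i" "snd i"] False by (auto simp: prod_manifold_sel(2))
    qed
    show ?thesis unfolding if_not_P[OF False] tf_bracket_def by (rule s0)
  qed
qed

lemma poisson_structure_prod:
  assumes P: "\<And>j. j \<in> K \<Longrightarrow> poisson_structure (Y j) (\<pi> j)"
  shows "poisson_structure M (prod_tf \<pi>)"
  unfolding poisson_structure_def bivector_field_def
proof (intro conjI ballI)
  show "is_manifold M" by (rule is_manifold_prod)
  show "tensor_field M (prod_tf \<pi>)"
    using P by (intro tensor_field_prod) (simp add: poisson_structure_def bivector_field_def)
  show "tf_eq M (prod_tf \<pi>) (\<lambda>c p a b. - prod_tf \<pi> c p b a)"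
    unfolding tf_eq_def
  proof (intro ballI)
    fix c p i k assume c: "c \<in> charts M" "p \<in> chart_dom M c" and "i \<in> idx M" "k \<in> idx M"
    then obtain j a l b where i: "i = (j, a)" "j \<in> K" "a \<in> idx (Y j)" "k = (l, b)" "l \<in> K" "b \<in> idx (Y l)"
      by (auto simp: prod_manifold_sel)
    show "prod_tf \<pi> c p i k = - prod_tf \<pi> c p k i"
    proof (cases "j = l")
      case True
      have "\<pi> j (c j) (p j) a b = - \<pi> j (c j) (p j) b a"
        using P[OF i(2)] factor_charts[OF c(1) i(2)] factor_dom[OF c(2) i(2)] i True
        unfolding poisson_structure_def bivector_field_def tf_eq_def by blast
      then show ?thesis using i True by (simp add: prod_tf_def)
    qed (simp add: prod_tf_def i)
  qed
next
  fix c p i k n assume c: "c \<in> charts M" "p \<in> chart_dom M c" and "i \<in> idx M" "k \<in> idx M" "n \<in> idx M"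
  then obtain j a l b m e where i: "i = (j, a)" "j \<in> K" "a \<in> idx (Y j)" "k = (l, b)" "l \<in> K" "b \<in> idx (Y l)"
    "n = (m, e)" "m \<in> K" "e \<in> idx (Y m)"
    by (auto simp: prod_manifold_sel)
  show "tf_bracket M (prod_tf \<pi>) (prod_tf \<pi>) c p i k n = 0"
  proof (cases "j = l \<and> l = m")
    case True
    have "tf_bracket (Y j) (\<pi> j) (\<pi> j) (c j) (p j) a b e = 0"
      using P[OF i(2)] factor_charts[OF c(1) i(2)] factor_dom[OF c(2) i(2)] i(3,6,9) True
      unfolding poisson_structure_def by blast
    then show ?thesis unfolding i(1,4,7) tf_bracket_prod[OF c i(2,3,5,6,8,9)] if_P[OF True] .
  next
    case False
    then show ?thesis unfolding i(1,4,7) tf_bracket_prod[OF c i(2,3,5,6,8,9)] by (rule if_not_P)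
  qed
qed

text \<open>A tensor field given by one formula on the products over \<open>K\<close> and over a larger index set \<open>L\<close>
  projects from the latter to the former, since the Jacobian of the projection only involves the
  coordinates of the factors in \<open>K\<close>.\<close>

lemma projects_to_subproduct:
  assumes L: "manifold_family L Y" and sub: "K \<subseteq> L" and R: "tensor_field M R"
    and local: "\<And>c p j a l b. j \<in> K \<Longrightarrow> l \<in> K \<Longrightarrow> R (restrict c K) (restrict p K) (j, a) (l, b) = R c p (j, a) (l, b)"
  shows "projects_to (prod_manifold L Y) M (\<lambda>p. restrict p K) R R"
  unfolding projects_to_def
proof (intro ballI impI)
  interpret L: manifold_family L Y by (rule L)
  fix c c' p i k
  assume c: "c \<in> charts L.M" "c' \<in> charts M" and p: "p \<in> chart_dom L.M c" "restrict p K \<in> chart_dom M c'"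
    and "i \<in> idx M" "k \<in> idx M"
  then obtain j a l b where i: "i = (j, a)" "j \<in> K" "a \<in> idx (Y j)" "k = (l, b)" "l \<in> K" "b \<in> idx (Y l)"
    by (auto simp: prod_manifold_sel)
  have cK: "restrict c K \<in> charts M" and pK: "restrict p K \<in> chart_dom M (restrict c K)"
    using c(1) p(1) sub by (auto simp: prod_manifold_sel L.prod_manifold_sel PiE_iff)
  let ?C = "\<lambda>j a d. chart_deriv (Y j) (c j) d (\<lambda>q. coord (Y j) (c' j) q a) (p j)"
  have D: "chart_deriv L.M c (m, d) (\<lambda>q. coord M c' (restrict q K) (j, a)) p = (if m = j then ?C j a d else 0)"
    if "j \<in> K" "a \<in> idx (Y j)" "m \<in> L" "d \<in> idx (Y m)" for m d j a
    using L.chart_deriv_prod[OF c(1) p(1), of j m d "\<lambda>q. coord (Y j) (c' j) q a"] that sub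
    by (auto simp: coord_prod)
  have DK: "chart_deriv M (restrict c K) (m, d) (\<lambda>q. coord M c' q (j, a)) (restrict p K) = (if m = j then ?C j a d else 0)"
    if "j \<in> K" "a \<in> idx (Y j)" "m \<in> K" "d \<in> idx (Y m)" for m d j a
    using coord_deriv[OF cK pK] that by (auto simp: idx_prod_iff)
  let ?S = "\<Sum>d\<in>idx (Y j). \<Sum>e\<in>idx (Y l). ?C j a d * ?C l b e * R c p (j, d) (l, e)"
  have "R c' (restrict p K) i k = (\<Sum>d\<in>idx M. \<Sum>e\<in>idx M.
      chart_deriv M (restrict c K) d (\<lambda>q. coord M c' q i) (restrict p K) *
      chart_deriv M (restrict c K) e (\<lambda>q. coord M c' q k) (restrict p K) * R (restrict c K) (restrict p K) d e)"
    using R cK c(2) pK p(2) \<open>i \<in> idx M\<close> \<open>k \<in> idx M\<close> unfolding tensor_field_def by blast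
  also have "\<dots> = (\<Sum>d\<in>idx (Y j). \<Sum>e\<in>idx M.
      chart_deriv M (restrict c K) (j, d) (\<lambda>q. coord M c' q i) (restrict p K) *
      chart_deriv M (restrict c K) e (\<lambda>q. coord M c' q k) (restrict p K) * R (restrict c K) (restrict p K) (j, d) e)"
    using i by (intro sum_idx_factor) (auto simp: DK)
  also have "\<dots> = (\<Sum>d\<in>idx (Y j). \<Sum>e\<in>idx (Y l).
      chart_deriv M (restrict c K) (j, d) (\<lambda>q. coord M c' q i) (restrict p K) *
      chart_deriv M (restrict c K) (l, e) (\<lambda>q. coord M c' q k) (restrict p K) * R (restrict c K) (restrict p K) (j, d) (l, e))"
    using i by (intro sum.cong refl sum_idx_factor) (auto simp: DK)
  also have "\<dots> = ?S"
    using i by (intro sum.cong refl) (simp add: DK local)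
  finally have 1: "R c' (restrict p K) i k = ?S" .
  have jl: "j \<in> L" "l \<in> L" using i sub by auto
  have "(\<Sum>d\<in>idx L.M. \<Sum>e\<in>idx L.M. chart_deriv L.M c d (\<lambda>q. coord M c' (restrict q K) i) p *
      chart_deriv L.M c e (\<lambda>q. coord M c' (restrict q K) k) p * R c p d e) =
    (\<Sum>d\<in>idx (Y j). \<Sum>e\<in>idx L.M. chart_deriv L.M c (j, d) (\<lambda>q. coord M c' (restrict q K) i) p *
      chart_deriv L.M c e (\<lambda>q. coord M c' (restrict q K) k) p * R c p (j, d) e)"
    using i jl by (intro L.sum_idx_factor) (auto simp: D)
  also have "\<dots> = (\<Sum>d\<in>idx (Y j). \<Sum>e\<in>idx (Y l). chart_deriv L.M c (j, d) (\<lambda>q. coord M c' (restrict q K) i) p *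
      chart_deriv L.M c (l, e) (\<lambda>q. coord M c' (restrict q K) k) p * R c p (j, d) (l, e))"
    using i jl by (intro sum.cong refl L.sum_idx_factor) (auto simp: D)
  also have "\<dots> = ?S"
    using i jl by (intro sum.cong refl) (simp add: D)
  finally show "R c' (restrict p K) i k = (\<Sum>d\<in>idx L.M. \<Sum>e\<in>idx L.M.
      chart_deriv L.M c d (\<lambda>q. coord M c' (restrict q K) i) p *
      chart_deriv L.M c e (\<lambda>q. coord M c' (restrict q K) k) p * R c p d e)"
    using 1 by simp
qed

lemma projects_to_factor:
  assumes l: "l \<in> K" and Q: "tensor_field (Y l) Q"
    and diag: "\<And>c p a b. c \<in> charts M \<Longrightarrow> p \<in> chart_dom M c \<Longrightarrow> a \<in> idx (Y l) \<Longrightarrow> b \<in> idx (Y l) \<Longrightarrow>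
      R c p (l, a) (l, b) = Q (c l) (p l) a b"
  shows "projects_to M (Y l) (\<lambda>p. p l) R Q"
  unfolding projects_to_def
proof (intro ballI impI)
  fix c c' p a b
  assume c: "c \<in> charts M" "c' \<in> charts (Y l)" and p: "p \<in> chart_dom M c" "p l \<in> chart_dom (Y l) c'"
    and ab: "a \<in> idx (Y l)" "b \<in> idx (Y l)"
  let ?C = "\<lambda>a d. chart_deriv (Y l) (c l) d (\<lambda>q. coord (Y l) c' q a) (p l)"
  have D: "chart_deriv M c (m, d) (\<lambda>q. coord (Y l) c' (q l) a) p = (if m = l then ?C a d else 0)"
    if "m \<in> K" "d \<in> idx (Y m)" for m d a
    using chart_deriv_prod[OF c(1) p(1) l that, of "\<lambda>q. coord (Y l) c' q a"] .
  have "(\<Sum>d\<in>idx M. \<Sum>e\<in>idx M. chart_deriv M c d (\<lambda>q. coord (Y l) c' (q l) a) p *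
      chart_deriv M c e (\<lambda>q. coord (Y l) c' (q l) b) p * R c p d e) =
    (\<Sum>d\<in>idx (Y l). \<Sum>e\<in>idx M. chart_deriv M c (l, d) (\<lambda>q. coord (Y l) c' (q l) a) p *
      chart_deriv M c e (\<lambda>q. coord (Y l) c' (q l) b) p * R c p (l, d) e)"
    using l by (intro sum_idx_factor) (auto simp: D)
  also have "\<dots> = (\<Sum>d\<in>idx (Y l). \<Sum>e\<in>idx (Y l). chart_deriv M c (l, d) (\<lambda>q. coord (Y l) c' (q l) a) p *
      chart_deriv M c (l, e) (\<lambda>q. coord (Y l) c' (q l) b) p * R c p (l, d) (l, e))"
    using l by (intro sum.cong refl sum_idx_factor) (auto simp: D)
  also have "\<dots> = (\<Sum>d\<in>idx (Y l). \<Sum>e\<in>idx (Y l). ?C a d * ?C b e * Q (c l) (p l) d e)"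
    using l by (intro sum.cong refl) (simp add: D diag[OF c(1) p(1)])
  also have "\<dots> = Q c' (p l) a b"
  proof -
    have "p l \<in> chart_dom (Y l) (c l) \<inter> chart_dom (Y l) c'" using factor_dom[OF p(1) l] p(2) by blast
    from conjunct2[OF Q[unfolded tensor_field_def], rule_format, OF factor_charts[OF c(1) l] c(2) this ab]
    show ?thesis by (rule sym)
  qed
  finally show "Q c' (p l) a b = (\<Sum>d\<in>idx M. \<Sum>e\<in>idx M. chart_deriv M c d (\<lambda>q. coord (Y l) c' (q l) a) p *
      chart_deriv M c e (\<lambda>q. coord (Y l) c' (q l) b) p * R c p d e)" by simp
qed

end

text \<open>The Lie bialgebra is the product over all of \<open>J\<close>, whereas the manifold may be the product over a
  subset \<open>K\<close>. Thus the projection of the twisted Poisson structure to some of the factors is again a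
  twist of a Poisson space by the same twisting element, and no twisting element has to be projected.\<close>

locale poisson_family = manifold_family K Y + prod_lie_bialg s J G
  for K and Y :: "nat \<Rightarrow> ('a, 'c, 'i, 'k::real_normed_field) manifold"
    and s :: "'k \<Rightarrow> 'v::ab_group_add \<Rightarrow> 'v" and J and G +
  fixes \<epsilon> :: 'k and \<pi> :: "nat \<Rightarrow> ('a, 'c, 'i, 'k) tfield" and \<sigma> :: "nat \<Rightarrow> 'v \<Rightarrow> ('a, 'c, 'i, 'k) vfield"
  assumes sub: "K \<subseteq> J" and sign: "\<epsilon> * \<epsilon> = 1"
    and spaces: "j \<in> K \<Longrightarrow> signed_poisson_space \<epsilon> s (G j) (Y j) (\<pi> j) (\<sigma> j)"
begin

abbreviation "\<Lambda> \<equiv> prod_action \<sigma>"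

lemma action_apply: "\<Lambda> x c p (j, a) = \<sigma> j (x j) (c j) (p j) a"
  by (simp add: prod_action_def prod_vf_def)

lemma in_J: "j \<in> K \<Longrightarrow> j \<in> J" using sub by blast

lemma factor_action_chart: "c \<in> charts M \<Longrightarrow> j \<in> K \<Longrightarrow> action_chart s (G j) \<epsilon> (Y j) (\<sigma> j) (c j)"
  using spaces factor[OF in_J] factor_chart[of c j] factor_manifold sign
  by (simp add: action_chart_def action_def action_axioms_def signed_poisson_space_def)

lemma prod_signed_action: "signed_action \<epsilon> sW PG M \<Lambda>"
proof -
  have X: "vector_field M (\<Lambda> x)" if "x \<in> W" for x
    unfolding prod_action_def
    using spaces W_component[OF that in_J]
    by (intro vector_field_prod) (simp add: signed_poisson_space_def signed_action_def linear_to_vector_fields_def)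
  have eq: "vf_eq M Z Z'" if "\<And>c p j a. c \<in> charts M \<Longrightarrow> p \<in> chart_dom M c \<Longrightarrow> j \<in> K \<Longrightarrow> a \<in> idx (Y j) \<Longrightarrow> Z c p (j, a) = Z' c p (j, a)" for Z Z'
    using that unfolding vf_eq_def by (auto simp: prod_manifold_sel(2))
  have "linear_to_vector_fields sW W M \<Lambda>"
    unfolding linear_to_vector_fields_def
  proof (intro conjI ballI allI X eq)
    fix x y c p j a assume xy: "x \<in> W" "y \<in> W" and h: "c \<in> charts M" "p \<in> chart_dom M c" "j \<in> K" "a \<in> idx (Y j)"
    interpret action_chart s "G j" \<epsilon> "Y j" "\<sigma> j" "c j" by (rule factor_action_chart[OF h(1,3)])
    show "\<Lambda> (x + y) c p (j, a) = (\<Lambda> x + \<Lambda> y) c p (j, a)"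
      using xy h W_component in_J factor_dom by (simp add: action_apply \<sigma>_add)
  next
    fix k x c p j a assume x: "x \<in> W" and h: "c \<in> charts M" "p \<in> chart_dom M c" "j \<in> K" "a \<in> idx (Y j)"
    interpret action_chart s "G j" \<epsilon> "Y j" "\<sigma> j" "c j" by (rule factor_action_chart[OF h(1,3)])
    show "\<Lambda> (sW k x) c p (j, a) = k * \<Lambda> x c p (j, a)"
      using x h W_component in_J factor_dom by (simp add: action_apply \<sigma>_scale prod_scale_def)
  qed
  moreover have "vf_eq M (\<Lambda> (brk PG x y)) (\<lambda>c p a. - \<epsilon> * vf_bracket M (\<Lambda> x) (\<Lambda> y) c p a)" if xy: "x \<in> W" "y \<in> W" for x y
  proof (rule eq)
    fix c p j a assume h: "c \<in> charts M" "p \<in> chart_dom M c" "j \<in> K" "a \<in> idx (Y j)"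
    have "\<sigma> j (brk (G j) (x j) (y j)) (c j) (p j) a = - \<epsilon> * vf_bracket (Y j) (\<sigma> j (x j)) (\<sigma> j (y j)) (c j) (p j) a"
      using spaces[OF h(3)] W_component[OF xy(1) in_J[OF h(3)]] W_component[OF xy(2) in_J[OF h(3)]]
        factor_charts[OF h(1,3)] factor_dom[OF h(2,3)] h(4)
      by (simp add: signed_poisson_space_def signed_action_def vf_eq_def)
    then show "\<Lambda> (brk PG x y) c p (j, a) = - \<epsilon> * vf_bracket M (\<Lambda> x) (\<Lambda> y) c p (j, a)"
      using in_J[OF h(3)] unfolding action_apply
      by (simp add: prod_action_def vf_bracket_prod[OF h] prod_bialg_sel)
  qed
  ultimately show ?thesis by (simp add: signed_action_def prod_bialg_sel)
qed

lemma prod_action_chart: "c \<in> charts M \<Longrightarrow> action_chart sW PG \<epsilon> M \<Lambda> c"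
  using lie_bialgebra_prod is_manifold_prod sign prod_signed_action prod_chart
  by (simp add: action_chart_def action_def action_axioms_def lie_bialg_def)

text \<open>The leg of a frame functional of the factor \<open>j\<close> is zero in every other factor, because \<open>\<sigma>\<^sub>i(0) = 0\<close>; so a
  block diagonal tensor acts by a block diagonal tensor field.\<close>

lemma act_prod_tensor:
  assumes A: "\<And>i. i \<in> J \<Longrightarrow> A i \<in> tensor_square s (underlying (G i))"
    and h: "c \<in> charts M" "p \<in> chart_dom M c" and j: "j \<in> K" "a \<in> idx (Y j)" and l: "l \<in> K" "b \<in> idx (Y l)"
  shows "act W \<Lambda> (prod_tensor s J G A) c p (j, a) (l, b) =
    prod_tf (\<lambda>i. act (underlying (G i)) (\<sigma> i) (A i)) c p (j, a) (l, b)"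
proof -
  interpret P: action_chart sW PG \<epsilon> M \<Lambda> c by (rule prod_action_chart[OF h(1)])
  define f where "f j a = cut_to (underlying (G j)) (\<lambda>x. \<sigma> j x (c j) (p j) a)" for j a
  have fr: "P.frame p (j, a) \<in> dual sW W" if "j \<in> K" "a \<in> idx (Y j)" for j a
    using P.frame_in_dual[OF h(2), of "(j, a)"] that by (simp add: idx_prod_iff prod_bialg_sel)
  have f: "f j a \<in> dual s (underlying (G j))" if j: "j \<in> K" "a \<in> idx (Y j)" for j a
  proof -
    interpret action_chart s "G j" \<epsilon> "Y j" "\<sigma> j" "c j" by (rule factor_action_chart[OF h(1) j(1)])
    show ?thesis using frame_in_dual[OF factor_dom[OF h(2) j(1)] j(2)] by (simp add: frame_def f_def)
  qed
  have leg: "leg G i (P.frame p (j, a)) = (if i = j then f j a else 0)"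
    if i: "i \<in> J" and j: "j \<in> K" "a \<in> idx (Y j)" for i j a
  proof
    fix y
    interpret action_chart s "G j" \<epsilon> "Y j" "\<sigma> j" "c j" by (rule factor_action_chart[OF h(1) j(1)])
    have "\<sigma> j 0 (c j) (p j) a = 0"
      using \<sigma>_scale[OF V_closed(3) factor_dom[OF h(2) j(1)] j(2), of 0] by simp
    then show "leg G i (P.frame p (j, a)) y = (if i = j then f j a else 0) y"
      using incl_in_W[OF i, of y]
      by (auto simp: leg_def P.frame_def prod_bialg_sel f_def cut_to_def action_apply incl_def)
  qed
  have "act W \<Lambda> (prod_tensor s J G A) c p (j, a) (l, b) = prod_tensor s J G A (P.frame p (j, a)) (P.frame p (l, b))"
    using P.act_frame by (simp add: prod_bialg_sel)
  also have "\<dots> = (\<Sum>i\<in>J. A i (if i = j then f j a else 0) (if i = l then f l b else 0))"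
    using fr j l by (simp add: prod_tensor_apply leg)
  also have "\<dots> = (\<Sum>i\<in>J. if i = j then if j = l then A j (f j a) (f j b) else 0 else 0)"
    using A f j l in_J by (intro sum.cong refl) (auto simp: tensor_zero_left[OF A] tensor_zero_right[OF A] dual_zero)
  also have "\<dots> = prod_tf (\<lambda>i. act (underlying (G i)) (\<sigma> i) (A i)) c p (j, a) (l, b)"
    using finite_J in_J[OF j(1)] by (simp add: prod_tf_def act_def f_def)
  finally show ?thesis .
qed

lemma prod_signed_poisson_space: "signed_poisson_space \<epsilon> sW PG M (prod_tf \<pi>) \<Lambda>"
proof -
  have "tf_eq M (vf_tf_bracket M (\<Lambda> x) (prod_tf \<pi>)) (act W \<Lambda> (cobr PG x))" if x: "x \<in> W" for x
    unfolding tf_eq_def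
  proof (intro ballI)
    fix c p i k assume h: "c \<in> charts M" "p \<in> chart_dom M c" and "i \<in> idx M" "k \<in> idx M"
    then obtain j a l b where i: "i = (j, a)" "k = (l, b)" and j: "j \<in> K" "a \<in> idx (Y j)" and l: "l \<in> K" "b \<in> idx (Y l)"
      by (auto simp: prod_manifold_sel)
    have A: "cobr (G i) (x i) \<in> tensor_square s (underlying (G i))" if "i \<in> J" for i
      by (rule lie_bialg.cobr_tensor[OF factor[OF that] W_component[OF x that]])
    have "vf_tf_bracket (Y j) (\<sigma> j (x j)) (\<pi> j) (c j) (p j) a b = act (underlying (G j)) (\<sigma> j) (cobr (G j) (x j)) (c j) (p j) a b"
      if "j = l"
      using spaces[OF j(1)] W_component[OF x in_J[OF j(1)]] factor_charts[OF h(1) j(1)] factor_dom[OF h(2) j(1)] j l that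
      by (simp add: signed_poisson_space_def tf_eq_def)
    moreover have "act W \<Lambda> (cobr PG x) c p i k =
      prod_tf (\<lambda>i. act (underlying (G i)) (\<sigma> i) (cobr (G i) (x i))) c p (j, a) (l, b)"
      unfolding i prod_bialg_sel(3) by (rule act_prod_tensor[OF A h j l])
    ultimately show "vf_tf_bracket M (\<Lambda> x) (prod_tf \<pi>) c p i k = act W \<Lambda> (cobr PG x) c p i k"
      unfolding i by (simp add: prod_action_def vf_tf_bracket_prod[OF h j l]) (simp add: prod_tf_def)
  qed
  then show ?thesis
    using lie_bialgebra_prod prod_signed_action poisson_structure_prod spaces
    by (simp add: signed_poisson_space_def prod_bialg_sel)
qed

text \<open>On the diagonal blocks the correction term is \<open>\<sigma>\<^sub>l(p\<^sub>l(t))\<close>, which is zero for a mixed \<open>t\<close>.\<close>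

lemma act_mixed_diagonal:
  assumes t: "push W s (underlying (G l)) (\<lambda>x. x l) t = 0"
    and h: "c \<in> charts M" "p \<in> chart_dom M c" and l: "l \<in> K" "a \<in> idx (Y l)" "b \<in> idx (Y l)"
  shows "act W \<Lambda> t c p (l, a) (l, b) = 0"
proof -
  interpret action_chart s "G l" \<epsilon> "Y l" "\<sigma> l" "c l" by (rule factor_action_chart[OF h(1) l(1)])
  have "push W s V (\<lambda>x. x l) t (frame (p l) a) (frame (p l) b) = 0" by (simp add: t)
  moreover have "cut_to W (\<lambda>x. frame (p l) a (x l)) = cut_to W (\<lambda>x. \<Lambda> x c p (l, a))" for a
    using W_component[OF _ in_J[OF l(1)]] by (auto simp: cut_to_def frame_apply action_apply fun_eq_iff)
  ultimately show ?thesis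
    using frame_in_dual[OF factor_dom[OF h(2) l(1)]] l by (simp add: push_def act_def)
qed

text \<open>Linearity of \<open>\<tau> \<mapsto> \<Lambda>(\<tau>)\<close>: the diagonal blocks add up to \<open>- \<epsilon> \<Lambda>(r)\<close> and \<open>\<epsilon> \<Lambda>(t)\<close> is added to them.\<close>

lemma prod_tf_quasitriangular:
  assumes r: "\<And>j. j \<in> J \<Longrightarrow> r j \<in> tensor_square s (underlying (G j))"
    and eq: "\<And>j. j \<in> K \<Longrightarrow> tf_eq (Y j) (\<pi> j) (\<lambda>c p a b. - \<epsilon> * act (underlying (G j)) (\<sigma> j) (r j) c p a b)"
  shows "tf_eq M (\<lambda>c p a b. prod_tf \<pi> c p a b + \<epsilon> * act W \<Lambda> t c p a b)
    (\<lambda>c p a b. - \<epsilon> * act W \<Lambda> (prod_tensor s J G r - t) c p a b)"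
  unfolding tf_eq_def
proof (intro ballI)
  fix c p i k assume h: "c \<in> charts M" "p \<in> chart_dom M c" and "i \<in> idx M" "k \<in> idx M"
  then obtain j a l b where i: "i = (j, a)" "k = (l, b)" and j: "j \<in> K" "a \<in> idx (Y j)" and l: "l \<in> K" "b \<in> idx (Y l)"
    by (auto simp: prod_manifold_sel)
  have "\<pi> j (c j) (p j) a b = - \<epsilon> * act (underlying (G j)) (\<sigma> j) (r j) (c j) (p j) a b" if "j = l"
    using eq[OF j(1)] factor_charts[OF h(1) j(1)] factor_dom[OF h(2) j(1)] j l that by (simp add: tf_eq_def)
  moreover have "act W \<Lambda> (prod_tensor s J G r) c p i k =
      prod_tf (\<lambda>i. act (underlying (G i)) (\<sigma> i) (r i)) c p (j, a) (l, b)"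
    unfolding i by (rule act_prod_tensor[OF r h j l])
  ultimately have e1: "prod_tf \<pi> c p i k = - \<epsilon> * act W \<Lambda> (prod_tensor s J G r) c p i k"
    unfolding i by (simp add: prod_tf_def)
  have e2: "act W \<Lambda> (prod_tensor s J G r - t) c p i k = act W \<Lambda> (prod_tensor s J G r) c p i k - act W \<Lambda> t c p i k"
    by (simp add: act_def)
  show "prod_tf \<pi> c p i k + \<epsilon> * act W \<Lambda> t c p i k = - \<epsilon> * act W \<Lambda> (prod_tensor s J G r - t) c p i k"
    unfolding e1 e2 by (simp add: algebra_simps)
qed

end

section \<open>Mixed products\<close>

context
  fixes s :: "'k::real_normed_field \<Rightarrow> 'v::ab_group_add \<Rightarrow> 'v" and \<epsilon> :: 'k and J :: "nat set"
    and G :: "nat \<Rightarrow> ('k, 'v) bialg" and t :: "('k, nat \<Rightarrow> 'v) tensor2"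
    and Y :: "nat \<Rightarrow> ('a, 'c, 'i, 'k) manifold"
    and \<pi> :: "nat \<Rightarrow> ('a, 'c, 'i, 'k) tfield" and \<sigma> :: "nat \<Rightarrow> 'v \<Rightarrow> ('a, 'c, 'i, 'k) vfield"
    and R :: "(nat \<Rightarrow> 'a, nat \<Rightarrow> 'c, nat \<times> 'i, 'k) tfield"
  assumes J: "finite J" and vs: "vector_space s" and sign: "\<epsilon> * \<epsilon> = 1"
    and spaces: "\<And>j. j \<in> J \<Longrightarrow> signed_poisson_space \<epsilon> s (G j) (Y j) (\<pi> j) (\<sigma> j)"
    and t: "mixed_twisting_element s J G t"
    and R: "R = (\<lambda>c p a b. prod_tf \<pi> c p a b + \<epsilon> * act (prod_space J G) (prod_action \<sigma>) t c p a b)"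
begin

lemma subfamily:
  assumes K: "K \<subseteq> J" shows "poisson_family K Y s J G \<epsilon> \<pi> \<sigma>"
proof (intro poisson_family.intro manifold_family.intro prod_lie_bialg.intro poisson_family_axioms.intro)
  show "is_manifold (Y j)" if "j \<in> K" for j
    using spaces[of j] that K by (auto simp: signed_poisson_space_def poisson_structure_def)
  show "lie_bialg s (G j)" if "j \<in> J" for j
    using spaces[OF that] by (simp add: lie_bialg_def signed_poisson_space_def)
  show "signed_poisson_space \<epsilon> s (G j) (Y j) (\<pi> j) (\<sigma> j)" if "j \<in> K" for j
    using spaces that K by blast
qed (use J vs sign K in \<open>auto intro: finite_subset\<close>)

text \<open>The elements of the factors outside \<open>K\<close> act on the product over \<open>K\<close> by zero.\<close>

lemma subproduct_twist:
  assumes "K \<subseteq> J"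
  shows "signed_poisson_space \<epsilon> (prod_scale s) (twist (prod_scale s) (prod_bialg s J G) t) (prod_manifold K Y) R (prod_action \<sigma>)"
proof -
  interpret poisson_family K Y s J G \<epsilon> \<pi> \<sigma> by (rule subfamily[OF assms])
  have "twisting_element (prod_scale s) (prod_bialg s J G) t"
    using t by (simp add: mixed_twisting_element_def)
  from signed_poisson_space_twist[OF prod_signed_poisson_space sign this] show ?thesis
    unfolding R prod_bialg_sel(1) .
qed

lemma subproduct_poisson: "K \<subseteq> J \<Longrightarrow> poisson_structure (prod_manifold K Y) R"
  using subproduct_twist by (simp add: signed_poisson_space_def)

lemma R_local:
  "j \<in> K \<Longrightarrow> l \<in> K \<Longrightarrow> R (restrict c K) (restrict p K) (j, a) (l, b) = R c p (j, a) (l, b)"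
  by (simp add: R prod_tf_def act_def prod_action_def prod_vf_def)

lemma pair_mixed:
  assumes ij: "i \<in> J" "j \<in> J" shows "mixed_product_pair Y i j R"
  unfolding mixed_product_pair_def
proof (intro conjI ballI)
  have sub: "{i, j} \<subseteq> J" using ij by simp
  show "poisson_structure (prod_manifold {i, j} Y) R" by (rule subproduct_poisson[OF sub])
  fix l assume l: "l \<in> {i, j}"
  interpret poisson_family "{i, j}" Y s J G \<epsilon> \<pi> \<sigma> by (rule subfamily[OF sub])
  have P: "poisson_structure (Y l) (\<pi> l)" using spaces[OF l] by (simp add: signed_poisson_space_def)
  then have Q: "tensor_field (Y l) (\<pi> l)" by (simp add: poisson_structure_def bivector_field_def)
  have mixed: "push W s (underlying (G l)) (\<lambda>x. x l) t = 0"
    using t in_J[OF l] by (simp add: mixed_twisting_element_def)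
  have "projects_to (prod_manifold {i, j} Y) (Y l) (\<lambda>p. p l) R (\<pi> l)"
  proof (rule projects_to_factor[OF l Q])
    fix c p a b assume "c \<in> charts M" "p \<in> chart_dom M c" "a \<in> idx (Y l)" "b \<in> idx (Y l)"
    from act_mixed_diagonal[OF mixed this(1,2) l this(3,4)] show "R c p (l, a) (l, b) = \<pi> l (c l) (p l) a b"
      by (simp add: R prod_tf_def)
  qed
  with P show "\<exists>Q. poisson_structure (Y l) Q \<and> projects_to (prod_manifold {i, j} Y) (Y l) (\<lambda>p. p l) R Q"
    by (intro exI[of _ "\<pi> l"] conjI)
qed

theorem mixed_product: "mixed_product_poisson J Y R"
  unfolding mixed_product_poisson_def
proof (intro conjI ballI impI)
  show "poisson_structure (prod_manifold J Y) R" by (rule subproduct_poisson) simp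
  fix i j assume ij: "i \<in> J" "j \<in> J" "i < j"
  then have sub: "{i, j} \<subseteq> J" by simp
  interpret poisson_family "{i, j}" Y s J G \<epsilon> \<pi> \<sigma> by (rule subfamily[OF sub])
  interpret J: poisson_family J Y s J G \<epsilon> \<pi> \<sigma> by (rule subfamily) simp
  have "tensor_field M R"
    using subproduct_poisson[OF sub] by (simp add: poisson_structure_def bivector_field_def)
  then have "projects_to (prod_manifold J Y) M (\<lambda>p. restrict p {i, j}) R R"
    by (rule projects_to_subproduct[OF J.manifold_family_axioms sub]) (rule R_local)
  with pair_mixed[OF ij(1,2)] show "\<exists>Q. mixed_product_pair Y i j Q \<and>
    projects_to (prod_manifold J Y) (prod_manifold {i, j} Y) (\<lambda>p. restrict p {i, j}) R Q"
    by (intro exI[of _ R] conjI)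
qed

theorem mixed_quasitriangular:
  assumes "\<And>j. j \<in> J \<Longrightarrow> quasitriangular s (G j) (r j)"
    and "\<And>j. j \<in> J \<Longrightarrow> tf_eq (Y j) (\<pi> j) (\<lambda>c p a b. - \<epsilon> * act (underlying (G j)) (\<sigma> j) (r j) c p a b)"
  shows "tf_eq (prod_manifold J Y) R
    (\<lambda>c p a b. - \<epsilon> * act (prod_space J G) (prod_action \<sigma>) (prod_tensor s J G r - t) c p a b)"
proof -
  interpret poisson_family J Y s J G \<epsilon> \<pi> \<sigma> by (rule subfamily) simp
  show ?thesis
    unfolding R using assms by (intro prod_tf_quasitriangular) (simp_all add: quasitriangular_def)
qed

end

theorem proposition3p4:
  fixes s :: "'k::real_normed_field \<Rightarrow> 'v::ab_group_add \<Rightarrow> 'v"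
    and n :: nat
    and G :: "nat \<Rightarrow> ('k, 'v) bialg"
    and t :: "('k, nat \<Rightarrow> 'v) tensor2"
    and Y :: "nat \<Rightarrow> ('a, 'c, 'i, 'k) manifold"
    and \<pi> :: "nat \<Rightarrow> ('a, 'c, 'i, 'k) tfield"
    and \<sigma> :: "nat \<Rightarrow> 'v \<Rightarrow> ('a, 'c, 'i, 'k) vfield"
  assumes "n \<ge> 2"
    and "\<forall>j<n. lie_bialgebra s (G j)"
    and "mixed_twisting_element s {..<n} G t"
  shows
    "((\<forall>j<n. left_poisson_space s (G j) (Y j) (\<pi> j) (\<sigma> j)) \<longrightarrow>
       (let g = prod_bialg s {..<n} G;
            M = prod_manifold {..<n} Y;
            \<Lambda> = prod_action \<sigma>;
            \<pi>Y = prod_tf \<pi> + act (underlying g) \<Lambda> t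
        in mixed_product_poisson {..<n} Y \<pi>Y \<and>
           left_poisson_space (prod_scale s) (twist (prod_scale s) g t) M \<pi>Y \<Lambda> \<and>
           (\<forall>r. (\<forall>j<n. quasitriangular s (G j) (r j) \<and>
                        tf_eq (Y j) (\<pi> j) (- act (underlying (G j)) (\<sigma> j) (r j))) \<longrightarrow>
                tf_eq M \<pi>Y (- act (underlying g) \<Lambda> (prod_tensor s {..<n} G r - t))))) \<and>
     ((\<forall>j<n. right_poisson_space s (G j) (Y j) (\<pi> j) (\<sigma> j)) \<longrightarrow>
       (let g = prod_bialg s {..<n} G;
            M = prod_manifold {..<n} Y;
            \<rho> = prod_action \<sigma>;
            \<pi>Y = prod_tf \<pi> - act (underlying g) \<rho> t
        in mixed_product_poisson {..<n} Y \<pi>Y \<and>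
           right_poisson_space (prod_scale s) (twist (prod_scale s) g t) M \<pi>Y \<rho> \<and>
           (\<forall>r. (\<forall>j<n. quasitriangular s (G j) (r j) \<and>
                        tf_eq (Y j) (\<pi> j) (act (underlying (G j)) (\<sigma> j) (r j))) \<longrightarrow>
                tf_eq M \<pi>Y (act (underlying g) \<rho> (prod_tensor s {..<n} G r - t)))))"
proof -
  have vs: "vector_space s" using assms(1) assms(2)[rule_format, of 0] by (simp add: lie_bialgebra_def)
  have g: "underlying (prod_bialg s {..<n} G) = prod_space {..<n} G" by (simp add: prod_bialg_def)
  have fin: "finite {..<n}" by simp
  have left: "mixed_product_poisson {..<n} Y R \<and>
      left_poisson_space (prod_scale s) (twist (prod_scale s) (prod_bialg s {..<n} G) t) (prod_manifold {..<n} Y) R (prod_action \<sigma>) \<and>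
      (\<forall>r. (\<forall>j<n. quasitriangular s (G j) (r j) \<and>
                  tf_eq (Y j) (\<pi> j) (- act (underlying (G j)) (\<sigma> j) (r j))) \<longrightarrow>
          tf_eq (prod_manifold {..<n} Y) R (- act (prod_space {..<n} G) (prod_action \<sigma>) (prod_tensor s {..<n} G r - t)))"
    if "\<forall>j<n. left_poisson_space s (G j) (Y j) (\<pi> j) (\<sigma> j)"
      and R: "R = prod_tf \<pi> + act (prod_space {..<n} G) (prod_action \<sigma>) t" for R
  proof -
    have spaces: "signed_poisson_space 1 s (G j) (Y j) (\<pi> j) (\<sigma> j)" if "j \<in> {..<n}" for j
      using \<open>\<forall>j<n. left_poisson_space s (G j) (Y j) (\<pi> j) (\<sigma> j)\<close> that by (simp add: left_poisson_space_iff)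
    have R': "R = (\<lambda>c p a b. prod_tf \<pi> c p a b + 1 * act (prod_space {..<n} G) (prod_action \<sigma>) t c p a b)"
      by (intro ext) (simp add: R)
    have neg: "- T = (\<lambda>c p a b. - 1 * T c p a b)" for T :: "('x, 'y, 'z, 'k) tfield"
      by (intro ext) simp
    show ?thesis
    proof (intro conjI allI impI)
      show "mixed_product_poisson {..<n} Y R"
        by (rule mixed_product[OF fin vs mult_1_left spaces assms(3) R'])
      show "left_poisson_space (prod_scale s) (twist (prod_scale s) (prod_bialg s {..<n} G) t)
          (prod_manifold {..<n} Y) R (prod_action \<sigma>)"
        unfolding left_poisson_space_iff
        by (rule subproduct_twist[OF fin vs mult_1_left spaces assms(3) R' subset_refl])
      fix r assume r: "\<forall>j<n. quasitriangular s (G j) (r j) \<and>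
        tf_eq (Y j) (\<pi> j) (- act (underlying (G j)) (\<sigma> j) (r j))"
      show "tf_eq (prod_manifold {..<n} Y) R
          (- act (prod_space {..<n} G) (prod_action \<sigma>) (prod_tensor s {..<n} G r - t))"
        unfolding neg
        by (rule mixed_quasitriangular[OF fin vs mult_1_left spaces assms(3) R'])
           (use r[unfolded neg] in simp_all)
    qed
  qed
  have right: "mixed_product_poisson {..<n} Y R \<and>
      right_poisson_space (prod_scale s) (twist (prod_scale s) (prod_bialg s {..<n} G) t) (prod_manifold {..<n} Y) R (prod_action \<sigma>) \<and>
      (\<forall>r. (\<forall>j<n. quasitriangular s (G j) (r j) \<and>
                  tf_eq (Y j) (\<pi> j) (act (underlying (G j)) (\<sigma> j) (r j))) \<longrightarrow>
          tf_eq (prod_manifold {..<n} Y) R (act (prod_space {..<n} G) (prod_action \<sigma>) (prod_tensor s {..<n} G r - t)))"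
    if "\<forall>j<n. right_poisson_space s (G j) (Y j) (\<pi> j) (\<sigma> j)"
      and R: "R = prod_tf \<pi> - act (prod_space {..<n} G) (prod_action \<sigma>) t" for R
  proof -
    have spaces: "signed_poisson_space (- 1) s (G j) (Y j) (\<pi> j) (\<sigma> j)" if "j \<in> {..<n}" for j
      using \<open>\<forall>j<n. right_poisson_space s (G j) (Y j) (\<pi> j) (\<sigma> j)\<close> that by (simp add: right_poisson_space_iff)
    have R': "R = (\<lambda>c p a b. prod_tf \<pi> c p a b + - 1 * act (prod_space {..<n} G) (prod_action \<sigma>) t c p a b)"
      by (intro ext) (simp add: R)
    have sign: "- 1 * - 1 = (1 :: 'k)" by simp
    have pos: "T = (\<lambda>c p a b. - (- 1) * T c p a b)" for T :: "('x, 'y, 'z, 'k) tfield"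
      by (intro ext) simp
    show ?thesis
    proof (intro conjI allI impI)
      show "mixed_product_poisson {..<n} Y R"
        by (rule mixed_product[OF fin vs sign spaces assms(3) R'])
      show "right_poisson_space (prod_scale s) (twist (prod_scale s) (prod_bialg s {..<n} G) t)
          (prod_manifold {..<n} Y) R (prod_action \<sigma>)"
        unfolding right_poisson_space_iff
        by (rule subproduct_twist[OF fin vs sign spaces assms(3) R' subset_refl])
      fix r assume r: "\<forall>j<n. quasitriangular s (G j) (r j) \<and>
        tf_eq (Y j) (\<pi> j) (act (underlying (G j)) (\<sigma> j) (r j))"
      show "tf_eq (prod_manifold {..<n} Y) R
          (act (prod_space {..<n} G) (prod_action \<sigma>) (prod_tensor s {..<n} G r - t))"
        by (subst pos, rule mixed_quasitriangular[OF fin vs sign spaces assms(3) R'])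
           (use r in simp_all)
    qed
  qed
  show ?thesis
    unfolding Let_def g by (intro conjI[OF impI impI] left right refl)
qed

end
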